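(* For repetitive tiling spaces $\Omega$ of finite local complexity, the profinite fundamental group $\hat\pi_1(\Omega)$ is a topological invariant: if $\Omega=\varprojlim\Gamma_n$ and $\Omega'=\varprojlim\Gamma'_n$ are homeomorphic, then $\hat\pi_1(\Omega)\cong\hat\pi_1(\Omega')$; in particular, $\hat\pi_1(\Omega)$ is, up to isomorphism, independent of how $\Omega$ is written as an inverse limit.
   Context: A tiling of $\mathbb{R}^d$ has finite local complexity if it has finitely many patches of each bounded diameter up to translation, and is repetitive if each patch recurs in every ball of some radius depending on the patch; $\Omega$ is its hull (all tilings whose patches occur in it up to translation), with two tilings close if they agree on a large ball about the origin up to a small translation. $\Omega$ is written as an inverse limit of approximants $\Gamma_n$, finite connected CW complexes with bonding maps $\sigma_{n+1}:\Gamma_{n+1}\to\Gamma_n$ and compatible base points, in which a point of $\Gamma_n$ describes the tiling in a neighborhood of the origin that grows to all of $\mathbb{R}^d$ as $n\to\infty$. $\hat\pi_1(\Omega):=\varprojlim\hat\pi_1(\Gamma_n)$, where $\hat\pi_1(\Gamma_n)=\varprojlim\pi_1(\Gamma_n)/N$ (over finite-index normal subgroups $N$) is the profinite completion of $\pi_1(\Gamma_n)$, and the bonding maps are induced by $(\sigma_{n+1})_*$. A priori this depends on the inverse limit presentation. *)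

theory Defs
  imports "HOL-Analysis.Analysis" "HOL-Algebra.Coset"
begin

section \<open>Tilings and their hulls\<close>

text \<open>A tile is a support together with a label. Labels distinguish tiles of the same shape and
  are unaffected by translations.\<close>

type_synonym ('a, 'l) tile = "'a set \<times> 'l"

definition tiling :: "('a::euclidean_space, 'l) tile set \<Rightarrow> bool" where
  "tiling T \<longleftrightarrow>
     (\<forall>t\<in>T. compact (fst t) \<and> fst t \<noteq> {} \<and> closure (interior (fst t)) = fst t) \<and>
     (\<Union>t\<in>T. fst t) = UNIV \<and>
     (\<forall>s\<in>T. \<forall>t\<in>T. s \<noteq> t \<longrightarrow> interior (fst s) \<inter> interior (fst t) = {})"

definition translate :: "'a::euclidean_space \<Rightarrow> ('a, 'l) tile set \<Rightarrow> ('a, 'l) tile set" where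
  "translate v T = (\<lambda>(S, l). ((+) v ` S, l)) ` T"

definition patch_of :: "('a::euclidean_space, 'l) tile set \<Rightarrow> ('a, 'l) tile set \<Rightarrow> bool" where
  "patch_of P T \<longleftrightarrow> finite P \<and> P \<subseteq> T"

definition patch_support :: "('a::euclidean_space, 'l) tile set \<Rightarrow> 'a set" where
  "patch_support P = (\<Union>t\<in>P. fst t)"

definition finite_local_complexity :: "('a::euclidean_space, 'l) tile set \<Rightarrow> bool" where
  "finite_local_complexity T \<longleftrightarrow>
     (\<forall>r. \<exists>F. finite F \<and>
        (\<forall>P. patch_of P T \<and> diameter (patch_support P) \<le> r \<longrightarrow> (\<exists>Q\<in>F. \<exists>v. P = translate v Q)))"

definition repetitive :: "('a::euclidean_space, 'l) tile set \<Rightarrow> bool" where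
  "repetitive T \<longleftrightarrow>
     (\<forall>P. patch_of P T \<longrightarrow>
        (\<exists>R. \<forall>y. \<exists>v. patch_of (translate v P) T \<and> patch_support (translate v P) \<subseteq> cball y R))"

definition tiling_hull :: "('a::euclidean_space, 'l) tile set \<Rightarrow> ('a, 'l) tile set set" where
  "tiling_hull T = {S. tiling S \<and> (\<forall>P. patch_of P S \<longrightarrow> (\<exists>v. patch_of (translate v P) T))}"

definition agree_on :: "real \<Rightarrow> ('a::euclidean_space, 'l) tile set \<Rightarrow> ('a, 'l) tile set \<Rightarrow> bool" where
  "agree_on r S S' \<longleftrightarrow>
     {t\<in>S. fst t \<inter> ball 0 r \<noteq> {}} = {t\<in>S'. fst t \<inter> ball 0 r \<noteq> {}}"

text \<open>\<open>tiling_nbhd T \<epsilon> S\<close> consists of the tilings in the hull of \<open>T\<close> that agree with \<open>S\<close> on the ball of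
  radius \<open>1/\<epsilon>\<close> about the origin up to a translation of length less than \<open>\<epsilon>\<close>.\<close>

definition tiling_nbhd ::
  "('a::euclidean_space, 'l) tile set \<Rightarrow> real \<Rightarrow> ('a, 'l) tile set \<Rightarrow> ('a, 'l) tile set set" where
  "tiling_nbhd T \<epsilon> S = {S' \<in> tiling_hull T. \<exists>v. norm v < \<epsilon> \<and> agree_on (1 / \<epsilon>) S (translate v S')}"

definition hull_topology :: "('a::euclidean_space, 'l) tile set \<Rightarrow> ('a, 'l) tile set topology" where
  "hull_topology T =
     topology (\<lambda>U. U \<subseteq> tiling_hull T \<and> (\<forall>S\<in>U. \<exists>\<epsilon>>0. tiling_nbhd T \<epsilon> S \<subseteq> U))"

lemma agree_on_mono:
  assumes "agree_on r S S'" "r' \<le> r" shows "agree_on r' S S'"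
proof -
  have *: "ball 0 r' \<subseteq> ball (0::'a) r"
    using assms(2) by (simp add: subset_ball)
  have "(t \<in> S) = (t \<in> S')" if "fst t \<inter> ball 0 r' \<noteq> {}" for t
  proof -
    have "fst t \<inter> ball 0 r \<noteq> {}" using that * by blast
    then show ?thesis using assms(1) unfolding agree_on_def by blast
  qed
  then show ?thesis unfolding agree_on_def by blast
qed

lemma tiling_nbhd_mono:
  assumes "0 < \<epsilon>" "\<epsilon> \<le> \<delta>" shows "tiling_nbhd T \<epsilon> S \<subseteq> tiling_nbhd T \<delta> S"
proof -
  have "1 / \<delta> \<le> 1 / \<epsilon>" using assms by (simp add: frac_le)
  then show ?thesis
    using assms(2) agree_on_mono less_le_trans unfolding tiling_nbhd_def by blast
qed

lemma openin_hull_topology: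
  "openin (hull_topology T) U \<longleftrightarrow> U \<subseteq> tiling_hull T \<and> (\<forall>S\<in>U. \<exists>\<epsilon>>0. tiling_nbhd T \<epsilon> S \<subseteq> U)"
proof -
  define P where "P = (\<lambda>U. U \<subseteq> tiling_hull T \<and> (\<forall>S\<in>U. \<exists>\<epsilon>>0. tiling_nbhd T \<epsilon> S \<subseteq> U))"
  have "istopology P"
    unfolding istopology_def
  proof (intro conjI allI impI)
    fix U V assume U: "P U" and V: "P V"
    have "\<exists>\<epsilon>>0. tiling_nbhd T \<epsilon> S \<subseteq> U \<inter> V" if S: "S \<in> U \<inter> V" for S
    proof -
      obtain a where a: "a > 0" "tiling_nbhd T a S \<subseteq> U"
        using U S unfolding P_def by blast
      obtain b where b: "b > 0" "tiling_nbhd T b S \<subseteq> V"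
        using V S unfolding P_def by blast
      have "min a b > 0" using a b by simp
      moreover have "tiling_nbhd T (min a b) S \<subseteq> U"
        by (rule subset_trans[OF tiling_nbhd_mono a(2)]) (use \<open>min a b > 0\<close> in auto)
      moreover have "tiling_nbhd T (min a b) S \<subseteq> V"
        by (rule subset_trans[OF tiling_nbhd_mono b(2)]) (use \<open>min a b > 0\<close> in auto)
      ultimately show ?thesis by blast
    qed
    moreover have "U \<inter> V \<subseteq> tiling_hull T" using U unfolding P_def by blast
    ultimately show "P (U \<inter> V)" unfolding P_def by blast
  next
    fix K assume K: "\<forall>U\<in>K. P U"
    have "\<exists>\<epsilon>>0. tiling_nbhd T \<epsilon> S \<subseteq> \<Union>K" if S: "S \<in> \<Union>K" for S
    proof -
      obtain U where U: "U \<in> K" "S \<in> U" using S by blast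
      then have "\<exists>\<epsilon>>0. tiling_nbhd T \<epsilon> S \<subseteq> U" using K unfolding P_def by blast
      then show ?thesis using Union_upper[OF U(1)] by (meson subset_trans)
    qed
    moreover have "\<Union>K \<subseteq> tiling_hull T" using K unfolding P_def by blast
    ultimately show "P (\<Union>K)" unfolding P_def by blast
  qed
  then have "openin (topology P) = P" by (rule topology_inverse')
  then show ?thesis
    unfolding hull_topology_def P_def[symmetric] by (simp add: P_def)
qed

lemma topspace_hull_topology [simp]: "topspace (hull_topology T) = tiling_hull T"
proof
  show "topspace (hull_topology T) \<subseteq> tiling_hull T"
    using openin_hull_topology openin_topspace by blast
  have "openin (hull_topology T) (tiling_hull T)"
    unfolding openin_hull_topology tiling_nbhd_def using zero_less_one by blast
  then show "tiling_hull T \<subseteq> topspace (hull_topology T)"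
    by (rule openin_subset)
qed


section \<open>Finite CW complexes\<close>

text \<open>The topology \<open>Euclidean_space n\<close> lives on the sequences that vanish from index \<open>n\<close> on.\<close>

definition closed_disc :: "nat \<Rightarrow> (nat \<Rightarrow> real) set" where
  "closed_disc n = {u \<in> topspace (Euclidean_space n). (\<Sum>i<n. (u i)\<^sup>2) \<le> 1}"

definition open_disc :: "nat \<Rightarrow> (nat \<Rightarrow> real) set" where
  "open_disc n = {u \<in> topspace (Euclidean_space n). (\<Sum>i<n. (u i)\<^sup>2) < 1}"

text \<open>\<open>E\<close> is the set of open cells. As there are finitely many of them, closure-finiteness and
  the weak topology condition hold automatically.\<close>

definition finite_CW_complex :: "'b topology \<Rightarrow> bool" where
  "finite_CW_complex X \<longleftrightarrow>
     Hausdorff_space X \<and>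
     (\<exists>(E :: 'b set set) (dim :: 'b set \<Rightarrow> nat) (\<Phi> :: 'b set \<Rightarrow> (nat \<Rightarrow> real) \<Rightarrow> 'b).
        finite E \<and> \<Union>E = topspace X \<and> disjoint E \<and>
        (\<forall>e\<in>E.
           continuous_map (subtopology (Euclidean_space (dim e)) (closed_disc (dim e))) X (\<Phi> e) \<and>
           homeomorphic_map (subtopology (Euclidean_space (dim e)) (open_disc (dim e)))
             (subtopology X e) (\<Phi> e) \<and>
           \<Phi> e ` (closed_disc (dim e) - open_disc (dim e)) \<subseteq> \<Union>{c\<in>E. dim c < dim e}))"


section \<open>Inverse limits of sequences\<close>

text \<open>In an inverse sequence \<open>X 0, X 1, \<dots>\<close> the bonding map \<open>f (Suc n)\<close> goes from \<open>X (Suc n)\<close> to \<open>X n\<close>;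
  the value \<open>f 0\<close> is not used.\<close>

definition threads :: "(nat \<Rightarrow> 'b set) \<Rightarrow> (nat \<Rightarrow> 'b \<Rightarrow> 'b) \<Rightarrow> (nat \<Rightarrow> 'b) set" where
  "threads A f = {z. (\<forall>n. z n \<in> A n) \<and> (\<forall>n. f (Suc n) (z (Suc n)) = z n)}"

definition invlim_topology :: "(nat \<Rightarrow> 'b topology) \<Rightarrow> (nat \<Rightarrow> 'b \<Rightarrow> 'b) \<Rightarrow> (nat \<Rightarrow> 'b) topology" where
  "invlim_topology X f =
     subtopology (product_topology X UNIV) (threads (\<lambda>n. topspace (X n)) f)"

definition invlim_group :: "(nat \<Rightarrow> 'g monoid) \<Rightarrow> (nat \<Rightarrow> 'g \<Rightarrow> 'g) \<Rightarrow> (nat \<Rightarrow> 'g) monoid" where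
  "invlim_group G f =
     \<lparr>carrier = threads (\<lambda>n. carrier (G n)) f,
      mult = (\<lambda>u v n. u n \<otimes>\<^bsub>G n\<^esub> v n),
      one = (\<lambda>n. \<one>\<^bsub>G n\<^esub>)\<rparr>"


section \<open>The fundamental group\<close>

text \<open>Paths are functions on the reals of which only the values on \<open>{0..1}\<close> matter. The library
  operator for joining paths is restricted to type class topologies, hence \<open>path_join\<close>.\<close>

definition loops :: "'b topology \<Rightarrow> 'b \<Rightarrow> (real \<Rightarrow> 'b) set" where
  "loops X x = {p. pathin X p \<and> p 0 = x \<and> p 1 = x}"

definition loop_homotopy :: "'b topology \<Rightarrow> 'b \<Rightarrow> (real \<Rightarrow> 'b) rel" where
  "loop_homotopy X x =
     {(p, q). p \<in> loops X x \<and> q \<in> loops X x \<and>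
        homotopic_with (\<lambda>r. r 0 = x \<and> r 1 = x) (top_of_set {0..1}) X p q}"

definition path_join :: "(real \<Rightarrow> 'b) \<Rightarrow> (real \<Rightarrow> 'b) \<Rightarrow> real \<Rightarrow> 'b" where
  "path_join p q = (\<lambda>t. if t \<le> 1/2 then p (2 * t) else q (2 * t - 1))"

definition fundamental_group :: "'b topology \<Rightarrow> 'b \<Rightarrow> (real \<Rightarrow> 'b) set monoid" where
  "fundamental_group X x =
     \<lparr>carrier = loops X x // loop_homotopy X x,
      mult = (\<lambda>A B. \<Union>p\<in>A. \<Union>q\<in>B. loop_homotopy X x `` {path_join p q}),
      one = loop_homotopy X x `` {\<lambda>_. x}\<rparr>"

text \<open>The homomorphism into the fundamental group of \<open>Y\<close> at \<open>y\<close> induced by a map \<open>f\<close>.\<close>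

definition induced_fundamental ::
  "'c topology \<Rightarrow> 'c \<Rightarrow> ('b \<Rightarrow> 'c) \<Rightarrow> (real \<Rightarrow> 'b) set \<Rightarrow> (real \<Rightarrow> 'c) set" where
  "induced_fundamental Y y f A = (\<Union>p\<in>A. loop_homotopy Y y `` {f \<circ> p})"


section \<open>Profinite completion\<close>

definition finite_index_normal :: "'g monoid \<Rightarrow> 'g set set" where
  "finite_index_normal G = {N. N \<lhd> G \<and> finite (rcosets\<^bsub>G\<^esub> N)}"

text \<open>For \<open>N \<subseteq> M\<close> the projection from \<open>G Mod N\<close> to \<open>G Mod M\<close> sends a coset \<open>C\<close> to \<open>M <#>\<^bsub>G\<^esub> C\<close>.\<close>

definition profinite_completion :: "'g monoid \<Rightarrow> ('g set \<Rightarrow> 'g set) monoid" where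
  "profinite_completion G =
     \<lparr>carrier = {u \<in> (\<Pi>\<^sub>E N\<in>finite_index_normal G. carrier (G Mod N)).
                  \<forall>N\<in>finite_index_normal G. \<forall>M\<in>finite_index_normal G.
                    N \<subseteq> M \<longrightarrow> M <#>\<^bsub>G\<^esub> u N = u M},
      mult = (\<lambda>u v. \<lambda>N\<in>finite_index_normal G. u N \<otimes>\<^bsub>G Mod N\<^esub> v N),
      one = (\<lambda>N\<in>finite_index_normal G. \<one>\<^bsub>G Mod N\<^esub>)\<rparr>"

definition profinite_topology :: "'g monoid \<Rightarrow> ('g set \<Rightarrow> 'g set) topology" where
  "profinite_topology G =
     subtopology
       (product_topology (\<lambda>N. discrete_topology (carrier (G Mod N))) (finite_index_normal G))
       (carrier (profinite_completion G))"

text \<open>The map of completions induced by a homomorphism \<open>\<phi>\<close> from \<open>G\<close> to \<open>H\<close>: its component at \<open>N\<close> comes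
  from the injection of \<open>G\<close> modulo the preimage of \<open>N\<close> into \<open>H Mod N\<close>.\<close>

definition induced_profinite ::
  "'g monoid \<Rightarrow> 'h monoid \<Rightarrow> ('g \<Rightarrow> 'h) \<Rightarrow> ('g set \<Rightarrow> 'g set) \<Rightarrow> 'h set \<Rightarrow> 'h set" where
  "induced_profinite G H \<phi> u =
     (\<lambda>N\<in>finite_index_normal H. N <#>\<^bsub>H\<^esub> (\<phi> ` u (\<phi> -` N \<inter> carrier G)))"

definition topological_group_isomorphic ::
  "'g monoid \<Rightarrow> 'g topology \<Rightarrow> 'h monoid \<Rightarrow> 'h topology \<Rightarrow> bool" where
  "topological_group_isomorphic G X H Y \<longleftrightarrow> (\<exists>h. h \<in> iso G H \<and> homeomorphic_map X Y h)"


section \<open>Inverse limit presentations and the profinite fundamental group\<close>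

text \<open>The map \<open>p\<close> identifies the hull of \<open>T\<close> with the inverse limit of the \<open>\<Gamma> n\<close>. The last clause says
  that \<open>p S n\<close> determines \<open>S\<close> on a ball about the origin whose radius tends to infinity with \<open>n\<close>.\<close>

definition approximant_presentation ::
  "('a::euclidean_space, 'l) tile set \<Rightarrow> (nat \<Rightarrow> 'b topology) \<Rightarrow> (nat \<Rightarrow> 'b \<Rightarrow> 'b) \<Rightarrow> (nat \<Rightarrow> 'b) \<Rightarrow> bool"
  where
  "approximant_presentation T \<Gamma> \<sigma> x \<longleftrightarrow>
     (\<forall>n. finite_CW_complex (\<Gamma> n) \<and> connected_space (\<Gamma> n)) \<and>
     (\<forall>n. continuous_map (\<Gamma> (Suc n)) (\<Gamma> n) (\<sigma> (Suc n))) \<and>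
     (\<forall>n. x n \<in> topspace (\<Gamma> n)) \<and> (\<forall>n. \<sigma> (Suc n) (x (Suc n)) = x n) \<and>
     (\<exists>p. homeomorphic_map (hull_topology T) (invlim_topology \<Gamma> \<sigma>) p \<and>
          (\<forall>r. \<exists>n0. \<forall>n\<ge>n0. \<forall>S\<in>tiling_hull T. \<forall>S'\<in>tiling_hull T. p S n = p S' n \<longrightarrow> agree_on r S S'))"

definition profinite_pi1_bond ::
  "(nat \<Rightarrow> 'b topology) \<Rightarrow> (nat \<Rightarrow> 'b \<Rightarrow> 'b) \<Rightarrow> (nat \<Rightarrow> 'b) \<Rightarrow> nat \<Rightarrow>
   ((real \<Rightarrow> 'b) set set \<Rightarrow> (real \<Rightarrow> 'b) set set) \<Rightarrow> (real \<Rightarrow> 'b) set set \<Rightarrow> (real \<Rightarrow> 'b) set set" where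
  "profinite_pi1_bond \<Gamma> \<sigma> x n =
     induced_profinite (fundamental_group (\<Gamma> n) (x n))
       (fundamental_group (\<Gamma> (n - 1)) (x (n - 1)))
       (induced_fundamental (\<Gamma> (n - 1)) (x (n - 1)) (\<sigma> n))"

definition profinite_pi1 ::
  "(nat \<Rightarrow> 'b topology) \<Rightarrow> (nat \<Rightarrow> 'b \<Rightarrow> 'b) \<Rightarrow> (nat \<Rightarrow> 'b) \<Rightarrow>
   (nat \<Rightarrow> (real \<Rightarrow> 'b) set set \<Rightarrow> (real \<Rightarrow> 'b) set set) monoid" where
  "profinite_pi1 \<Gamma> \<sigma> x =
     invlim_group (\<lambda>n. profinite_completion (fundamental_group (\<Gamma> n) (x n)))
       (profinite_pi1_bond \<Gamma> \<sigma> x)"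

definition profinite_pi1_topology ::
  "(nat \<Rightarrow> 'b topology) \<Rightarrow> (nat \<Rightarrow> 'b \<Rightarrow> 'b) \<Rightarrow> (nat \<Rightarrow> 'b) \<Rightarrow>
   (nat \<Rightarrow> (real \<Rightarrow> 'b) set set \<Rightarrow> (real \<Rightarrow> 'b) set set) topology" where
  "profinite_pi1_topology \<Gamma> \<sigma> x =
     invlim_topology (\<lambda>n. profinite_topology (fundamental_group (\<Gamma> n) (x n)))
       (profinite_pi1_bond \<Gamma> \<sigma> x)"

end

theory Submission
  imports Defs
begin

text \<open>A cocycle on a space \<open>X\<close> with values in a discrete group \<open>K\<close> is a function \<open>c\<close> on pairs of nearby points with
  \<open>c u v * c v w = c u w\<close>, taken up to \<open>c u v \<mapsto> inverse (b u) * c u v * b v\<close> for arbitrary functions \<open>b\<close>; no continuity is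
  involved. On a connected finite CW complex \<open>\<Gamma>\<close> the cocycles with values in \<open>K\<close> are classified by their
  holonomy, that is, by the homomorphisms from the fundamental group to \<open>K\<close> up to conjugation. On a limit of
  compact Hausdorff spaces \<open>\<Gamma> n\<close>, every cocycle comes from some \<open>\<Gamma> n\<close>, and cocycles on \<open>\<Gamma> n\<close> that become
  cohomologous on the limit do so on a later stage. Hence two presentations of the same space give an
  interleaving of the two sequences of fundamental groups that commutes up to conjugation; the
  conjugations are unavoidable because the homeomorphism need not respect the base points. After profinite
  completion, a compactness argument replaces the interleaving homomorphisms by conjugates for which
  everything commutes, and the limits are isomorphic.\<close>

section \<open>Properties of small sets and open covers\<close>

text \<open>A homeomorphism between two limits induces no maps between their stages. Homomorphisms
  between the fundamental groups are obtained instead by using such a group as the coefficient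
  group: the universal cocycle of one stage, whose holonomy along a loop is the class of that loop,
  is pulled back to the limit, descends to a stage of the other presentation, and its monodromy
  there is the desired homomorphism. The descent goes through a section of the projection to a stage
  that is only approximately continuous. A cocycle depending on pairs of nearby points can be pulled
  back along such a section, whereas a continuous map into a stage would first have to be extended
  from the limit to a neighbourhood. The zigzag of homomorphisms commutes up to inner automorphisms,
  and making it commute means solving infinitely many linked equations for the conjugating elements.
  Each finite part is solvable, but a sequence of nonempty sets without compactness may have empty
  limit; this is the point at which profinite groups replace the fundamental groups.\<close>

definition small_sets :: "'b topology \<Rightarrow> ('b set \<Rightarrow> bool) \<Rightarrow> bool" where
  "small_sets X P \<longleftrightarrow> (\<forall>x\<in>topspace X. \<exists>U. openin X U \<and> x \<in> U \<and> (\<forall>A\<subseteq>U. P A))"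

lemma small_sets_mono:
  assumes "small_sets X P" "\<And>A. A \<subseteq> topspace X \<Longrightarrow> P A \<Longrightarrow> Q A"
  shows "small_sets X Q"
  unfolding small_sets_def
proof
  fix x assume "x \<in> topspace X"
  then obtain U where "openin X U" "x \<in> U" "\<forall>A\<subseteq>U. P A"
    using assms(1) unfolding small_sets_def by blast
  then show "\<exists>U. openin X U \<and> x \<in> U \<and> (\<forall>A\<subseteq>U. Q A)"
    using assms(2) by (meson openin_subset subset_trans)
qed

lemma small_setsE:
  assumes "small_sets X P" "x \<in> topspace X"
  obtains U where "openin X U" "x \<in> U" "P U"
  using assms unfolding small_sets_def by blast

lemma small_sets_conj:
  assumes "small_sets X P" "small_sets X Q"
  shows "small_sets X (\<lambda>A. P A \<and> Q A)"
  unfolding small_sets_def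
proof
  fix x assume x: "x \<in> topspace X"
  obtain U where "openin X U" "x \<in> U" "\<forall>A\<subseteq>U. P A"
    using assms(1) x unfolding small_sets_def by blast
  moreover obtain V where "openin X V" "x \<in> V" "\<forall>A\<subseteq>V. Q A"
    using assms(2) x unfolding small_sets_def by blast
  ultimately show "\<exists>U. openin X U \<and> x \<in> U \<and> (\<forall>A\<subseteq>U. P A \<and> Q A)"
    by (intro exI[of _ "U \<inter> V"]) auto
qed

text \<open>The image of a small set is merely contained in the chosen open set. This is why
  \<open>small_sets\<close> quantifies over all subsets of that set: \<open>P\<close> itself is not
  assumed to be hereditary.\<close>

lemma small_sets_pullback:
  assumes "continuous_map Z X f" "small_sets X P"
  shows "small_sets Z (\<lambda>A. P (f ` A))"
  unfolding small_sets_def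
proof
  fix z assume z: "z \<in> topspace Z"
  then have "f z \<in> topspace X" using assms(1) continuous_map_funspace by blast
  then obtain U where U: "openin X U" "f z \<in> U" "\<forall>A\<subseteq>U. P A"
    using assms(2) unfolding small_sets_def by blast
  show "\<exists>U. openin Z U \<and> z \<in> U \<and> (\<forall>A\<subseteq>U. P (f ` A))"
  proof (intro exI conjI allI impI)
    show "openin Z {z \<in> topspace Z. f z \<in> U}"
      using assms(1) U(1) openin_continuous_map_preimage by blast
    show "P (f ` A)" if "A \<subseteq> {z \<in> topspace Z. f z \<in> U}" for A
    proof -
      have "f ` A \<subseteq> U" using that by auto
      then show ?thesis using U(3) by blast
    qed
  qed (use z U in auto)
qed

lemma small_sets_True: "(\<And>A. A \<subseteq> topspace X \<Longrightarrow> P A) \<Longrightarrow> small_sets X P"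
  unfolding small_sets_def by (metis openin_topspace)

text \<open>The Lebesgue number of the cover by open sets whose traces on \<open>S\<close> have only
  subsets with property \<open>P\<close>. A point of the nonempty set \<open>A\<close> serves as the
  centre of a ball inside one member of the cover.\<close>

lemma small_sets_Lebesgue:
  fixes S :: "'a::metric_space set"
  assumes "compact S" "small_sets (top_of_set S) P"
  obtains e where "e > 0"
    "\<And>A. A \<noteq> {} \<Longrightarrow> A \<subseteq> S \<Longrightarrow> (\<And>u v. u \<in> A \<Longrightarrow> v \<in> A \<Longrightarrow> dist u v < e) \<Longrightarrow> P A"
proof -
  define C where "C = {W. open W \<and> (\<forall>A\<subseteq>S \<inter> W. P A)}"
  have "S \<subseteq> \<Union>C"
  proof
    fix x assume x: "x \<in> S"
    then obtain U where U: "openin (top_of_set S) U" "x \<in> U" "\<forall>A\<subseteq>U. P A"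
      using assms(2) unfolding small_sets_def by fastforce
    obtain W where W: "open W" "U = S \<inter> W" using U(1) unfolding openin_open by blast
    then have "W \<in> C" using U unfolding C_def by blast
    then show "x \<in> \<Union>C" using W U by blast
  qed
  moreover have "\<And>B. B \<in> C \<Longrightarrow> open B" unfolding C_def by auto
  ultimately obtain e where e: "e > 0" "\<forall>x\<in>S. \<exists>B\<in>C. ball x e \<subseteq> B"
    using Heine_Borel_lemma[OF assms(1), of C] by metis
  show thesis
  proof (rule that[OF e(1)])
    fix A assume A: "A \<noteq> {}" "A \<subseteq> S" "\<And>u v. u \<in> A \<Longrightarrow> v \<in> A \<Longrightarrow> dist u v < e"
    obtain u where u: "u \<in> A" using A(1) by blast
    then obtain B where B: "B \<in> C" "ball u e \<subseteq> B" using e(2) A(2) by blast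
    have "A \<subseteq> ball u e" using A(3) u by auto
    then show "P A" using B A(2) unfolding C_def by blast
  qed
qed

section \<open>Refinements of open covers\<close>

definition open_cover :: "'b topology \<Rightarrow> 'b set set \<Rightarrow> bool" where
  "open_cover X C \<longleftrightarrow> (\<forall>U\<in>C. openin X U) \<and> \<Union>C = topspace X"

lemma open_cover_imp_small_sets:
  assumes "open_cover X C"
  shows "small_sets X (\<lambda>A. \<exists>U\<in>C. A \<subseteq> U)"
  unfolding small_sets_def
proof
  fix x assume "x \<in> topspace X"
  then obtain U where "U \<in> C" "x \<in> U" using assms unfolding open_cover_def by blast
  then show "\<exists>U. openin X U \<and> x \<in> U \<and> (\<forall>A\<subseteq>U. \<exists>U\<in>C. A \<subseteq> U)"
    using assms unfolding open_cover_def by blast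
qed

text \<open>If the closed sets \<open>F i \<subseteq> U i\<close> still cover, the sets \<open>V y\<close> cut out by the conditions \<open>U i\<close> for \<open>y \<in> F i\<close>
  and \<open>- F i\<close> for \<open>y \<notin> F i\<close> form a barycentric refinement: a point of \<open>F i\<close> only lies in sets \<open>V y \<subseteq> U i\<close>.\<close>

lemma barycentric_refinement:
  assumes "compact_space X" "Hausdorff_space X" "small_sets X P"
  obtains C where "open_cover X C" "small_sets X (\<lambda>A. A \<noteq> {} \<longrightarrow> (\<exists>V\<in>C. A \<subseteq> V))"
    "\<And>z. z \<in> topspace X \<Longrightarrow> P (\<Union>{V\<in>C. z \<in> V})"
proof -
  \<comment> \<open>Regularity puts a closed set \<open>F\<close> between a smaller neighbourhood
    \<open>W\<close> and the given \<open>U\<close>.\<close>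
  have "\<exists>W F. openin X W \<and> x \<in> W \<and> W \<subseteq> F \<and> closedin X F \<and> (\<exists>U. openin X U \<and> F \<subseteq> U \<and> (\<forall>A\<subseteq>U. P A))"
    if x: "x \<in> topspace X" for x
  proof -
    obtain U where U: "openin X U" "x \<in> U" "\<forall>A\<subseteq>U. P A"
      using assms(3) x unfolding small_sets_def by blast
    have "neighbourhood_base_of (closedin X) X"
      using assms(1,2) compact_Hausdorff_imp_regular_space neighbourhood_base_of_closedin by blast
    then obtain W F where "openin X W" "closedin X F" "x \<in> W" "W \<subseteq> F" "F \<subseteq> U"
      using U(1,2) unfolding neighbourhood_base_of by meson
    then show ?thesis using U by blast
  qed
  then obtain W F where WF: "\<And>x. x \<in> topspace X \<Longrightarrow> openin X (W x) \<and> x \<in> W x \<and> W x \<subseteq> F x \<and> closedin X (F x) \<and>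
      (\<exists>U. openin X U \<and> F x \<subseteq> U \<and> (\<forall>A\<subseteq>U. P A))"
    by metis
  then obtain U where U: "\<And>x. x \<in> topspace X \<Longrightarrow> openin X (U x) \<and> F x \<subseteq> U x \<and> (\<forall>A\<subseteq>U x. P A)"
    by metis
  have "\<exists>I. finite I \<and> I \<subseteq> topspace X \<and> topspace X \<subseteq> \<Union>(W ` I)"
  proof -
    have "\<exists>\<F>. finite \<F> \<and> \<F> \<subseteq> W ` topspace X \<and> topspace X \<subseteq> \<Union>\<F>"
    proof (rule assms(1)[unfolded compact_space_def compactin_def, THEN conjunct2, rule_format], intro conjI ballI)
      fix U assume "U \<in> W ` topspace X"
      then show "openin X U" using WF by blast
    next
      show "topspace X \<subseteq> \<Union>(W ` topspace X)" using WF by blast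
    qed
    then show ?thesis by (metis finite_subset_image)
  qed
  then obtain I where I: "finite I" "I \<subseteq> topspace X" "topspace X \<subseteq> \<Union>(W ` I)" by blast
  define V where "V y = topspace X \<inter> (\<Inter>i\<in>I. if y \<in> F i then U i else topspace X - F i)" for y
  have Vo: "openin X (V y)" for y
  proof (cases "I = {}")
    case True then show ?thesis unfolding V_def by simp
  next
    case False
    have "openin X (\<Inter>i\<in>I. if y \<in> F i then U i else topspace X - F i)"
    proof (rule openin_Inter)
      fix Z assume "Z \<in> (\<lambda>i. if y \<in> F i then U i else topspace X - F i) ` I"
      then obtain i where i: "i \<in> I" "Z = (if y \<in> F i then U i else topspace X - F i)" by blast
      then have "openin X (U i)" "openin X (topspace X - F i)" using U WF I by blast+
      then show "openin X Z" using i by simp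
    qed (use I False in auto)
    then show ?thesis unfolding V_def by blast
  qed
  have Vy: "y \<in> V y" if "y \<in> topspace X" for y
    using that U I unfolding V_def by auto
  have cov: "open_cover X (V ` topspace X)"
    unfolding open_cover_def using Vo Vy openin_subset by fastforce
  show thesis
  proof
    show "open_cover X (V ` topspace X)" by (rule cov)
    show "small_sets X (\<lambda>A. A \<noteq> {} \<longrightarrow> (\<exists>Va\<in>V ` topspace X. A \<subseteq> Va))"
      by (rule small_sets_mono[OF open_cover_imp_small_sets[OF cov]]) auto
    fix z assume z: "z \<in> topspace X"
    then obtain i where i: "i \<in> I" "z \<in> F i" using I WF by (metis UN_E subsetD)
    have "\<Union>{V' \<in> V ` topspace X. z \<in> V'} \<subseteq> U i"
    proof -
      have "V y \<subseteq> U i" if "z \<in> V y" for y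
        using that i unfolding V_def by (cases "y \<in> F i") auto
      then show ?thesis by blast
    qed
    then show "P (\<Union>{V' \<in> V ` topspace X. z \<in> V'})" using U i I by blast
  qed
qed

text \<open>Two barycentric refinements in a row give a star refinement. If \<open>V'\<close> meets
  \<open>V\<close> in \<open>w\<close>, the star of \<open>w\<close> lies in one member of
  \<open>B\<close> that contains both; all these members contain a fixed point \<open>v\<close> of
  \<open>V\<close>, so their union is the star of \<open>v\<close> in \<open>B\<close>.\<close>

lemma star_refinement:
  assumes "compact_space X" "Hausdorff_space X" "small_sets X P"
  obtains C where "open_cover X C" "\<And>V. V \<in> C \<Longrightarrow> V \<noteq> {} \<Longrightarrow> P (\<Union>{V'\<in>C. V' \<inter> V \<noteq> {}})"
proof -
  obtain B where B: "open_cover X B" "\<And>z. z \<in> topspace X \<Longrightarrow> \<forall>A\<subseteq>\<Union>{V\<in>B. z \<in> V}. P A"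
  proof -
    \<comment> \<open>\<open>barycentric_refinement\<close> yields its property only for the full
      star of a point; the hereditary version is needed for the smaller star of \<open>V\<close>
      below.\<close>
    have "small_sets X (\<lambda>A. \<forall>A'\<subseteq>A. P A')"
      using assms(3) unfolding small_sets_def by (meson subset_trans)
    from barycentric_refinement[OF assms(1,2) this] show thesis using that by metis
  qed
  obtain C where C: "open_cover X C" "\<And>z. z \<in> topspace X \<Longrightarrow> \<exists>W\<in>B. \<Union>{V\<in>C. z \<in> V} \<subseteq> W"
    using barycentric_refinement[OF assms(1,2) open_cover_imp_small_sets[OF B(1)]] by metis
  show thesis
  proof (rule that[OF C(1)])
    fix V assume V: "V \<in> C" "V \<noteq> {}"
    then obtain v where v: "v \<in> V" "v \<in> topspace X" using C(1) unfolding open_cover_def by blast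
    have "\<Union>{V'\<in>C. V' \<inter> V \<noteq> {}} \<subseteq> \<Union>{W\<in>B. v \<in> W}"
    proof
      fix x assume "x \<in> \<Union>{V'\<in>C. V' \<inter> V \<noteq> {}}"
      then obtain V' w where V': "V' \<in> C" "x \<in> V'" "w \<in> V'" "w \<in> V" by blast
      then have "w \<in> topspace X" using C(1) unfolding open_cover_def by blast
      then obtain W where "W \<in> B" "\<Union>{V\<in>C. w \<in> V} \<subseteq> W" using C(2) by blast
      then show "x \<in> \<Union>{W\<in>B. v \<in> W}" using V V' v by blast
    qed
    then show "P (\<Union>{V'\<in>C. V' \<inter> V \<noteq> {}})" using B(2) v by blast
  qed
qed

section \<open>Cocycles\<close>

text \<open>Nonabelian Alexander-Spanier cocycles of degree one: only the values of \<open>c\<close> near the diagonal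
  matter. Cohomology classes of such cocycles with values in \<open>K\<close> classify principal \<open>K\<close>-bundles.\<close>

definition cocycle_on :: "('k, 'm) monoid_scheme \<Rightarrow> ('b \<Rightarrow> 'b \<Rightarrow> 'k) \<Rightarrow> 'b set \<Rightarrow> bool" where
  "cocycle_on K c A \<longleftrightarrow> (\<forall>u\<in>A. \<forall>v\<in>A. c u v \<in> carrier K \<and> (\<forall>w\<in>A. c u v \<otimes>\<^bsub>K\<^esub> c v w = c u w))"

definition cocycle :: "'b topology \<Rightarrow> ('k, 'm) monoid_scheme \<Rightarrow> ('b \<Rightarrow> 'b \<Rightarrow> 'k) \<Rightarrow> bool" where
  "cocycle X K c \<longleftrightarrow> small_sets X (cocycle_on K c)"

definition cohomologous_by ::
  "'b topology \<Rightarrow> ('k, 'm) monoid_scheme \<Rightarrow> ('b \<Rightarrow> 'k) \<Rightarrow> ('b \<Rightarrow> 'b \<Rightarrow> 'k) \<Rightarrow> ('b \<Rightarrow> 'b \<Rightarrow> 'k) \<Rightarrow> bool" where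
  "cohomologous_by X K b c c' \<longleftrightarrow> b \<in> topspace X \<rightarrow> carrier K \<and>
     small_sets X (\<lambda>A. \<forall>u\<in>A. \<forall>v\<in>A. c u v \<otimes>\<^bsub>K\<^esub> b v = b u \<otimes>\<^bsub>K\<^esub> c' u v)"

definition cohomologous ::
  "'b topology \<Rightarrow> ('k, 'm) monoid_scheme \<Rightarrow> ('b \<Rightarrow> 'b \<Rightarrow> 'k) \<Rightarrow> ('b \<Rightarrow> 'b \<Rightarrow> 'k) \<Rightarrow> bool" where
  "cohomologous X K c c' \<longleftrightarrow> (\<exists>b. cohomologous_by X K b c c')"

text \<open>A parallel section: a step from \<open>u\<close> to \<open>v\<close> multiplies
  \<open>b\<close> on the right by \<open>c u v\<close>. Hence two trivializations of a cocycle on a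
  connected space differ by a constant factor on the left, the fact behind both gluing and
  holonomy.\<close>

definition trivialization ::
  "'b topology \<Rightarrow> ('k, 'm) monoid_scheme \<Rightarrow> ('b \<Rightarrow> 'b \<Rightarrow> 'k) \<Rightarrow> ('b \<Rightarrow> 'k) \<Rightarrow> bool" where
  "trivialization X K c b \<longleftrightarrow> b \<in> topspace X \<rightarrow> carrier K \<and>
     small_sets X (\<lambda>A. \<forall>u\<in>A. \<forall>v\<in>A. b u \<otimes>\<^bsub>K\<^esub> c u v = b v)"

section \<open>Functoriality and the equivalence relation on cocycles\<close>

lemma cocycle_pullback:
  assumes "continuous_map Z X f" "cocycle X K c"
  shows "cocycle Z K (\<lambda>u v. c (f u) (f v))"
  using small_sets_pullback[OF assms(1) assms(2)[unfolded cocycle_def]]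
  unfolding cocycle_def cocycle_on_def by (elim small_sets_mono) auto

lemma cohomologous_pullback:
  fixes K (structure)
  assumes "continuous_map Z X f" "cohomologous X K c c'"
  shows "cohomologous Z K (\<lambda>u v. c (f u) (f v)) (\<lambda>u v. c' (f u) (f v))"
proof -
  obtain b where b: "cohomologous_by X K b c c'" using assms(2) unfolding cohomologous_def by blast
  have "small_sets Z (\<lambda>A. \<forall>u\<in>A. \<forall>v\<in>A. c (f u) (f v) \<otimes> b (f v) = b (f u) \<otimes> c' (f u) (f v))"
    using small_sets_pullback[OF assms(1), of "\<lambda>A. \<forall>u\<in>A. \<forall>v\<in>A. c u v \<otimes> b v = b u \<otimes> c' u v"] b
    unfolding cohomologous_by_def by simp
  then have "cohomologous_by Z K (b \<circ> f) (\<lambda>u v. c (f u) (f v)) (\<lambda>u v. c' (f u) (f v))"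
    using b continuous_map_funspace[OF assms(1)] unfolding cohomologous_by_def by auto
  then show ?thesis unfolding cohomologous_def by blast
qed

lemma trivialization_pullback:
  fixes K (structure)
  assumes "continuous_map Z X f" "trivialization X K c b"
  shows "trivialization Z K (\<lambda>u v. c (f u) (f v)) (b \<circ> f)"
proof -
  have "small_sets Z (\<lambda>A. \<forall>u\<in>f ` A. \<forall>v\<in>f ` A. b u \<otimes> c u v = b v)"
    using small_sets_pullback[OF assms(1)] assms(2) unfolding trivialization_def by blast
  then show ?thesis
    using assms continuous_map_funspace[OF assms(1)] unfolding trivialization_def by auto
qed

lemma cocycle_at:
  fixes K (structure)
  assumes "cocycle X K c" "u \<in> topspace X" shows "c u u \<in> carrier K" "c u u \<otimes> c u u = c u u"
  using assms unfolding cocycle_def cocycle_on_def small_sets_def by blast+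

lemma cohomologous_eqI:
  fixes K (structure)
  assumes "group K" "small_sets X (\<lambda>A. \<forall>u\<in>A. \<forall>v\<in>A. c u v \<in> carrier K \<and> c u v = c' u v)"
  shows "cohomologous X K c c'"
proof -
  interpret group K by fact
  have "cohomologous_by X K (\<lambda>_. \<one>) c c'"
    unfolding cohomologous_by_def
  proof
    show "small_sets X (\<lambda>A. \<forall>u\<in>A. \<forall>v\<in>A. c u v \<otimes> \<one> = \<one> \<otimes> c' u v)"
      using assms(2) by (rule small_sets_mono) (metis l_one r_one)
  qed auto
  then show ?thesis unfolding cohomologous_def by blast
qed

text \<open>The coboundary is inverted pointwise. Values of a cocycle lie in the carrier only near
  the diagonal, so the cocycle hypotheses enter through the same small sets as the relation itself;
  likewise for transitivity.\<close>

lemma cohomologous_sym: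
  fixes K (structure)
  assumes "group K" "cocycle X K c" "cocycle X K c'" "cohomologous X K c c'"
  shows "cohomologous X K c' c"
proof -
  interpret group K by fact
  obtain b where b: "cohomologous_by X K b c c'" using assms(4) unfolding cohomologous_def by blast
  have bc: "u \<in> topspace X \<Longrightarrow> b u \<in> carrier K" for u using b unfolding cohomologous_by_def by blast
  have "cohomologous_by X K (\<lambda>u. inv b u) c' c"
    unfolding cohomologous_by_def
  proof
    have "small_sets X (\<lambda>A. (cocycle_on K c A \<and> cocycle_on K c' A) \<and> (\<forall>u\<in>A. \<forall>v\<in>A. c u v \<otimes> b v = b u \<otimes> c' u v))"
      using b assms(2,3) unfolding cohomologous_by_def cocycle_def by (intro small_sets_conj) auto
    then show "small_sets X (\<lambda>A. \<forall>u\<in>A. \<forall>v\<in>A. c' u v \<otimes> inv b v = inv b u \<otimes> c u v)"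
    proof (rule small_sets_mono, intro ballI)
      fix A u v
      assume A: "A \<subseteq> topspace X" and *: "(cocycle_on K c A \<and> cocycle_on K c' A) \<and> (\<forall>u\<in>A. \<forall>v\<in>A. c u v \<otimes> b v = b u \<otimes> c' u v)"
        and u: "u \<in> A" "v \<in> A"
      have "b u \<in> carrier K" "b v \<in> carrier K" "c u v \<in> carrier K" "c' u v \<in> carrier K"
        using A * u bc unfolding cocycle_on_def by auto
      moreover have "c u v \<otimes> b v = b u \<otimes> c' u v" using * u by blast
      ultimately show "c' u v \<otimes> inv b v = inv b u \<otimes> c u v"
        by (metis inv_closed inv_solve_left inv_solve_right' m_assoc m_closed)
    qed
  qed (use bc in auto)
  then show ?thesis unfolding cohomologous_def by blast
qed

lemma cohomologous_trans:
  fixes K (structure)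
  assumes "group K" "cocycle X K c" "cocycle X K c'" "cocycle X K c''"
    "cohomologous X K c c'" "cohomologous X K c' c''"
  shows "cohomologous X K c c''"
proof -
  interpret group K by fact
  obtain b where b: "cohomologous_by X K b c c'" using assms(5) unfolding cohomologous_def by blast
  obtain b' where b': "cohomologous_by X K b' c' c''" using assms(6) unfolding cohomologous_def by blast
  have bc: "u \<in> topspace X \<Longrightarrow> b u \<in> carrier K" "u \<in> topspace X \<Longrightarrow> b' u \<in> carrier K" for u
    using b b' unfolding cohomologous_by_def by blast+
  have "cohomologous_by X K (\<lambda>u. b u \<otimes> b' u) c c''"
    unfolding cohomologous_by_def
  proof
    have "small_sets X (\<lambda>A. (cocycle_on K c A \<and> cocycle_on K c' A \<and> cocycle_on K c'' A) \<and>
        (\<forall>u\<in>A. \<forall>v\<in>A. c u v \<otimes> b v = b u \<otimes> c' u v) \<and> (\<forall>u\<in>A. \<forall>v\<in>A. c' u v \<otimes> b' v = b' u \<otimes> c'' u v))"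
      using b b' assms(2,3,4) unfolding cohomologous_by_def cocycle_def by (intro small_sets_conj) auto
    then show "small_sets X (\<lambda>A. \<forall>u\<in>A. \<forall>v\<in>A. c u v \<otimes> (b v \<otimes> b' v) = b u \<otimes> b' u \<otimes> c'' u v)"
    proof (rule small_sets_mono, intro ballI)
      fix A u v
      assume A: "A \<subseteq> topspace X" and *: "(cocycle_on K c A \<and> cocycle_on K c' A \<and> cocycle_on K c'' A) \<and>
        (\<forall>u\<in>A. \<forall>v\<in>A. c u v \<otimes> b v = b u \<otimes> c' u v) \<and> (\<forall>u\<in>A. \<forall>v\<in>A. c' u v \<otimes> b' v = b' u \<otimes> c'' u v)"
        and u: "u \<in> A" "v \<in> A"
      have cl: "b u \<in> carrier K" "b v \<in> carrier K" "b' u \<in> carrier K" "b' v \<in> carrier K"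
         "c u v \<in> carrier K" "c' u v \<in> carrier K" "c'' u v \<in> carrier K"
        using A * u bc unfolding cocycle_on_def by auto
      have "c u v \<otimes> b v = b u \<otimes> c' u v" "c' u v \<otimes> b' v = b' u \<otimes> c'' u v" using * u by blast+
      then show "c u v \<otimes> (b v \<otimes> b' v) = b u \<otimes> b' u \<otimes> c'' u v"
        using cl by (metis m_assoc)
    qed
  qed (use bc in auto)
  then show ?thesis unfolding cohomologous_def by blast
qed

lemma cocycle_hom:
  assumes "\<phi> \<in> hom K L" "cocycle X K c"
  shows "cocycle X L (\<lambda>u v. \<phi> (c u v))"
  using assms(2) unfolding cocycle_def
proof (rule small_sets_mono)
  fix A assume "cocycle_on K c A"
  then show "cocycle_on L (\<lambda>u v. \<phi> (c u v)) A"
    using assms(1) unfolding cocycle_on_def hom_def by (auto simp: Pi_iff) metis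
qed

lemma cohomologous_hom:
  fixes K (structure)
  assumes "\<phi> \<in> hom K L" "cocycle X K c" "cocycle X K c'" "cohomologous X K c c'"
  shows "cohomologous X L (\<lambda>u v. \<phi> (c u v)) (\<lambda>u v. \<phi> (c' u v))"
proof -
  obtain b where b: "cohomologous_by X K b c c'" using assms(4) unfolding cohomologous_def by blast
  have bc: "u \<in> topspace X \<Longrightarrow> b u \<in> carrier K" for u using b unfolding cohomologous_by_def by blast
  have "cohomologous_by X L (\<lambda>u. \<phi> (b u)) (\<lambda>u v. \<phi> (c u v)) (\<lambda>u v. \<phi> (c' u v))"
    unfolding cohomologous_by_def
  proof
    have "small_sets X (\<lambda>A. (cocycle_on K c A \<and> cocycle_on K c' A) \<and> (\<forall>u\<in>A. \<forall>v\<in>A. c u v \<otimes> b v = b u \<otimes> c' u v))"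
      using b assms(2,3) unfolding cohomologous_by_def cocycle_def by (intro small_sets_conj) auto
    then show "small_sets X (\<lambda>A. \<forall>u\<in>A. \<forall>v\<in>A. \<phi> (c u v) \<otimes>\<^bsub>L\<^esub> \<phi> (b v) = \<phi> (b u) \<otimes>\<^bsub>L\<^esub> \<phi> (c' u v))"
    proof (rule small_sets_mono, intro ballI)
      fix A u v
      assume A: "A \<subseteq> topspace X" and *: "(cocycle_on K c A \<and> cocycle_on K c' A) \<and> (\<forall>u\<in>A. \<forall>v\<in>A. c u v \<otimes> b v = b u \<otimes> c' u v)"
        and u: "u \<in> A" "v \<in> A"
      have "b u \<in> carrier K" "b v \<in> carrier K" "c u v \<in> carrier K" "c' u v \<in> carrier K"
        using A * u bc unfolding cocycle_on_def by auto
      then show "\<phi> (c u v) \<otimes>\<^bsub>L\<^esub> \<phi> (b v) = \<phi> (b u) \<otimes>\<^bsub>L\<^esub> \<phi> (c' u v)"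
        using * u hom_mult[OF assms(1)] by metis
    qed
  qed (use bc assms(1) hom_in_carrier in fastforce)
  then show ?thesis unfolding cohomologous_def by blast
qed

text \<open>Trivializations over two closed pieces are glued after a translation by the constant that relates them on
  the connected overlap.\<close>

lemma trivialization_glue:
  fixes K (structure)
  fixes A B :: "'a::metric_space set"
  assumes "group K"
    and c: "\<And>C. C \<noteq> {} \<Longrightarrow> C \<subseteq> S \<Longrightarrow> (\<And>u v. u \<in> C \<Longrightarrow> v \<in> C \<Longrightarrow> dist u v < e) \<Longrightarrow> cocycle_on K c C"
    and "0 < e" "A \<subseteq> S" "B \<subseteq> S" "z \<in> A \<inter> B" "connected (A \<inter> B)"
    and near: "\<And>u v. u \<in> A \<Longrightarrow> v \<in> B \<Longrightarrow> dist u v < e \<Longrightarrow> \<exists>w\<in>A \<inter> B. dist u w < e \<and> dist w v < e"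
    and a: "a \<in> A \<rightarrow> carrier K" "\<And>u v. u \<in> A \<Longrightarrow> v \<in> A \<Longrightarrow> dist u v < e \<Longrightarrow> a u \<otimes> c u v = a v"
    and b: "b \<in> B \<rightarrow> carrier K" "\<And>u v. u \<in> B \<Longrightarrow> v \<in> B \<Longrightarrow> dist u v < e \<Longrightarrow> b u \<otimes> c u v = b v"
  shows "\<exists>d\<in>A \<union> B \<rightarrow> carrier K. \<forall>u\<in>A \<union> B. \<forall>v\<in>A \<union> B. dist u v < e \<longrightarrow> d u \<otimes> c u v = d v"
proof -
  interpret group K by fact
  define k where "k = a z \<otimes> inv b z"
  have ac: "u \<in> A \<Longrightarrow> a u \<in> carrier K" and bc: "u \<in> B \<Longrightarrow> b u \<in> carrier K" for u using a b by auto
  \<comment> \<open>All uses of the cocycle identity below concern three points at pairwise distance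
    less than \<open>e\<close>.\<close>
  have c3: "cocycle_on K c {u, w, v}" if "u \<in> S" "v \<in> S" "w \<in> S" "dist u v < e" "dist u w < e" "dist w v < e" for u v w
    by (rule c) (use that \<open>0 < e\<close> in \<open>auto simp: dist_commute\<close>)
  have cc: "c u v \<in> carrier K" if "u \<in> S" "v \<in> S" "dist u v < e" for u v
    using c3[of u v u] that \<open>0 < e\<close> unfolding cocycle_on_def by simp
  have ceq: "c u v = c u w \<otimes> c w v" if "u \<in> S" "v \<in> S" "w \<in> S" "dist u v < e" "dist u w < e" "dist w v < e" for u v w
    using c3[OF that] unfolding cocycle_on_def by simp
  have k: "k \<in> carrier K" using ac bc assms(6) unfolding k_def by auto
  have kw: "a w = k \<otimes> b w" if w: "w \<in> A \<inter> B" for w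
  proof -
    \<comment> \<open>A step of length less than \<open>e\<close> multiplies \<open>a\<close> and
      \<open>b\<close> on the right by the same element \<open>c u v\<close>, so the quotient is
      locally constant on the overlap.\<close>
    have "a z \<otimes> inv b z = a w \<otimes> inv b w"
    proof (rule connected_local_const[OF assms(7,6) w], intro ballI)
      fix u assume u: "u \<in> A \<inter> B"
      have "\<forall>\<^sub>F v in at u within A \<inter> B. v \<in> A \<inter> B \<and> dist u v < e"
        using \<open>0 < e\<close> by (auto simp: eventually_at dist_commute)
      then show "\<forall>\<^sub>F v in at u within A \<inter> B. a u \<otimes> inv b u = a v \<otimes> inv b v"
      proof (rule eventually_mono, elim conjE)
        fix v assume v: "v \<in> A \<inter> B" "dist u v < e"
        have "a u \<otimes> c u v = a v" "b u \<otimes> c u v = b v" using a b u v by auto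
        moreover have "c u v \<in> carrier K" using cc u v assms by blast
        ultimately show "a u \<otimes> inv b u = a v \<otimes> inv b v"
          using ac[of u] bc[of u] u
          by (metis IntD1 IntD2 inv_closed inv_mult_group inv_solve_right' m_assoc m_closed r_inv r_one)
      qed
    qed
    then show ?thesis unfolding k_def using ac[of w] bc[of w] w
      by (metis IntD1 IntD2 inv_closed l_inv m_assoc r_one)
  qed
  define d where "d u = (if u \<in> A then a u else k \<otimes> b u)" for u
  have dB: "d u = k \<otimes> b u" if "u \<in> B" for u using kw that unfolding d_def by auto
  have AA: "d u \<otimes> c u v = d v" if "u \<in> A" "v \<in> A" "dist u v < e" for u v
    using a that unfolding d_def by simp
  have BB: "d u \<otimes> c u v = d v" if "u \<in> B" "v \<in> B" "dist u v < e" for u v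
    using b that k bc cc[of u v] assms(5) by (simp add: dB m_assoc subset_iff)
  have dc: "d u \<in> carrier K" if "u \<in> A \<union> B" for u using that ac bc k unfolding d_def by auto
  \<comment> \<open>A short step from one piece to the other is broken at a point \<open>w\<close>
    of the overlap, where both formulas for \<open>d\<close> are valid.\<close>
  have step: "d u \<otimes> c u v = d v" if "w \<in> A \<inter> B" "dist u v < e" "dist u w < e" "dist w v < e"
    "u \<in> A \<and> v \<in> B \<or> u \<in> B \<and> v \<in> A" for u v w
  proof -
    have S: "u \<in> S" "v \<in> S" "w \<in> S" using that assms by auto
    have "d u \<otimes> c u v = (d u \<otimes> c u w) \<otimes> c w v"
      using ceq[OF S] that(2-4) cc[of u w] cc[of w v] S dc[of u] that(5) by (metis Un_iff m_assoc)
    also have "d u \<otimes> c u w = d w" using AA[of u w] BB[of u w] that by auto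
    also have "d w \<otimes> c w v = d v" using AA[of w v] BB[of w v] that by auto
    finally show ?thesis .
  qed
  have "d u \<otimes> c u v = d v" if uv: "u \<in> A \<union> B" "v \<in> A \<union> B" "dist u v < e" for u v
  proof -
    consider "u \<in> A" "v \<in> A" | "u \<in> B" "v \<in> B" | "u \<in> A" "v \<in> B" | "u \<in> B" "v \<in> A" using uv by blast
    then show ?thesis
    proof cases
      case 3
      then obtain w where "w \<in> A \<inter> B" "dist u w < e" "dist w v < e" using near uv by blast
      then show ?thesis using step 3 uv by blast
    next
      case 4
      then obtain w where "w \<in> A \<inter> B" "dist v w < e" "dist w u < e" using near[of v u] uv by (auto simp: dist_commute)
      then show ?thesis using step[of w u v] 4 uv by (auto simp: dist_commute)
    qed (use AA BB uv in auto)
  qed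
  then show ?thesis using dc by blast
qed

text \<open>The simple connectedness of the square in terms of cocycles. Two bisection arguments
  build the trivialization: rectangles of bounded height are joined horizontally to a strip, then
  strips are joined vertically. Neighbouring pieces meet in a segment, so the connected overlap
  required for gluing is always available.\<close>

lemma cocycle_on_square_trivial:
  fixes K (structure)
  fixes c :: "real \<times> real \<Rightarrow> real \<times> real \<Rightarrow> 'k"
  assumes "group K" "cocycle (top_of_set ({0..1} \<times> {0..1})) K c"
  obtains b where "trivialization (top_of_set ({0..1} \<times> {0..1})) K c b"
proof -
  interpret group K by fact
  define S :: "(real \<times> real) set" where "S = {0..1} \<times> {0..1}"
  have "compact S" unfolding S_def by (intro compact_Times) auto
  then obtain e where e: "e > 0"
    "\<And>A. A \<noteq> {} \<Longrightarrow> A \<subseteq> S \<Longrightarrow> (\<And>u v. u \<in> A \<Longrightarrow> v \<in> A \<Longrightarrow> dist u v < e) \<Longrightarrow> cocycle_on K c A"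
    using small_sets_Lebesgue[of S "cocycle_on K c"] assms(2) unfolding cocycle_def S_def by metis
  define triv where "triv A \<longleftrightarrow> (\<exists>b\<in>A \<rightarrow> carrier K. \<forall>u\<in>A. \<forall>v\<in>A. dist u v < e \<longrightarrow> b u \<otimes> c u v = b v)" for A
  have glue: "triv (A \<union> B)" if gl: "triv A" "triv B" "A \<subseteq> S" "B \<subseteq> S" "A \<inter> B \<noteq> {}" "connected (A \<inter> B)"
    "\<And>u v. u \<in> A \<Longrightarrow> v \<in> B \<Longrightarrow> dist u v < e \<Longrightarrow> \<exists>w\<in>A \<inter> B. dist u w < e \<and> dist w v < e" for A B
  proof -
    obtain a b z where ab: "a \<in> A \<rightarrow> carrier K" "\<And>u v. u \<in> A \<Longrightarrow> v \<in> A \<Longrightarrow> dist u v < e \<Longrightarrow> a u \<otimes> c u v = a v"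
      "b \<in> B \<rightarrow> carrier K" "\<And>u v. u \<in> B \<Longrightarrow> v \<in> B \<Longrightarrow> dist u v < e \<Longrightarrow> b u \<otimes> c u v = b v" "z \<in> A \<inter> B"
      using gl(1,2,5) unfolding triv_def by blast
    show ?thesis unfolding triv_def
      by (rule trivialization_glue[where a = a and b = b and z = z and S = S]) (fact assms(1) e gl ab)+
  qed
  have dist_le: "dist u v \<le> \<bar>fst u - fst v\<bar> + \<bar>snd u - snd v\<bar>" for u v :: "real \<times> real"
    unfolding dist_prod_def dist_real_def using sqrt_sum_squares_le_sum_abs[of "\<bar>fst u - fst v\<bar>" "\<bar>snd u - snd v\<bar>"] by simp
  \<comment> \<open>The sides are shorter than \<open>e/2\<close>, so any two points are closer than
    \<open>e\<close> and the cocycle identity holds on the whole rectangle; then \<open>c z\<close>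
    is a trivialization for any point \<open>z\<close> of it.\<close>
  have local: "triv ({p..q} \<times> {r..s})" if pq: "0 \<le> p" "q \<le> 1" "0 \<le> r" "s \<le> 1" "q - p < e/2" "s - r < e/2" for p q r s
  proof (cases "{p..q} \<times> {r..s} = {}")
    case True then show ?thesis unfolding triv_def by auto
  next
    case False
    let ?R = "{p..q} \<times> {r..s}"
    have close: "dist u v < e" if "u \<in> ?R" "v \<in> ?R" for u v
    proof -
      have "\<bar>fst u - fst v\<bar> \<le> q - p" "\<bar>snd u - snd v\<bar> \<le> s - r" using that by (auto simp: mem_Times_iff abs_le_iff)
      then show ?thesis using dist_le[of u v] \<open>q - p < e/2\<close> \<open>s - r < e/2\<close> by argo
    qed
    have "?R \<subseteq> S" using pq unfolding S_def by auto
    then have coc: "cocycle_on K c ?R" using e(2)[OF False _ close] by simp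
    obtain z where z: "z \<in> ?R" using False by blast
    then show ?thesis unfolding triv_def using coc unfolding cocycle_on_def
      by (intro bexI[of _ "c z"]) auto
  qed
  \<comment> \<open>Used for a point \<open>w\<close> of the common edge that shares one coordinate
    with \<open>u\<close> and lies between \<open>u\<close> and \<open>v\<close> in the
    other.\<close>
  have near: "dist u w \<le> dist u v \<and> dist w v \<le> dist u v" if
    "\<bar>fst u - fst w\<bar> \<le> \<bar>fst u - fst v\<bar>" "\<bar>fst w - fst v\<bar> \<le> \<bar>fst u - fst v\<bar>"
    "\<bar>snd u - snd w\<bar> \<le> \<bar>snd u - snd v\<bar>" "\<bar>snd w - snd v\<bar> \<le> \<bar>snd u - snd v\<bar>" for u v w :: "real \<times> real"
    using that unfolding dist_prod_def dist_real_def by (auto intro!: real_sqrt_le_mono add_mono simp: abs_le_square_iff)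
  have strip: "triv ({0..1} \<times> {r..s})" if rs: "0 \<le> r" "r \<le> s" "s \<le> 1" "s - r < e/2" for r s
  proof -
    \<comment> \<open>\<open>Bolzano\<close> supplies intervals anywhere on the line; the premises
      make \<open>P\<close> vacuous outside the unit interval.\<close>
    define P where "P p q \<longleftrightarrow> (0 \<le> p \<longrightarrow> p \<le> q \<longrightarrow> q \<le> 1 \<longrightarrow> triv ({p..q} \<times> {r..s}))" for p q
    have "P 0 1"
    proof (rule Bolzano)
      fix p q t assume P: "P p q" "P q t" and pqt: "p \<le> q" "q \<le> t"
      show "P p t" unfolding P_def
      proof (intro impI)
        assume "0 \<le> p" "t \<le> 1"
        have eq: "{p..t} \<times> {r..s} = {p..q} \<times> {r..s} \<union> {q..t} \<times> {r..s}" using pqt by auto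
        have int: "({p..q} \<times> {r..s}) \<inter> ({q..t} \<times> {r..s}) = {q} \<times> {r..s}" using pqt by auto
        show "triv ({p..t} \<times> {r..s})" unfolding eq
        proof (rule glue)
          fix u v assume u: "u \<in> {p..q} \<times> {r..s}" and v: "v \<in> {q..t} \<times> {r..s}" and uv: "dist u v < e"
          have "dist u (q, snd u) \<le> dist u v \<and> dist (q, snd u) v \<le> dist u v"
            by (rule near) (use u v in \<open>auto simp: mem_Times_iff\<close>)
          moreover have "(q, snd u) \<in> {p..q} \<times> {r..s} \<inter> ({q..t} \<times> {r..s})" unfolding int using u by (auto simp: mem_Times_iff)
          ultimately show "\<exists>w\<in>{p..q} \<times> {r..s} \<inter> ({q..t} \<times> {r..s}). dist u w < e \<and> dist w v < e" using uv by (meson le_less_trans)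
        next
          show "connected ({p..q} \<times> {r..s} \<inter> ({q..t} \<times> {r..s}))" unfolding int by (intro connected_Times) auto
          show "{p..q} \<times> {r..s} \<inter> ({q..t} \<times> {r..s}) \<noteq> {}" unfolding int using rs by auto
        qed (use P \<open>0 \<le> p\<close> \<open>t \<le> 1\<close> pqt rs in \<open>auto simp: P_def S_def\<close>)
      qed
    next
      fix x :: real
      show "\<exists>d>0. \<forall>a b. a \<le> x \<and> x \<le> b \<and> b - a < d \<longrightarrow> P a b"
        by (rule exI[of _ "e/2"]) (use e(1) local rs in \<open>auto simp: P_def\<close>)
    qed auto
    then show ?thesis unfolding P_def by simp
  qed
  define P where "P r s \<longleftrightarrow> (0 \<le> r \<longrightarrow> r \<le> s \<longrightarrow> s \<le> 1 \<longrightarrow> triv ({0..1} \<times> {r..s}))" for r s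
  have "P 0 1"
  proof (rule Bolzano)
    fix p q t assume P: "P p q" "P q t" and pqt: "p \<le> q" "q \<le> t"
    show "P p t" unfolding P_def
    proof (intro impI)
      assume "0 \<le> p" "t \<le> 1"
      have eq: "{0..1} \<times> {p..t} = {0..1::real} \<times> {p..q} \<union> {0..1} \<times> {q..t}" using pqt by auto
      have int: "({0..1::real} \<times> {p..q}) \<inter> ({0..1} \<times> {q..t}) = {0..1} \<times> {q}" using pqt by auto
      show "triv ({0..1} \<times> {p..t})" unfolding eq
      proof (rule glue)
        fix u v assume u: "u \<in> {0..1::real} \<times> {p..q}" and v: "v \<in> {0..1::real} \<times> {q..t}" and uv: "dist u v < e"
        have "dist u (fst u, q) \<le> dist u v \<and> dist (fst u, q) v \<le> dist u v"
          by (rule near) (use u v in \<open>auto simp: mem_Times_iff\<close>)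
        moreover have "(fst u, q) \<in> {0..1} \<times> {p..q} \<inter> ({0..1} \<times> {q..t})" unfolding int using u by (auto simp: mem_Times_iff)
        ultimately show "\<exists>w\<in>{0..1} \<times> {p..q} \<inter> ({0..1} \<times> {q..t}). dist u w < e \<and> dist w v < e" using uv by (meson le_less_trans)
      next
        show "connected ({0..1::real} \<times> {p..q} \<inter> ({0..1} \<times> {q..t}))" unfolding int by (intro connected_Times) auto
        show "{0..1::real} \<times> {p..q} \<inter> ({0..1} \<times> {q..t}) \<noteq> {}" unfolding int by auto
      qed (use P \<open>0 \<le> p\<close> \<open>t \<le> 1\<close> pqt in \<open>auto simp: P_def S_def\<close>)
    qed
  next
    fix x :: real
    show "\<exists>d>0. \<forall>a b. a \<le> x \<and> x \<le> b \<and> b - a < d \<longrightarrow> P a b"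
      by (rule exI[of _ "e/2"]) (use e(1) strip in \<open>auto simp: P_def\<close>)
  qed auto
  then have "triv S" unfolding P_def S_def by simp
  then obtain b where b: "b \<in> S \<rightarrow> carrier K" "\<And>u v. u \<in> S \<Longrightarrow> v \<in> S \<Longrightarrow> dist u v < e \<Longrightarrow> b u \<otimes> c u v = b v"
    unfolding triv_def by blast
  have "small_sets (top_of_set S) (\<lambda>A. \<forall>u\<in>A. \<forall>v\<in>A. b u \<otimes> c u v = b v)"
    unfolding small_sets_def
  proof
    fix x assume "x \<in> topspace (top_of_set S)"
    then have "x \<in> S" by simp
    show "\<exists>U. openin (top_of_set S) U \<and> x \<in> U \<and> (\<forall>A\<subseteq>U. \<forall>u\<in>A. \<forall>v\<in>A. b u \<otimes> c u v = b v)"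
    proof (intro exI conjI allI impI ballI)
      show "openin (top_of_set S) (S \<inter> ball x (e/2))" by (simp add: openin_open_Int)
      fix A u v assume A: "A \<subseteq> S \<inter> ball x (e/2)" "u \<in> A" "v \<in> A"
      then have "dist x u < e/2" "dist x v < e/2" by auto
      then have "dist u v < e" using dist_triangle_half_r by blast
      then show "b u \<otimes> c u v = b v" using b A by blast
    qed (use \<open>x \<in> S\<close> e in auto)
  qed
  then show thesis using that[of b] b unfolding trivialization_def S_def by simp
qed

section \<open>Homotopy classes of paths\<close>

text \<open>The endpoints are fixed but arbitrary, so that loops can be decomposed into paths
  between different points.\<close>

definition path_homotopic :: "'b topology \<Rightarrow> (real \<Rightarrow> 'b) \<Rightarrow> (real \<Rightarrow> 'b) \<Rightarrow> bool" where
  "path_homotopic X p q \<longleftrightarrow> p 0 = q 0 \<and> p 1 = q 1 \<and>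
     homotopic_with (\<lambda>r. r 0 = p 0 \<and> r 1 = p 1) (top_of_set {0..1}) X p q"

definition path_class :: "'b topology \<Rightarrow> (real \<Rightarrow> 'b) \<Rightarrow> (real \<Rightarrow> 'b) set" where
  "path_class X p = {q. path_homotopic X p q}"

text \<open>A product that depends on the classes alone: equations between classes can be
  substituted into it, which is not possible inside \<open>path_join\<close>.\<close>

definition path_mult :: "'b topology \<Rightarrow> (real \<Rightarrow> 'b) set \<Rightarrow> (real \<Rightarrow> 'b) set \<Rightarrow> (real \<Rightarrow> 'b) set" where
  "path_mult X A B = (\<Union>p\<in>A. \<Union>q\<in>B. path_class X (path_join p q))"

definition path_reverse :: "(real \<Rightarrow> 'b) \<Rightarrow> real \<Rightarrow> 'b" where
  "path_reverse p = (\<lambda>t. p (1 - t))"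

lemma path_homotopic_refl: "pathin X p \<Longrightarrow> path_homotopic X p p"
  unfolding path_homotopic_def pathin_def by simp

lemma path_homotopic_sym: "path_homotopic X p q \<Longrightarrow> path_homotopic X q p"
  unfolding path_homotopic_def by (auto intro: homotopic_with_symD)

lemma path_homotopic_trans: "path_homotopic X p q \<Longrightarrow> path_homotopic X q r \<Longrightarrow> path_homotopic X p r"
  unfolding path_homotopic_def by (auto intro: homotopic_with_trans)

lemma path_homotopic_imp_pathin:
  assumes "path_homotopic X p q" shows "pathin X p" "pathin X q"
  using assms homotopic_with_imp_continuous_maps unfolding path_homotopic_def pathin_def by blast+

lemma path_homotopic_ends: "path_homotopic X p q \<Longrightarrow> p 0 = q 0" "path_homotopic X p q \<Longrightarrow> p 1 = q 1"
  unfolding path_homotopic_def by auto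

lemma path_class_eqI: "path_homotopic X p q \<Longrightarrow> path_class X p = path_class X q"
  unfolding path_class_def using path_homotopic_sym path_homotopic_trans by blast

lemma path_class_eq_iff: "pathin X p \<Longrightarrow> path_class X p = path_class X q \<longleftrightarrow> path_homotopic X p q"
  using path_class_eqI path_homotopic_sym path_homotopic_refl unfolding path_class_def by blast

lemma pathin_in_topspace: "pathin X p \<Longrightarrow> t \<in> {0..1} \<Longrightarrow> p t \<in> topspace X"
  unfolding pathin_def by (metis PiE continuous_map_funspace topspace_euclidean_subtopology)

text \<open>All homotopies between paths that are needed below are images of linear homotopies in a convex set.\<close>

lemma path_homotopic_convex:
  fixes S :: "'a::real_normed_vector set"
  assumes "convex S" "continuous_map (top_of_set S) X F"
    and "continuous_on {0..1} a" "a \<in> {0..1} \<rightarrow> S" "continuous_on {0..1} b" "b \<in> {0..1} \<rightarrow> S"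
    and "a 0 = b 0" "a 1 = b 1"
  shows "path_homotopic X (F \<circ> a) (F \<circ> b)"
proof -
  define g where "g = (\<lambda>(t::real, s). (1 - t) *\<^sub>R a s + t *\<^sub>R b s)"
  have "continuous_on ({0..1} \<times> {0..1}) g"
  proof -
    have "continuous_on ({0..1::real} \<times> {0..1}) (\<lambda>z. a (snd z))" "continuous_on ({0..1::real} \<times> {0..1}) (\<lambda>z. b (snd z))"
      by (rule continuous_on_compose2[OF assms(3)], auto intro!: continuous_intros,
          rule continuous_on_compose2[OF assms(5)], auto intro!: continuous_intros)
    then show ?thesis unfolding g_def case_prod_beta by (intro continuous_intros)
  qed
  moreover have "g ` ({0..1} \<times> {0..1}) \<subseteq> S"
    unfolding g_def using assms(1,4,6) by (auto simp: Pi_iff intro!: convexD_alt)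
  ultimately have "continuous_map (top_of_set ({0..1} \<times> {0..1})) (top_of_set S) g"
    by auto
  then have "continuous_map (prod_topology (top_of_set {0..1}) (top_of_set {0..1})) X (F \<circ> g)"
    using assms(2) continuous_map_compose by (metis prod_topology_subtopology_eu)
  moreover have "g (t, 0) = a 0" "g (t, 1) = a 1" for t
    unfolding g_def using assms(7,8) by (auto simp: algebra_simps)
  ultimately have "homotopic_with (\<lambda>r. r 0 = (F \<circ> a) 0 \<and> r 1 = (F \<circ> a) 1) (top_of_set {0..1}) X (F \<circ> a) (F \<circ> b)"
    unfolding homotopic_with_def by (intro exI[of _ "F \<circ> g"]) (auto simp: g_def)
  then show ?thesis unfolding path_homotopic_def using assms by auto
qed

lemma pathin_compose_real:
  assumes "pathin X p" "continuous_on {0..1} a" "a \<in> {0..1} \<rightarrow> {0..1}"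
  shows "pathin X (p \<circ> a)"
  using assms unfolding pathin_def
  by (intro continuous_map_compose[of _ "top_of_set {0..1}"]) auto

lemma pathin_reverse: "pathin X p \<Longrightarrow> pathin X (path_reverse p)"
  using pathin_compose_real[of X p "\<lambda>t. 1 - t", OF _ continuous_on_diff[OF continuous_on_const continuous_on_id]]
  unfolding path_reverse_def comp_def by auto

lemma path_reverse_ends [simp]: "path_reverse p 0 = p 1" "path_reverse p 1 = p 0"
  "path_reverse (path_reverse p) = p"
  unfolding path_reverse_def by auto

lemma path_join_ends [simp]: "path_join p q 0 = p 0" "path_join p q 1 = q 1"
  unfolding path_join_def by auto

lemma path_join_comp: "F \<circ> path_join a b = path_join (F \<circ> a) (F \<circ> b)"
  unfolding path_join_def by auto

lemma pathin_const: "x \<in> topspace X \<Longrightarrow> pathin X (\<lambda>_. x)"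
  unfolding pathin_def by simp

text \<open>The parameter space \<open>Z\<close> is the time interval of the homotopies that are
  joined in \<open>path_homotopic_join\<close>.\<close>

lemma continuous_map_join:
  assumes "continuous_map (prod_topology Z (top_of_set {0..1})) X f"
    and "continuous_map (prod_topology Z (top_of_set {0..1})) X g"
    and "\<And>z. z \<in> topspace Z \<Longrightarrow> f (z, 1) = g (z, 0)"
  shows "continuous_map (prod_topology Z (top_of_set {0..1})) X
    (\<lambda>(z, t::real). if t \<le> 1/2 then f (z, 2 * t) else g (z, 2 * t - 1))"
proof -
  let ?Y = "prod_topology Z (top_of_set {0..1::real})"
  have snd: "continuous_map ?Y euclideanreal snd"
    using continuous_map_snd continuous_map_into_fulltopology by blast
  have "continuous_map ?Y X (\<lambda>w. if snd w \<le> 1/2 then f (fst w, 2 * snd w) else g (fst w, 2 * snd w - 1))"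
  proof (rule continuous_map_cases_le)
    show "continuous_map (subtopology ?Y {w \<in> topspace ?Y. snd w \<le> 1/2}) X (\<lambda>w. f (fst w, 2 * snd w))"
    proof -
      have "continuous_map (subtopology ?Y {w \<in> topspace ?Y. snd w \<le> 1/2}) ?Y (\<lambda>w. (fst w, 2 * snd w))"
        using continuous_map_fst snd
        by (intro continuous_map_pairedI continuous_map_into_subtopology continuous_map_real_mult continuous_map_from_subtopology) (auto simp: topspace_subtopology)
      from continuous_map_compose[OF this assms(1)] show ?thesis by (simp add: comp_def)
    qed
    show "continuous_map (subtopology ?Y {w \<in> topspace ?Y. 1/2 \<le> snd w}) X (\<lambda>w. g (fst w, 2 * snd w - 1))"
    proof -
      have "continuous_map (subtopology ?Y {w \<in> topspace ?Y. 1/2 \<le> snd w}) ?Y (\<lambda>w. (fst w, 2 * snd w - 1))"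
        using continuous_map_fst snd
        by (intro continuous_map_pairedI continuous_map_into_subtopology continuous_map_diff continuous_map_real_mult continuous_map_from_subtopology) (auto simp: topspace_subtopology)
      from continuous_map_compose[OF this assms(2)] show ?thesis by (simp add: comp_def)
    qed
    fix w assume w: "w \<in> topspace ?Y" "snd w = 1/2"
    then have "2 * snd w = 1" "2 * snd w - 1 = 0" "fst w \<in> topspace Z" by (auto simp: mem_Times_iff)
    then show "f (fst w, 2 * snd w) = g (fst w, 2 * snd w - 1)"
      using assms(3) by metis
  qed (use snd in auto)
  then show ?thesis by (simp add: case_prod_beta')
qed

lemma path_homotopic_join:
  assumes "path_homotopic X p p'" "path_homotopic X q q'" "p 1 = q 0"
  shows "path_homotopic X (path_join p q) (path_join p' q')"
proof -
  let ?I = "top_of_set {0..1::real}"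
  obtain f where f: "continuous_map (prod_topology ?I ?I) X f" "\<And>s. f (0, s) = p s" "\<And>s. f (1, s) = p' s"
    "\<And>t. t \<in> {0..1} \<Longrightarrow> f (t, 0) = p 0 \<and> f (t, 1) = p 1"
    using assms(1) unfolding path_homotopic_def homotopic_with_def by blast
  obtain g where g: "continuous_map (prod_topology ?I ?I) X g" "\<And>s. g (0, s) = q s" "\<And>s. g (1, s) = q' s"
    "\<And>t. t \<in> {0..1} \<Longrightarrow> g (t, 0) = q 0 \<and> g (t, 1) = q 1"
    using assms(2) unfolding path_homotopic_def homotopic_with_def by blast
  let ?h = "\<lambda>(z, t::real). if t \<le> 1/2 then f (z, 2 * t) else g (z, 2 * t - 1)"
  have "continuous_map (prod_topology ?I ?I) X ?h"
    by (rule continuous_map_join) (use f g assms(3) in auto)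
  then have "homotopic_with (\<lambda>r. r 0 = path_join p q 0 \<and> r 1 = path_join p q 1) ?I X (path_join p q) (path_join p' q')"
    unfolding homotopic_with_def
    by (intro exI[of _ ?h]) (use f g in \<open>auto simp: path_join_def\<close>)
  then show ?thesis using assms unfolding path_homotopic_def by simp
qed

lemma pathin_join: "pathin X p \<Longrightarrow> pathin X q \<Longrightarrow> p 1 = q 0 \<Longrightarrow> pathin X (path_join p q)"
  using path_homotopic_join path_homotopic_refl path_homotopic_imp_pathin by metis

lemma path_mult_class:
  assumes "pathin X p" "pathin X q" "p 1 = q 0"
  shows "path_mult X (path_class X p) (path_class X q) = path_class X (path_join p q)"
proof -
  have "path_class X (path_join p' q') = path_class X (path_join p q)"
    if "p' \<in> path_class X p" "q' \<in> path_class X q" for p' q'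
    using that path_homotopic_join assms unfolding path_class_def
    by (metis mem_Collect_eq path_class_def path_class_eqI)
  moreover have "p \<in> path_class X p" "q \<in> path_class X q"
    using assms path_homotopic_refl unfolding path_class_def by auto
  ultimately show ?thesis unfolding path_mult_def by blast
qed

lemma path_class_assoc:
  assumes "pathin X p" "pathin X q" "pathin X r" "p 1 = q 0" "q 1 = r 0"
  shows "path_class X (path_join (path_join p q) r) = path_class X (path_join p (path_join q r))"
proof -
  \<comment> \<open>The reparametrization has slopes 2, 1 and 1/2 with breaks at 1/4 and 1/2. It is
    concave, hence the minimum of its three linear pieces.\<close>
  let ?F = "path_join p (path_join q r)" and ?a = "\<lambda>t::real. min (2 * t) (min (t + 1/4) ((t + 1)/2))"
  have "path_join (path_join p q) r = ?F \<circ> ?a"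
  proof
    fix t :: real
    consider "t \<le> 1/4" | "1/4 < t" "t \<le> 1/2" | "1/2 < t" by linarith
    then show "path_join (path_join p q) r t = (?F \<circ> ?a) t"
    proof cases
      case 1
      then have "?a t = 2 * t" by (simp add: min_def field_simps)
      then show ?thesis using 1 by (simp add: path_join_def)
    next
      case 2
      then have "?a t = t + 1/4" by (simp add: min_def field_simps)
      then show ?thesis using 2 by (simp add: path_join_def algebra_simps)
    next
      case 3
      then have "?a t = (t + 1)/2" by (simp add: min_def field_simps)
      then show ?thesis using 3 by (simp add: path_join_def field_simps)
    qed
  qed
  moreover have "path_homotopic X (?F \<circ> ?a) (?F \<circ> (\<lambda>t. t))"
    by (rule path_homotopic_convex[of "{0..1}"])
       (use pathin_join[OF assms(1) pathin_join[OF assms(2,3,5)]] assms(4) in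
         \<open>auto simp: pathin_def min_le_iff_disj intro!: continuous_intros\<close>)
  ultimately show ?thesis unfolding comp_def by (metis path_class_eqI)
qed

lemma path_class_const_left:
  assumes "pathin X p" "x = p 0" shows "path_class X (path_join (\<lambda>_. x) p) = path_class X p"
proof -
  have "path_join (\<lambda>_. x) p = p \<circ> (\<lambda>t. max 0 (2 * t - 1))"
    by (auto simp: fun_eq_iff path_join_def assms(2) min_absorb1 min_absorb2 max_absorb1 max_absorb2)
  moreover have "path_homotopic X (p \<circ> (\<lambda>t. max 0 (2 * t - 1))) (p \<circ> (\<lambda>t. t))"
    by (rule path_homotopic_convex[of "{0..1}"])
       (use assms in \<open>auto simp: pathin_def intro!: continuous_intros\<close>)
  ultimately show ?thesis unfolding comp_def by (metis path_class_eqI)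
qed

lemma path_class_const_right:
  assumes "pathin X p" "x = p 1" shows "path_class X (path_join p (\<lambda>_. x)) = path_class X p"
proof -
  have "path_join p (\<lambda>_. x) = p \<circ> (\<lambda>t. min (2 * t) 1)"
    by (auto simp: fun_eq_iff path_join_def assms(2) min_absorb1 min_absorb2 max_absorb1 max_absorb2)
  moreover have "path_homotopic X (p \<circ> (\<lambda>t. min (2 * t) 1)) (p \<circ> (\<lambda>t. t))"
    by (rule path_homotopic_convex[of "{0..1}"])
       (use assms in \<open>auto simp: pathin_def intro!: continuous_intros\<close>)
  ultimately show ?thesis unfolding comp_def by (metis path_class_eqI)
qed

lemma path_class_reverse_right:
  assumes "pathin X p" shows "path_class X (path_join p (path_reverse p)) = path_class X (\<lambda>_. p 0)"
proof -
  \<comment> \<open>The path is \<open>p\<close> after a tent function, and the tent can be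
    flattened to 0 without moving its ends.\<close>
  have "path_join p (path_reverse p) = p \<circ> (\<lambda>t. min (2 * t) (2 - 2 * t))"
    by (auto simp: fun_eq_iff path_join_def path_reverse_def min_absorb1 min_absorb2 max_absorb1 max_absorb2)
  moreover have "path_homotopic X (p \<circ> (\<lambda>t. min (2 * t) (2 - 2 * t))) (p \<circ> (\<lambda>t. 0))"
    by (rule path_homotopic_convex[of "{0..1}"])
       (use assms in \<open>auto simp: pathin_def min_le_iff_disj intro!: continuous_intros\<close>)
  ultimately show ?thesis unfolding comp_def by (metis path_class_eqI)
qed

lemma path_class_reverse_left:
  assumes "pathin X p" shows "path_class X (path_join (path_reverse p) p) = path_class X (\<lambda>_. p 1)"
  using path_class_reverse_right[OF pathin_reverse[OF assms]] by simp

text \<open>The two ways along the boundary of the square from \<open>(0, 0)\<close> to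
  \<open>(1, 1)\<close> are homotopic because the square is convex.\<close>

lemma path_homotopic_square:
  assumes "continuous_map (top_of_set ({0..1} \<times> {0..1})) X F"
  shows "path_class X (path_join (\<lambda>t. F (0, t)) (\<lambda>t. F (t, 1))) =
    path_class X (path_join (\<lambda>t. F (t, 0)) (\<lambda>t. F (1, t)))"
proof -
  let ?a = "\<lambda>t::real. (max 0 (2 * t - 1), min 1 (2 * t))" and ?b = "\<lambda>t::real. (min 1 (2 * t), max 0 (2 * t - 1))"
  have "path_join (\<lambda>t. F (0, t)) (\<lambda>t. F (t, 1)) = F \<circ> ?a" "path_join (\<lambda>t. F (t, 0)) (\<lambda>t. F (1, t)) = F \<circ> ?b"
    by (auto simp: fun_eq_iff path_join_def min_absorb1 min_absorb2 max_absorb1 max_absorb2)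
  moreover have "path_homotopic X (F \<circ> ?a) (F \<circ> ?b)"
    by (rule path_homotopic_convex[OF _ assms])
       (auto intro!: continuous_intros convex_Times)
  ultimately show ?thesis by (metis path_class_eqI)
qed

lemma path_homotopic_image:
  assumes "continuous_map X Y f" "path_homotopic X p q" shows "path_homotopic Y (f \<circ> p) (f \<circ> q)"
proof -
  have "homotopic_with (\<lambda>r. r 0 = (f \<circ> p) 0 \<and> r 1 = (f \<circ> p) 1) (top_of_set {0..1}) Y (f \<circ> p) (f \<circ> q)"
    by (rule homotopic_with_compose_continuous_map_left[where p = "\<lambda>r. r 0 = p 0 \<and> r 1 = p 1"])
       (use assms in \<open>auto simp: path_homotopic_def\<close>)
  then show ?thesis using assms(2) unfolding path_homotopic_def by simp
qed

lemma pathin_image: "continuous_map X Y f \<Longrightarrow> pathin X p \<Longrightarrow> pathin Y (f \<circ> p)"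
  unfolding pathin_def by (rule continuous_map_compose)

section \<open>The fundamental group\<close>

lemma loopsD: "p \<in> loops X x \<Longrightarrow> pathin X p" "p \<in> loops X x \<Longrightarrow> p 0 = x" "p \<in> loops X x \<Longrightarrow> p 1 = x"
  unfolding loops_def by auto

text \<open>Passes from the classes that make up the fundamental group to classes of paths, where
  intermediate steps may leave the base point.\<close>

lemma loop_homotopy_class:
  assumes p: "p \<in> loops X x" shows "loop_homotopy X x `` {p} = path_class X p"
proof (rule Set.set_eqI)
  fix q
  have "path_homotopic X p q \<longleftrightarrow> q \<in> loops X x \<and>
      homotopic_with (\<lambda>r. r 0 = x \<and> r 1 = x) (top_of_set {0..1}) X p q"
    using path_homotopic_imp_pathin(2)[of X p q] loopsD[OF p]
    unfolding path_homotopic_def loops_def by auto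
  then show "q \<in> loop_homotopy X x `` {p} \<longleftrightarrow> q \<in> path_class X p"
    unfolding loop_homotopy_def path_class_def using p by simp
qed

lemma fundamental_carrier:
  "A \<in> carrier (fundamental_group X x) \<longleftrightarrow> (\<exists>p\<in>loops X x. A = path_class X p)"
  unfolding fundamental_group_def quotient_def using loop_homotopy_class by fastforce

lemma path_class_loops:
  "p \<in> loops X x \<Longrightarrow> q \<in> path_class X p \<Longrightarrow> q \<in> loops X x"
  using path_homotopic_imp_pathin(2) path_homotopic_ends unfolding path_class_def loops_def by fastforce

lemma loops_join: "p \<in> loops X x \<Longrightarrow> q \<in> loops X x \<Longrightarrow> path_join p q \<in> loops X x"
  unfolding loops_def using pathin_join by fastforce

lemma loops_reverse: "p \<in> loops X x \<Longrightarrow> path_reverse p \<in> loops X x"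
  unfolding loops_def using pathin_reverse by fastforce

lemma loops_const: "x \<in> topspace X \<Longrightarrow> (\<lambda>_. x) \<in> loops X x"
  unfolding loops_def using pathin_const by fastforce

lemma fundamental_mult:
  assumes "p \<in> loops X x" "q \<in> loops X x"
  shows "path_class X p \<otimes>\<^bsub>fundamental_group X x\<^esub> path_class X q = path_class X (path_join p q)"
proof -
  have "path_class X p \<otimes>\<^bsub>fundamental_group X x\<^esub> path_class X q = path_mult X (path_class X p) (path_class X q)"
  proof -
    have *: "loop_homotopy X x `` {path_join a b} = path_class X (path_join a b)"
      if "a \<in> path_class X p" "b \<in> path_class X q" for a b
      by (rule loop_homotopy_class[OF loops_join[OF path_class_loops[OF assms(1) that(1)] path_class_loops[OF assms(2) that(2)]]])
    show ?thesis
      unfolding fundamental_group_def path_mult_def monoid.simps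
      by (rule SUP_cong[OF refl SUP_cong[OF refl *]])
  qed
  then show ?thesis using path_mult_class assms loopsD by metis
qed

lemma fundamental_one: "x \<in> topspace X \<Longrightarrow> \<one>\<^bsub>fundamental_group X x\<^esub> = path_class X (\<lambda>_. x)"
  unfolding fundamental_group_def using loop_homotopy_class loops_const by fastforce

lemma group_fundamental_group:
  assumes "x \<in> topspace X" shows "group (fundamental_group X x)"
proof (rule groupI)
  let ?G = "fundamental_group X x"
  show "\<one>\<^bsub>?G\<^esub> \<in> carrier ?G" using assms fundamental_one fundamental_carrier loops_const by metis
  fix A assume "A \<in> carrier ?G"
  then obtain p where p: "p \<in> loops X x" "A = path_class X p" unfolding fundamental_carrier by blast
  show "\<one>\<^bsub>?G\<^esub> \<otimes>\<^bsub>?G\<^esub> A = A"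
    using p assms path_class_const_left[OF loopsD(1)[OF p(1)], of x] loopsD[OF p(1)]
    by (simp add: fundamental_one fundamental_mult loops_const)
  have "path_class X (path_reverse p) \<otimes>\<^bsub>?G\<^esub> A = \<one>\<^bsub>?G\<^esub>"
    using p assms path_class_reverse_left[OF loopsD(1)[OF p(1)]] loopsD[OF p(1)]
    by (simp add: fundamental_one fundamental_mult loops_reverse)
  then show "\<exists>B\<in>carrier ?G. B \<otimes>\<^bsub>?G\<^esub> A = \<one>\<^bsub>?G\<^esub>"
    using loops_reverse[OF p(1)] fundamental_carrier by metis
  fix B assume "B \<in> carrier ?G"
  then obtain q where q: "q \<in> loops X x" "B = path_class X q" unfolding fundamental_carrier by blast
  show "A \<otimes>\<^bsub>?G\<^esub> B \<in> carrier ?G" using p q fundamental_mult loops_join fundamental_carrier by metis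
  fix C assume "C \<in> carrier ?G"
  then obtain r where r: "r \<in> loops X x" "C = path_class X r" unfolding fundamental_carrier by blast
  show "A \<otimes>\<^bsub>?G\<^esub> B \<otimes>\<^bsub>?G\<^esub> C = A \<otimes>\<^bsub>?G\<^esub> (B \<otimes>\<^bsub>?G\<^esub> C)"
    using path_class_assoc[of X p q r] loopsD[OF p(1)] loopsD[OF q(1)] loopsD[OF r(1)]
    by (simp add: p q r fundamental_mult loops_join)
qed

lemma loops_image: "continuous_map X Y f \<Longrightarrow> p \<in> loops X x \<Longrightarrow> f \<circ> p \<in> loops Y (f x)"
  unfolding loops_def using pathin_image by fastforce

lemma induced_fundamental_class:
  assumes "continuous_map X Y f" "p \<in> loops X x" "f x = y"
  shows "induced_fundamental Y y f (path_class X p) = path_class Y (f \<circ> p)"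
proof -
  have "loop_homotopy Y y `` {f \<circ> q} = path_class Y (f \<circ> p)" if "q \<in> path_class X p" for q
  proof -
    have "f \<circ> q \<in> loops Y y" using loops_image path_class_loops assms that by metis
    moreover have "path_homotopic Y (f \<circ> p) (f \<circ> q)"
      using that path_homotopic_image assms(1) unfolding path_class_def by blast
    ultimately show ?thesis using loop_homotopy_class[of "f \<circ> q" Y y] path_class_eqI[of Y "f \<circ> p" "f \<circ> q"] by simp
  qed
  moreover have "p \<in> path_class X p" using path_homotopic_refl[OF loopsD(1)[OF assms(2)]] unfolding path_class_def by simp
  ultimately show ?thesis unfolding induced_fundamental_def by blast
qed

lemma induced_fundamental_hom:
  assumes "continuous_map X Y f" "f x = y"
  shows "induced_fundamental Y y f \<in> hom (fundamental_group X x) (fundamental_group Y y)"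
proof (rule homI)
  fix A assume "A \<in> carrier (fundamental_group X x)"
  then obtain p where p: "p \<in> loops X x" "A = path_class X p" unfolding fundamental_carrier by blast
  show "induced_fundamental Y y f A \<in> carrier (fundamental_group Y y)"
    unfolding fundamental_carrier using p induced_fundamental_class assms loops_image by metis
  fix B assume "B \<in> carrier (fundamental_group X x)"
  then obtain q where q: "q \<in> loops X x" "B = path_class X q" unfolding fundamental_carrier by blast
  show "induced_fundamental Y y f (A \<otimes>\<^bsub>fundamental_group X x\<^esub> B) =
      induced_fundamental Y y f A \<otimes>\<^bsub>fundamental_group Y y\<^esub> induced_fundamental Y y f B"
    using p q assms induced_fundamental_class[OF assms(1) _ assms(2)] loops_image[OF assms(1)]
    by (simp add: fundamental_mult loops_join path_join_comp) (metis fundamental_mult)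
qed

lemma induced_fundamental_comp:
  assumes "continuous_map X Y f" "continuous_map Y Z g" "f x = y" "g y = z"
    and "A \<in> carrier (fundamental_group X x)"
  shows "induced_fundamental Z z g (induced_fundamental Y y f A) = induced_fundamental Z z (g \<circ> f) A"
proof -
  obtain p where p: "p \<in> loops X x" "A = path_class X p" using assms(5) unfolding fundamental_carrier by blast
  have "f \<circ> p \<in> loops Y y" using loops_image assms p by metis
  then show ?thesis
    using p induced_fundamental_class[OF assms(1) p(1) assms(3)] induced_fundamental_class[OF assms(2) _ assms(4)]
      induced_fundamental_class[OF continuous_map_compose[OF assms(1,2)] p(1), of z] assms(3,4)
    by (simp add: comp_assoc)
qed

lemma induced_fundamental_id:
  assumes "A \<in> carrier (fundamental_group X x)"
  shows "induced_fundamental X x id A = A"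
  using assms induced_fundamental_class[of X X id _ x x] unfolding fundamental_carrier by auto

section \<open>Holonomy of cocycles along paths\<close>

text \<open>The parallel transport of \<open>c\<close> along \<open>p\<close>. A trivialization
  along \<open>p\<close> is unique up to a constant factor on the left, which cancels in the
  quotient of its end values; so the choice is immaterial.\<close>

definition holonomy :: "('k, 'm) monoid_scheme \<Rightarrow> ('b \<Rightarrow> 'b \<Rightarrow> 'k) \<Rightarrow> (real \<Rightarrow> 'b) \<Rightarrow> 'k" where
  "holonomy K c p = (SOME k. \<exists>b. trivialization (top_of_set {0..1}) K (\<lambda>s t. c (p s) (p t)) b \<and>
     k = inv\<^bsub>K\<^esub> b 0 \<otimes>\<^bsub>K\<^esub> b 1)"

definition monodromy :: "('k, 'm) monoid_scheme \<Rightarrow> ('b \<Rightarrow> 'b \<Rightarrow> 'k) \<Rightarrow> (real \<Rightarrow> 'b) set \<Rightarrow> 'k" where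
  "monodromy K c A = holonomy K c (SOME p. p \<in> A)"

lemma trivialization_cong:
  fixes K (structure)
  assumes "trivialization X K c b" "\<And>u v. u \<in> topspace X \<Longrightarrow> v \<in> topspace X \<Longrightarrow> c' u v = c u v"
  shows "trivialization X K c' b"
  unfolding trivialization_def
proof
  show "small_sets X (\<lambda>A. \<forall>u\<in>A. \<forall>v\<in>A. b u \<otimes> c' u v = b v)"
    by (rule small_sets_mono[OF assms(1)[unfolded trivialization_def, THEN conjunct2]])
       (simp add: assms(2) subset_iff)
qed (use assms(1) in \<open>simp add: trivialization_def\<close>)

text \<open>Pulling \<open>p\<close> back along the first projection turns the case of an interval
  into that of the square.\<close>

lemma trivialization_along_path:
  assumes "group K" "cocycle X K c" "pathin X p"
  obtains b where "trivialization (top_of_set {0..1}) K (\<lambda>s t. c (p s) (p t)) b"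
proof -
  have f: "continuous_map (top_of_set ({0..1::real} \<times> {0..1::real})) X (p \<circ> fst)"
    using assms(3) unfolding pathin_def
    by (intro continuous_map_compose[of _ "top_of_set {0..1}"]) (auto intro!: continuous_intros)
  obtain b where "trivialization (top_of_set ({0..1::real} \<times> {0..1::real})) K (\<lambda>u v. c ((p \<circ> fst) u) ((p \<circ> fst) v)) b"
    by (rule cocycle_on_square_trivial[OF assms(1) cocycle_pullback[OF f assms(2)]]) (rule that)
  moreover have "continuous_map (top_of_set {0..1}) (top_of_set ({0..1::real} \<times> {0..1})) (\<lambda>t::real. (t, 0::real))"
    by (auto intro!: continuous_intros)
  ultimately have "trivialization (top_of_set {0..1}) K (\<lambda>s t. c ((p \<circ> fst) (s, 0::real)) ((p \<circ> fst) (t, 0::real)))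
      (b \<circ> (\<lambda>t. (t, 0)))"
    by (rule trivialization_pullback[rotated])
  then show thesis using that by simp
qed

text \<open>The quotient of two trivializations is locally constant on the connected unit interval,
  by the same cancellation as in \<open>trivialization_glue\<close>.\<close>

lemma holonomy_eq:
  fixes K (structure)
  assumes "group K" "cocycle X K c" "pathin X p"
    and b: "trivialization (top_of_set {0..1}) K (\<lambda>s t. c (p s) (p t)) b"
  shows "holonomy K c p = inv b 0 \<otimes> b 1"
proof -
  interpret group K by fact
  let ?I = "top_of_set {0..1::real}"
  have "inv d 0 \<otimes> d 1 = inv b 0 \<otimes> b 1"
    if d: "trivialization ?I K (\<lambda>s t. c (p s) (p t)) d" for d
  proof -
    have bd: "t \<in> {0..1} \<Longrightarrow> b t \<in> carrier K" "t \<in> {0..1} \<Longrightarrow> d t \<in> carrier K" for t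
      using b d unfolding trivialization_def by auto
    have small: "small_sets ?I (\<lambda>A. cocycle_on K (\<lambda>s t. c (p s) (p t)) A \<and>
        (\<forall>u\<in>A. \<forall>v\<in>A. b u \<otimes> c (p u) (p v) = b v) \<and> (\<forall>u\<in>A. \<forall>v\<in>A. d u \<otimes> c (p u) (p v) = d v))"
      using b d cocycle_pullback[OF _ assms(2)] assms(3) unfolding trivialization_def cocycle_def pathin_def
      by (intro small_sets_conj) blast+
    have "d 0 \<otimes> inv b 0 = d 1 \<otimes> inv b 1"
    proof (rule connected_local_const[of "{0..1::real}"], simp_all, intro ballI)
      fix t :: real assume t: "t \<in> {0..1}"
      then have "t \<in> topspace ?I" by simp
      then obtain U where U: "openin ?I U" "t \<in> U" and *: "cocycle_on K (\<lambda>s t. c (p s) (p t)) U \<and>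
        (\<forall>u\<in>U. \<forall>v\<in>U. b u \<otimes> c (p u) (p v) = b v) \<and> (\<forall>u\<in>U. \<forall>v\<in>U. d u \<otimes> c (p u) (p v) = d v)"
        by (rule small_setsE[OF small])
      obtain W where W: "open W" "U = {0..1} \<inter> W" using U(1) unfolding openin_open by blast
      have "\<forall>\<^sub>F s in at t within {0..1}. s \<in> U"
        using W U(2) by (auto simp: eventually_at_topological)
      then show "\<forall>\<^sub>F s in at t within {0..1}. d t \<otimes> inv b t = d s \<otimes> inv b s"
      proof (rule eventually_mono)
        fix s assume s: "s \<in> U"
        then have "b t \<otimes> c (p t) (p s) = b s" "d t \<otimes> c (p t) (p s) = d s" "c (p t) (p s) \<in> carrier K"
          using * U unfolding cocycle_on_def by auto
        then show "d t \<otimes> inv b t = d s \<otimes> inv b s"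
          using bd[of t] t
          by (metis inv_closed inv_mult_group inv_solve_right' m_assoc m_closed r_inv r_one)
      qed
    qed
    moreover have "b 0 \<in> carrier K" "b 1 \<in> carrier K" "d 0 \<in> carrier K" "d 1 \<in> carrier K" using bd by auto
    ultimately show ?thesis
      by (metis inv_closed inv_mult_group inv_inv inv_solve_left inv_solve_right m_assoc m_closed)
  qed
  then show ?thesis unfolding holonomy_def
    by (rule_tac someI2[where a = "inv b 0 \<otimes> b 1"]) (use b in blast)+
qed

lemma holonomy_closed:
  assumes "group K" "cocycle X K c" "pathin X p" shows "holonomy K c p \<in> carrier K"
proof -
  interpret group K by fact
  obtain b where b: "trivialization (top_of_set {0..1}) K (\<lambda>s t. c (p s) (p t)) b"
    using trivialization_along_path[OF assms] .
  have "b 0 \<in> carrier K" "b 1 \<in> carrier K" using b unfolding trivialization_def by auto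
  then show ?thesis using holonomy_eq[OF assms b] by simp
qed

text \<open>When the cocycle identity holds on the whole path, \<open>c (p 0) (p t)\<close> is a
  trivialization, and its value at 0 is an idempotent of the group, hence the identity.\<close>

lemma holonomy_small:
  fixes K (structure)
  assumes "group K" "cocycle X K c" "pathin X p" "cocycle_on K c (p ` {0..1})"
  shows "holonomy K c p = c (p 0) (p 1)"
proof -
  interpret group K by fact
  have c: "c (p s) (p t) \<in> carrier K" "c (p s) (p t) \<otimes> c (p t) (p r) = c (p s) (p r)"
    if "s \<in> {0..1}" "t \<in> {0..1}" "r \<in> {0..1}" for r s t
    using assms(4) that unfolding cocycle_on_def by auto
  have "trivialization (top_of_set {0..1}) K (\<lambda>s t. c (p s) (p t)) (\<lambda>t. c (p 0) (p t))"
    unfolding trivialization_def by (auto intro!: small_sets_True c(1) c(2))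
  then have "holonomy K c p = inv c (p 0) (p 0) \<otimes> c (p 0) (p 1)"
    using holonomy_eq[OF assms(1-3)] by blast
  moreover have "c (p 0) (p 0) = \<one>" using c[of 0 0 0] by (simp add: l_cancel_one)
  ultimately show ?thesis using c(1)[of 0 1 0] by simp
qed

lemma holonomy_const:
  fixes K (structure)
  assumes "group K" "cocycle X K c" "x \<in> topspace X" shows "holonomy K c (\<lambda>_. x) = \<one>"
proof -
  interpret group K by fact
  have "cocycle_on K c {x}" using cocycle_at[OF assms(2,3)] unfolding cocycle_on_def by simp
  then have "holonomy K c (\<lambda>_. x) = c x x"
    by (intro holonomy_small[OF assms(1,2) pathin_const[OF assms(3)]]) (auto simp: image_constant_conv)
  then show ?thesis using cocycle_at[OF assms(2,3)] by (simp add: l_cancel_one)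
qed

text \<open>A trivialization along the joined path restricts to both halves, and its value at the
  midpoint cancels in the product.\<close>

lemma holonomy_join:
  fixes K (structure)
  assumes "group K" "cocycle X K c" "pathin X p" "pathin X q" "p 1 = q 0"
  shows "holonomy K c (path_join p q) = holonomy K c p \<otimes> holonomy K c q"
proof -
  interpret group K by fact
  let ?I = "top_of_set {0..1::real}" and ?r = "path_join p q"
  have r: "pathin X ?r" using pathin_join assms by blast
  obtain b where b: "trivialization ?I K (\<lambda>s t. c (?r s) (?r t)) b"
    using trivialization_along_path[OF assms(1,2) r] .
  have h: "continuous_map ?I ?I (\<lambda>t. t / 2)" "continuous_map ?I ?I (\<lambda>t. (t + 1) / 2)"
    by (auto intro!: continuous_intros)
  have t: "trivialization ?I K (\<lambda>s t. c (?r (s/2)) (?r (t/2))) (\<lambda>t. b (t / 2))"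
    "trivialization ?I K (\<lambda>s t. c (?r ((s+1)/2)) (?r ((t+1)/2))) (\<lambda>t. b ((t+1) / 2))"
    using trivialization_pullback[OF h(1) b] trivialization_pullback[OF h(2) b] by (simp_all add: comp_def)
  have "?r (t/2) = p t" if "t \<le> 1" for t using that unfolding path_join_def by auto
  \<comment> \<open>At the midpoint \<open>path_join\<close> takes the value \<open>p 1\<close>, so
    \<open>t = 0\<close> needs the hypothesis that the paths fit together.\<close>
  moreover have "?r ((t+1)/2) = q t" if "t \<ge> 0" for t using that assms(5) unfolding path_join_def add_divide_distrib by (cases "t = 0") auto
  ultimately have t': "trivialization ?I K (\<lambda>s t. c (p s) (p t)) (\<lambda>t. b (t / 2))"
    "trivialization ?I K (\<lambda>s t. c (q s) (q t)) (\<lambda>t. b ((t + 1) / 2))"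
    using trivialization_cong[OF t(1), of "\<lambda>s t. c (p s) (p t)"] trivialization_cong[OF t(2), of "\<lambda>s t. c (q s) (q t)"]
    by simp_all
  have "holonomy K c p = inv b 0 \<otimes> b (1/2)" "holonomy K c q = inv b (1/2) \<otimes> b 1"
    using holonomy_eq[OF assms(1,2,3) t'(1)] holonomy_eq[OF assms(1,2,4) t'(2)] by simp_all
  moreover have "b 0 \<in> carrier K" "b (1/2) \<in> carrier K" "b 1 \<in> carrier K" using b unfolding trivialization_def by auto
  ultimately show ?thesis using holonomy_eq[OF assms(1,2) r b]
    by (simp add: m_assoc) (metis inv_closed inv_solve_left m_closed)
qed

text \<open>The cocycle is trivialized on the whole homotopy square. Two opposite sides give the
  holonomies of \<open>p\<close> and \<open>q\<close>; the other two are constant paths with trivial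
  holonomy, so the values of the trivialization at the corners match.\<close>

lemma holonomy_homotopic:
  fixes K (structure)
  assumes "group K" "cocycle X K c" "path_homotopic X p q"
  shows "holonomy K c p = holonomy K c q"
proof -
  interpret group K by fact
  let ?I = "top_of_set {0..1::real}"
  have p: "pathin X p" "pathin X q" using path_homotopic_imp_pathin assms(3) by blast+
  obtain h where h: "continuous_map (prod_topology ?I ?I) X h" "\<And>s. h (0, s) = p s" "\<And>s. h (1, s) = q s"
    "\<And>t. t \<in> {0..1} \<Longrightarrow> h (t, 0) = p 0 \<and> h (t, 1) = p 1"
    using assms(3) unfolding path_homotopic_def homotopic_with_def by blast
  have h1: "continuous_map (top_of_set ({0..1} \<times> {0..1})) X h" using h(1) by (simp add: prod_topology_subtopology_eu)
  obtain b where b: "trivialization (top_of_set ({0..1} \<times> {0..1})) K (\<lambda>u v. c (h u) (h v)) b"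
    using cocycle_on_square_trivial[OF assms(1) cocycle_pullback[OF h1 assms(2)]] .
  have e: "trivialization ?I K (\<lambda>s t. c (h (e s)) (h (e t))) (b \<circ> e)"
    if "continuous_on {0..1} e" "e \<in> {0..1} \<rightarrow> {0..1} \<times> {0..1}" for e
    using trivialization_pullback[OF _ b, of ?I e] that by (simp add: image_subset_iff_funcset)
  have bc: "b z \<in> carrier K" if "z \<in> {0..1} \<times> {0..1}" for z using b that unfolding trivialization_def by auto
  have bottom: "holonomy K c p = inv b (0, 0) \<otimes> b (0, 1)"
    using holonomy_eq[OF assms(1,2) p(1), of "b \<circ> (\<lambda>t. (0, t))"] e[of "\<lambda>t. (0, t)"] by (simp add: h continuous_on_Pair)
  have top: "holonomy K c q = inv b (1, 0) \<otimes> b (1, 1)"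
    using holonomy_eq[OF assms(1,2) p(2), of "b \<circ> (\<lambda>t. (1, t))"] e[of "\<lambda>t. (1, t)"] by (simp add: h continuous_on_Pair)
  have side: "b (0, r) = b (1, r)" if r: "r = 0 \<or> r = 1" for r
  proof -
    have "trivialization ?I K (\<lambda>s t. c (h (s, r)) (h (t, r))) (\<lambda>t. b (t, r))"
      using e[of "\<lambda>t. (t, r)"] r by (auto simp: comp_def continuous_on_Pair)
    then have "trivialization ?I K (\<lambda>s t. c (p r) (p r)) (\<lambda>t. b (t, r))"
      by (rule trivialization_cong) (use h(4) r in auto)
    then have "holonomy K c (\<lambda>_. p r) = inv b (0, r) \<otimes> b (1, r)"
      using pathin_in_topspace[OF p(1), of r] r by (intro holonomy_eq[OF assms(1,2)] pathin_const) auto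
    then have "inv b (0, r) \<otimes> b (1, r) = \<one>"
      using holonomy_const[OF assms(1,2) pathin_in_topspace[OF p(1), of r]] r by auto
    moreover have "b (0, r) \<in> carrier K" "b (1, r) \<in> carrier K" using bc r by auto
    ultimately show ?thesis by (metis inv_closed inv_equality inv_inv)
  qed
  show ?thesis unfolding bottom top using side by simp
qed

text \<open>If \<open>d\<close> trivializes \<open>c\<close> along \<open>p\<close>, then
  \<open>d t \<otimes> b (p t)\<close> trivializes \<open>c'\<close>. For loops the result is a
  conjugation by the value of \<open>b\<close> at the base point, the source of all conjugations
  below.\<close>

lemma holonomy_cohomologous:
  fixes K (structure)
  assumes "group K" "cocycle X K c" "cocycle X K c'" "cohomologous_by X K b c c'" "pathin X p"
  shows "holonomy K c' p = inv b (p 0) \<otimes> holonomy K c p \<otimes> b (p 1)"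
proof -
  interpret group K by fact
  let ?I = "top_of_set {0..1::real}"
  obtain d where d: "trivialization ?I K (\<lambda>s t. c (p s) (p t)) d"
    using trivialization_along_path[OF assms(1,2,5)] .
  have pc: "continuous_map ?I X p" using assms(5) unfolding pathin_def .
  have bc: "t \<in> {0..1} \<Longrightarrow> b (p t) \<in> carrier K" for t
    using assms(4) pathin_in_topspace[OF assms(5)] unfolding cohomologous_by_def by blast
  have dc: "t \<in> {0..1} \<Longrightarrow> d t \<in> carrier K" for t using d unfolding trivialization_def by auto
  have 1: "small_sets ?I (\<lambda>A. cocycle_on K c (p ` A) \<and> cocycle_on K c' (p ` A) \<and>
      (\<forall>u\<in>p ` A. \<forall>v\<in>p ` A. c u v \<otimes> b v = b u \<otimes> c' u v))"
    using small_sets_pullback[OF pc, OF small_sets_conj[OF assms(2)[unfolded cocycle_def]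
      small_sets_conj[OF assms(3)[unfolded cocycle_def] assms(4)[unfolded cohomologous_by_def, THEN conjunct2]]]] .
  have "small_sets ?I (\<lambda>A. \<forall>u\<in>A. \<forall>v\<in>A. d u \<otimes> b (p u) \<otimes> c' (p u) (p v) = d v \<otimes> b (p v))"
  proof (rule small_sets_mono[OF small_sets_conj[OF 1 d[unfolded trivialization_def, THEN conjunct2]]], intro ballI)
    fix A u v
    assume A: "A \<subseteq> topspace ?I" and uv: "u \<in> A" "v \<in> A" and *: "(cocycle_on K c (p ` A) \<and> cocycle_on K c' (p ` A) \<and>
      (\<forall>u\<in>p ` A. \<forall>v\<in>p ` A. c u v \<otimes> b v = b u \<otimes> c' u v)) \<and> (\<forall>u\<in>A. \<forall>v\<in>A. d u \<otimes> c (p u) (p v) = d v)"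
    have "c (p u) (p v) \<in> carrier K" "c' (p u) (p v) \<in> carrier K" using * uv unfolding cocycle_on_def by auto
    moreover have "b (p u) \<in> carrier K" "b (p v) \<in> carrier K" "d u \<in> carrier K" using bc dc A uv by auto
    moreover have "c (p u) (p v) \<otimes> b (p v) = b (p u) \<otimes> c' (p u) (p v)" "d u \<otimes> c (p u) (p v) = d v"
      using * uv by auto
    ultimately show "d u \<otimes> b (p u) \<otimes> c' (p u) (p v) = d v \<otimes> b (p v)"
      by (metis m_assoc)
  qed
  then have "trivialization ?I K (\<lambda>s t. c' (p s) (p t)) (\<lambda>t. d t \<otimes> b (p t))"
    unfolding trivialization_def using bc dc by auto
  from holonomy_eq[OF assms(1,3,5) this] holonomy_eq[OF assms(1,2,5) d] show ?thesis
    using bc[of 0] bc[of 1] dc[of 0] dc[of 1] by (simp add: inv_mult_group m_assoc)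
qed

lemma holonomy_hom:
  fixes K (structure)
  assumes "group K" "group L" "\<phi> \<in> hom K L" "cocycle X K c" "pathin X p"
  shows "holonomy L (\<lambda>u v. \<phi> (c u v)) p = \<phi> (holonomy K c p)"
proof -
  interpret K: group K by fact
  interpret L: group L by fact
  interpret group_hom K L \<phi> by unfold_locales (rule assms(3))
  let ?I = "top_of_set {0..1::real}"
  obtain d where d: "trivialization ?I K (\<lambda>s t. c (p s) (p t)) d"
    using trivialization_along_path[OF assms(1,4,5)] .
  have dc: "t \<in> {0..1} \<Longrightarrow> d t \<in> carrier K" for t using d unfolding trivialization_def by auto
  have c: "small_sets ?I (cocycle_on K (\<lambda>s t. c (p s) (p t)))"
    using cocycle_pullback[OF _ assms(4)] assms(5) unfolding cocycle_def pathin_def by blast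
  have "small_sets ?I (\<lambda>A. \<forall>u\<in>A. \<forall>v\<in>A. \<phi> (d u) \<otimes>\<^bsub>L\<^esub> \<phi> (c (p u) (p v)) = \<phi> (d v))"
    using small_sets_conj[OF c d[unfolded trivialization_def, THEN conjunct2]]
  proof (rule small_sets_mono, intro ballI)
    fix A u v
    assume A: "A \<subseteq> topspace ?I" and uv: "u \<in> A" "v \<in> A" and *: "cocycle_on K (\<lambda>s t. c (p s) (p t)) A \<and> (\<forall>u\<in>A. \<forall>v\<in>A. d u \<otimes> c (p u) (p v) = d v)"
    have "c (p u) (p v) \<in> carrier K" "d u \<in> carrier K" "d u \<otimes> c (p u) (p v) = d v"
      using * uv A dc unfolding cocycle_on_def by auto
    then show "\<phi> (d u) \<otimes>\<^bsub>L\<^esub> \<phi> (c (p u) (p v)) = \<phi> (d v)" by (metis hom_mult)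
  qed
  then have "trivialization ?I L (\<lambda>s t. \<phi> (c (p s) (p t))) (\<lambda>t. \<phi> (d t))"
    unfolding trivialization_def using dc by auto
  from holonomy_eq[OF assms(2) cocycle_hom[OF assms(3,4)] assms(5) this] holonomy_eq[OF assms(1,4,5) d] show ?thesis
    using dc[of 0] dc[of 1] by simp
qed

lemma monodromy_class:
  assumes "group K" "cocycle X K c" "pathin X p"
  shows "monodromy K c (path_class X p) = holonomy K c p"
proof -
  have "p \<in> path_class X p" using path_homotopic_refl[OF assms(3)] unfolding path_class_def by blast
  then have "(SOME q. q \<in> path_class X p) \<in> path_class X p" by (rule someI[of "\<lambda>q. q \<in> path_class X p"])
  then have "path_homotopic X p (SOME q. q \<in> path_class X p)"
    unfolding path_class_def by simp
  then show ?thesis unfolding monodromy_def using holonomy_homotopic[OF assms(1,2)] by metis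
qed

lemma monodromy_hom:
  fixes K (structure)
  assumes "group K" "cocycle X K c"
  shows "monodromy K c \<in> hom (fundamental_group X x) K"
proof (rule homI)
  fix A assume "A \<in> carrier (fundamental_group X x)"
  then obtain p where p: "p \<in> loops X x" "A = path_class X p" unfolding fundamental_carrier by blast
  show "monodromy K c A \<in> carrier K"
    using monodromy_class[OF assms loopsD(1)[OF p(1)]] holonomy_closed[OF assms loopsD(1)[OF p(1)]] p(2) by simp
  fix B assume "B \<in> carrier (fundamental_group X x)"
  then obtain q where q: "q \<in> loops X x" "B = path_class X q" unfolding fundamental_carrier by blast
  show "monodromy K c (A \<otimes>\<^bsub>fundamental_group X x\<^esub> B) = monodromy K c A \<otimes> monodromy K c B"
    using holonomy_join[OF assms, of p q] loopsD[OF p(1)] loopsD[OF q(1)]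
    by (simp add: p q fundamental_mult monodromy_class[OF assms] pathin_join)
qed

section \<open>Finite CW complexes\<close>

definition vec_norm :: "nat \<Rightarrow> (nat \<Rightarrow> real) \<Rightarrow> real" where
  "vec_norm k u = sqrt (\<Sum>i<k. (u i)\<^sup>2)"

lemma vec_norm_nonneg [simp]: "0 \<le> vec_norm k u"
  unfolding vec_norm_def by (simp add: sum_nonneg)

lemma vec_norm_scale: "vec_norm k (\<lambda>i. a * u i) = \<bar>a\<bar> * vec_norm k u"
  unfolding vec_norm_def by (simp add: power_mult_distrib sum_distrib_left[symmetric] real_sqrt_mult)

lemma closed_disc_alt: "closed_disc k = {u. (\<forall>i\<ge>k. u i = 0) \<and> vec_norm k u \<le> 1}"
  unfolding closed_disc_def vec_norm_def topspace_Euclidean_space by simp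

lemma open_disc_alt: "open_disc k = {u. (\<forall>i\<ge>k. u i = 0) \<and> vec_norm k u < 1}"
  unfolding open_disc_def vec_norm_def topspace_Euclidean_space by simp

lemma Euclidean_space_top_of_set: "Euclidean_space k = top_of_set {u. \<forall>i\<ge>k. u i = 0}"
  unfolding Euclidean_space_def euclidean_product_topology ..

lemma closed_disc_top_of_set: "subtopology (Euclidean_space k) (closed_disc k) = top_of_set (closed_disc k)"
  unfolding Euclidean_space_top_of_set subtopology_subtopology closed_disc_alt
  by (rule arg_cong[of _ _ top_of_set]) auto

lemma open_disc_top_of_set: "subtopology (Euclidean_space k) (open_disc k) = top_of_set (open_disc k)"
  unfolding Euclidean_space_top_of_set subtopology_subtopology open_disc_alt
  by (rule arg_cong[of _ _ top_of_set]) auto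

lemma continuous_on_coordinate: "continuous_on S (\<lambda>u::nat \<Rightarrow> real. u i)"
  using continuous_on_product_then_coordinatewise[OF continuous_on_id] .

lemma continuous_on_vec_norm:
  assumes "continuous_on S f" shows "continuous_on S (\<lambda>z. vec_norm k (f z))"
  unfolding vec_norm_def
  by (intro continuous_intros continuous_on_product_then_coordinatewise[OF assms])

lemma vec_norm_pos:
  assumes "u \<in> closed_disc k" "u \<noteq> (\<lambda>_. 0)" shows "0 < vec_norm k u"
proof -
  obtain i where "u i \<noteq> 0" using assms(2) by auto
  moreover from this have "i < k" using assms(1) unfolding closed_disc_alt by (metis (mono_tags, lifting) mem_Collect_eq not_le)
  ultimately have "0 < (\<Sum>i<k. (u i)\<^sup>2)"
    by (intro sum_pos2[of _ i]) auto
  then show ?thesis unfolding vec_norm_def by simp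
qed

text \<open>The disc lies in a space of infinite sequences; it is a closed subset of the cube of
  sequences with entries in \<open>{-1..1}\<close>, which is compact by Tychonoff.\<close>

lemma compact_closed_disc: "compact (closed_disc k)"
proof -
  let ?B = "PiE UNIV (\<lambda>i::nat. {-1..1::real})"
  have "compactin (product_topology (\<lambda>i. euclidean) UNIV) ?B" unfolding compactin_PiE by auto
  then have "compact ?B" unfolding euclidean_product_topology by simp
  moreover have "closed (closed_disc k)"
  proof -
    have "closed_disc k = (\<Inter>i\<in>{k..}. {u. u i = 0}) \<inter> {u. vec_norm k u \<le> 1}"
      unfolding closed_disc_alt by auto
    moreover have "closed {u::nat \<Rightarrow> real. u i = 0}" for i
      by (intro closed_Collect_eq continuous_on_coordinate continuous_intros)
    moreover have "closed {u. vec_norm k u \<le> 1}"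
      by (intro closed_Collect_le continuous_on_vec_norm continuous_on_id continuous_on_const)
    ultimately show ?thesis by (simp add: closed_INT closed_Int)
  qed
  moreover have "closed_disc k \<subseteq> ?B"
  proof
    fix u assume u: "u \<in> closed_disc k"
    have "\<bar>u i\<bar> \<le> 1" for i
    proof (cases "i < k")
      case True
      have "(u i)\<^sup>2 \<le> (\<Sum>i<k. (u i)\<^sup>2)" by (rule member_le_sum) (use True in auto)
      also have "\<dots> \<le> 1" using u unfolding closed_disc_def by simp
      finally show ?thesis by (simp add: abs_square_le_1)
    next
      case False then show ?thesis using u unfolding closed_disc_alt by simp
    qed
    then show "u \<in> ?B" by (auto simp: abs_le_iff minus_le_iff)
  qed
  ultimately show ?thesis using compact_Int_closed by (metis inf.absorb_iff2 inf_commute)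
qed

text \<open>Dividing by \<open>max 1 (vec_norm k u)\<close> retracts the coordinate space onto the
  disc, and local path connectedness is inherited by retracts.\<close>

lemma locally_path_connected_closed_disc: "locally_path_connected_space (top_of_set (closed_disc k))"
proof -
  let ?r = "\<lambda>u i. u i / max 1 (vec_norm k u)"
  have "retraction_maps (Euclidean_space k) (top_of_set (closed_disc k)) ?r id"
    unfolding retraction_maps_def
  proof (intro conjI ballI)
    have m: "max 1 (vec_norm k u) > 0" for u by (simp add: less_max_iff_disj)
    have "continuous_on {u. \<forall>i\<ge>k. u i = 0} ?r"
      by (intro continuous_on_coordinatewise_then_product continuous_intros continuous_on_coordinate continuous_on_vec_norm)
         (use m in \<open>auto simp: less_imp_neq[symmetric]\<close>)
    moreover have "?r u \<in> closed_disc k" if "\<forall>i\<ge>k. u i = 0" for u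
    proof -
      have "vec_norm k (?r u) = vec_norm k u / max 1 (vec_norm k u)"
        using vec_norm_scale[of k "1 / max 1 (vec_norm k u)" u] m[of u] by simp
      also have "\<dots> \<le> 1" using m[of u] by (simp add: divide_le_eq_1)
      finally show ?thesis using that unfolding closed_disc_alt by simp
    qed
    ultimately show "continuous_map (Euclidean_space k) (top_of_set (closed_disc k)) ?r"
      unfolding Euclidean_space_top_of_set by auto
    show "continuous_map (top_of_set (closed_disc k)) (Euclidean_space k) id"
      unfolding Euclidean_space_top_of_set by (auto simp: closed_disc_alt)
    fix u assume "u \<in> topspace (top_of_set (closed_disc k))"
    then show "?r (id u) = u" unfolding closed_disc_alt by auto
  qed
  then have "retraction_map (Euclidean_space k) (top_of_set (closed_disc k)) ?r"
    unfolding retraction_map_def by blast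
  then show ?thesis using locally_path_connected_space_retraction_map_image locally_path_connected_Euclidean_space by blast
qed

text \<open>The contraction of \<open>U\<close> may leave \<open>U\<close>. This weak form passes
  easily through the attachment of a cell, where a neighbourhood is first deformed into the old
  space, and it still identifies short paths with equal ends.\<close>

definition semilocally_contractible :: "'b topology \<Rightarrow> bool" where
  "semilocally_contractible X \<longleftrightarrow> (\<forall>x\<in>topspace X. \<exists>U z. openin X U \<and> x \<in> U \<and>
     homotopic_with (\<lambda>_. True) (subtopology X U) X id (\<lambda>_. z))"

lemma cell_contractible:
  assumes "homeomorphic_map (top_of_set (open_disc k)) (subtopology X e) \<Phi>"
  shows "homotopic_with (\<lambda>_. True) (subtopology X e) X id (\<lambda>_. \<Phi> (\<lambda>_. 0))"
proof -
  obtain g where g: "homeomorphic_maps (top_of_set (open_disc k)) (subtopology X e) \<Phi> g"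
    using assms homeomorphic_map_maps by blast
  let ?h = "\<lambda>(t::real, u::nat \<Rightarrow> real) i. (1 - t) * u i"
  have "homotopic_with (\<lambda>_. True) (top_of_set (open_disc k)) (top_of_set (open_disc k)) id (\<lambda>_. \<lambda>_. 0)"
    unfolding homotopic_with_def
  proof (intro exI[of _ ?h] conjI)
    have "continuous_on ({0..1} \<times> open_disc k) ?h"
      unfolding case_prod_beta
      by (intro continuous_on_coordinatewise_then_product continuous_intros
            continuous_on_product_then_coordinatewise[OF continuous_on_snd[OF continuous_on_id]])
    moreover have "?h (t, u) \<in> open_disc k" if "t \<in> {0..1}" "u \<in> open_disc k" for t u
      using that vec_norm_scale[of k "1 - t" u] mult_left_le_one_le[of "vec_norm k u" "1 - t"]
      unfolding open_disc_alt by auto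
    ultimately show "continuous_map (prod_topology (top_of_set {0..1}) (top_of_set (open_disc k))) (top_of_set (open_disc k)) ?h"
      unfolding prod_topology_subtopology_eu by auto
  qed auto
  then have "homotopic_with (\<lambda>_. True) (subtopology X e) (top_of_set (open_disc k)) (id \<circ> g) ((\<lambda>_. \<lambda>_. 0) \<circ> g)"
    by (rule homotopic_with_compose_continuous_map_right) (use g in \<open>auto simp: homeomorphic_maps_def\<close>)
  then have h: "homotopic_with (\<lambda>_. True) (subtopology X e) (subtopology X e) (\<Phi> \<circ> (id \<circ> g)) (\<Phi> \<circ> ((\<lambda>_. \<lambda>_. 0) \<circ> g))"
    by (rule homotopic_with_compose_continuous_map_left) (use g in \<open>auto simp: homeomorphic_maps_def\<close>)
  have "homotopic_with (\<lambda>_. True) (subtopology X e) X (\<Phi> \<circ> (id \<circ> g)) (\<Phi> \<circ> ((\<lambda>_. \<lambda>_. 0) \<circ> g))"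
    using homotopic_with_compose_continuous_map_left[OF h, of X id "\<lambda>_. True"] continuous_map_id_subt by (simp add: comp_assoc)
  moreover have "homotopic_with (\<lambda>_. True) (subtopology X e) X id (\<Phi> \<circ> (id \<circ> g))"
    by (rule homotopic_with_equal) (use g in \<open>auto simp: homeomorphic_maps_def\<close>)
  ultimately have "homotopic_with (\<lambda>_. True) (subtopology X e) X id (\<Phi> \<circ> ((\<lambda>_. \<lambda>_. 0) \<circ> g))"
    using homotopic_with_trans by blast
  then show ?thesis by (simp add: comp_def)
qed

text \<open>Removing the centre of the new cell leaves a space that is deformed radially into \<open>A\<close>.\<close>

lemma attach_cell_deformation:
  assumes "Hausdorff_space X" and A: "closedin X A" and X: "topspace X = A \<union> e" "A \<inter> e = {}"
    and \<Phi>: "continuous_map (top_of_set (closed_disc k)) X \<Phi>"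
    and hom: "homeomorphic_map (top_of_set (open_disc k)) (subtopology X e) \<Phi>"
    and bd: "\<Phi> ` (closed_disc k - open_disc k) \<subseteq> A"
  obtains R W where "openin X W" "A \<subseteq> W"
    "continuous_map (prod_topology (top_of_set {0..1::real}) (subtopology X W)) X R"
    "\<And>w. w \<in> W \<Longrightarrow> R (0, w) = w" "\<And>w. w \<in> W \<Longrightarrow> R (1, w) \<in> A"
    "\<And>t w. w \<in> A \<Longrightarrow> R (t, w) = w"
proof -
  let ?D = "closed_disc k" and ?O = "open_disc k" and ?I = "top_of_set {0..1::real}"
  define z where "z = (\<lambda>_::nat. 0::real)"
  define D0 where "D0 = ?D - {z}"
  have OD: "?O \<subseteq> ?D" and z: "z \<in> ?O" unfolding open_disc_alt closed_disc_alt z_def by (auto simp: vec_norm_def)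
  obtain g where g: "homeomorphic_maps (top_of_set ?O) (subtopology X e) \<Phi> g"
    using hom homeomorphic_map_maps by blast
  have eX: "e \<subseteq> topspace X" using X by blast
  have \<Phi>O: "\<Phi> u \<in> e" if "u \<in> ?O" for u
    using that g eX unfolding homeomorphic_maps_def continuous_map_def by (auto simp: Pi_iff)
  have g\<Phi>: "g (\<Phi> u) = u" if "u \<in> ?O" for u using that g unfolding homeomorphic_maps_def by simp
  have gO: "g w \<in> ?O" "\<Phi> (g w) = w" if "w \<in> e" for w
    using that g eX unfolding homeomorphic_maps_def continuous_map_def by (auto simp: Pi_iff)
  have \<Phi>e: "u \<in> ?O" if "u \<in> ?D" "\<Phi> u \<in> e" for u using that bd X(2) by blast
  define W where "W = topspace X - {\<Phi> z}"
  have zX: "\<Phi> z \<in> topspace X" "\<Phi> z \<notin> A" using \<Phi>O[OF z] X by auto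
  have W: "openin X W" unfolding W_def
    using assms(1) zX Hausdorff_imp_t1_space t1_space_closedin_singleton by (metis openin_diff openin_topspace)
  have AW: "A \<subseteq> W" unfolding W_def using zX X by blast
  \<comment> \<open>\<open>D0\<close> is saturated for \<open>\<Phi>\<close>: no other point of the
    disc has the same image as the centre. So the restriction of \<open>\<Phi>\<close> to
    \<open>D0\<close> stays proper.\<close>
  have pre: "{u \<in> topspace (top_of_set ?D). \<Phi> u \<in> \<Phi> ` D0} = D0"
  proof -
    have "z \<notin> {u \<in> ?D. \<Phi> u \<in> \<Phi> ` D0}"
    proof
      assume "z \<in> {u \<in> ?D. \<Phi> u \<in> \<Phi> ` D0}"
      then obtain u where u: "u \<in> D0" "\<Phi> z = \<Phi> u" by auto
      then have "u \<in> ?O" using \<Phi>e[of u] \<Phi>O[OF z] unfolding D0_def by auto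
      then have "u = z" using g\<Phi> u z by metis
      then show False using u unfolding D0_def by blast
    qed
    then show ?thesis unfolding D0_def by auto
  qed
  have DW: "\<Phi> u \<in> W" if "u \<in> D0" for u
  proof -
    have "\<Phi> u \<in> topspace X" using that \<Phi> unfolding D0_def continuous_map_def by (auto simp: Pi_iff)
    moreover have "\<Phi> u \<noteq> \<Phi> z"
    proof
      assume "\<Phi> u = \<Phi> z"
      then have "\<Phi> z \<in> \<Phi> ` D0" using that by (metis image_eqI)
      then have "z \<in> {u \<in> topspace (top_of_set ?D). \<Phi> u \<in> \<Phi> ` D0}" using z OD by auto
      then have "z \<in> D0" unfolding pre .
      then show False unfolding D0_def by blast
    qed
    ultimately show ?thesis unfolding W_def by blast
  qed
  have Wcov: "w \<in> A \<or> w \<in> \<Phi> ` D0" if w: "w \<in> W" for w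
  proof (cases "w \<in> A")
    case False
    then have "w \<in> e" using w X unfolding W_def by blast
    then have "g w \<in> D0" "w = \<Phi> (g w)" using gO[of w] OD w unfolding D0_def W_def by auto
    then show ?thesis by blast
  qed simp
  \<comment> \<open>The factor is chosen to give the norm \<open>(1 - t) * vec_norm k u + t\<close>:
    the identity at time 0 and the projection to the unit sphere at time 1.\<close>
  define H where "H = (\<lambda>(t::real, u::nat \<Rightarrow> real) i. ((1 - t) + t / vec_norm k u) * u i)"
  have pos: "0 < vec_norm k u" if "u \<in> D0" for u using that vec_norm_pos unfolding D0_def z_def by blast
  have nH: "vec_norm k (H (t, u)) = (1 - t) * vec_norm k u + t" if "u \<in> D0" "t \<in> {0..1}" for t u
  proof -
    have "0 \<le> 1 - t + t / vec_norm k u" using that pos[of u] by auto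
    then have "vec_norm k (H (t, u)) = (1 - t + t / vec_norm k u) * vec_norm k u"
      unfolding H_def prod.case vec_norm_scale by simp
    also have "\<dots> = (1 - t) * vec_norm k u + t"
      using pos[OF that(1)] by (simp add: distrib_right)
    finally show ?thesis .
  qed
  have H_D0: "H (t, u) \<in> D0" if "u \<in> D0" "t \<in> {0..1}" for t u
  proof -
    have n: "vec_norm k u \<le> 1" "\<forall>i\<ge>k. u i = 0" using that unfolding D0_def closed_disc_alt by auto
    have "(1 - t) * vec_norm k u + t \<le> 1" using mult_left_mono[OF n(1), of "1 - t"] that by auto
    moreover have "0 < (1 - t) * vec_norm k u + t"
      using pos[OF that(1)] that(2) by (cases "t = 0") (auto intro: add_nonneg_pos)
    ultimately have "vec_norm k (H (t, u)) \<le> 1" "H (t, u) \<noteq> z" using nH[OF that] by (auto simp: vec_norm_def z_def)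
    moreover have "\<forall>i\<ge>k. H (t, u) i = 0" using n unfolding H_def by simp
    ultimately show ?thesis unfolding D0_def closed_disc_alt by blast
  qed
  have contH: "continuous_map (prod_topology ?I (top_of_set D0)) (top_of_set ?D) H"
  proof -
    have "continuous_on ({0..1} \<times> D0) H"
      unfolding H_def case_prod_beta
      by (intro continuous_on_coordinatewise_then_product continuous_intros
            continuous_on_product_then_coordinatewise[OF continuous_on_snd[OF continuous_on_id]] continuous_on_vec_norm)
         (use pos in \<open>auto simp: less_imp_neq[symmetric]\<close>)
    moreover have "H w \<in> ?D" if "w \<in> {0..1} \<times> D0" for w
      using H_D0[of "snd w" "fst w"] that unfolding D0_def by (auto simp: mem_Times_iff)
    ultimately show ?thesis unfolding prod_topology_subtopology_eu by auto
  qed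
  \<comment> \<open>The inverse \<open>g\<close> exists only on the open cell.
    \<open>R\<Phi>\<close> carries the formula over to all of \<open>D0\<close>, because
    \<open>H\<close> does not move the unit sphere.\<close>
  define R where "R = (\<lambda>(t, w). if w \<in> A then w else \<Phi> (H (t, g w)))"
  have R\<Phi>: "R (t, \<Phi> u) = \<Phi> (H (t, u))" if u: "u \<in> D0" "t \<in> {0..1}" for t u
  proof (cases "u \<in> ?O")
    case True
    then show ?thesis using \<Phi>O[of u] X g\<Phi>[of u] unfolding R_def by auto
  next
    case False
    then have "vec_norm k u = 1" "\<Phi> u \<in> A"
      using u bd unfolding D0_def closed_disc_alt open_disc_alt by auto
    then show ?thesis unfolding R_def H_def by simp
  qed
  have cR: "continuous_map (prod_topology ?I (subtopology X W)) X R"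
  proof (rule pasting_lemma_closed[where I = "{True, False}" and
        T = "\<lambda>b. if b then {0..1} \<times> A else {0..1} \<times> \<Phi> ` D0" and f = "\<lambda>b. if b then snd else R"])
    let ?Y = "prod_topology ?I (subtopology X W)"
    have WX: "W \<subseteq> topspace X" unfolding W_def by blast
    have cl: "closedin (subtopology X W) A" "closedin (subtopology X W) (\<Phi> ` D0)"
    proof -
      show "closedin (subtopology X W) A" using A AW closedin_subset_topspace by blast
      have "closedin X (\<Phi> ` ?D)"
        by (rule compactin_imp_closedin[OF assms(1) image_compactin[OF _ \<Phi>]])
           (use compact_closed_disc in \<open>simp add: compactin_subtopology\<close>)
      moreover have "\<Phi> ` ?D \<inter> W = \<Phi> ` D0" using DW unfolding W_def D0_def by auto
      ultimately show "closedin (subtopology X W) (\<Phi> ` D0)"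
        unfolding closedin_subtopology by blast
    qed
    fix b :: bool
    show "closedin ?Y (if b then {0..1} \<times> A else {0..1} \<times> \<Phi> ` D0)"
      using cl by (auto simp: closedin_prod_Times_iff)
    show "continuous_map (subtopology ?Y (if b then {0..1} \<times> A else {0..1} \<times> \<Phi> ` D0)) X (if b then snd else R)"
    proof (cases b)
      case True
      have "continuous_map ?Y X snd"
        using continuous_map_snd continuous_map_into_fulltopology by blast
      then show ?thesis using True continuous_map_from_subtopology by auto
    next
      case False
      \<comment> \<open>The product of a quotient map with the identity of the interval need not be
        a quotient map. Properness is preserved by products and makes the product closed, hence a
        quotient map.\<close>
      have proper: "proper_map (top_of_set D0) (subtopology X (\<Phi> ` D0)) \<Phi>"
      proof -
        have "proper_map (top_of_set ?D) X \<Phi>"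
          by (rule continuous_closed_imp_proper_map[OF _ _ \<Phi> continuous_imp_closed_map[OF \<Phi>]])
             (use compact_closed_disc assms(1) in \<open>auto simp: compact_space_subtopology Hausdorff_imp_t1_space\<close>)
        from proper_map_restriction[OF this pre] show ?thesis
          unfolding subtopology_subtopology D0_def by (simp add: Int_absorb1 inf_commute)
      qed
      let ?q = "\<lambda>(t, u). (t, \<Phi> u)"
      let ?Z = "prod_topology ?I (subtopology X (\<Phi> ` D0))"
      have sub: "subtopology ?Y ({0..1} \<times> \<Phi> ` D0) = ?Z"
      proof -
        have "subtopology (subtopology X W) (\<Phi> ` D0) = subtopology X (\<Phi> ` D0)"
          unfolding subtopology_subtopology using DW by (intro arg_cong[of _ _ "subtopology X"]) auto
        then show ?thesis by (simp add: subtopology_Times subtopology_subtopology)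
      qed
      have "proper_map (prod_topology ?I (top_of_set D0)) ?Z ?q"
        unfolding proper_map_prod using proper by (auto simp: proper_map_id[unfolded id_def])
      then have clq: "closed_map (prod_topology ?I (top_of_set D0)) ?Z ?q" by (rule proper_imp_closed_map)
      have cont\<Phi>: "continuous_map (top_of_set D0) (subtopology X (\<Phi> ` D0)) \<Phi>"
        by (rule continuous_map_into_subtopology[OF continuous_map_from_subtopology_mono[OF \<Phi>]]) (auto simp: D0_def)
      have cq: "continuous_map (prod_topology ?I (top_of_set D0)) ?Z ?q"
        unfolding continuous_map_prod_top using cont\<Phi> by (auto simp: id_def[symmetric])
      have surj: "?q ` topspace (prod_topology ?I (top_of_set D0)) = topspace ?Z"
        using DW WX by (auto simp: image_iff)
      have q: "quotient_map (prod_topology ?I (top_of_set D0)) ?Z ?q"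
        using continuous_closed_imp_quotient_map[OF cq clq surj] .
      have "continuous_map (prod_topology ?I (top_of_set D0)) X (\<Phi> \<circ> H)"
        using contH \<Phi> continuous_map_compose by blast
      then have "continuous_map (prod_topology ?I (top_of_set D0)) X (R \<circ> ?q)"
        by (rule continuous_map_eq) (use R\<Phi> in auto)
      then have "continuous_map ?Z X R" using continuous_compose_quotient_map[OF q] by blast
      then show ?thesis using False sub by simp
    qed
    fix b' :: bool and x :: "real \<times> 'a"
    assume x: "x \<in> topspace ?Y \<inter> (if b then {0..1} \<times> A else {0..1} \<times> \<Phi> ` D0) \<inter> (if b' then {0..1} \<times> A else {0..1} \<times> \<Phi> ` D0)"
    have "R x = snd x" if "snd x \<in> A" using that unfolding R_def by (simp add: case_prod_beta)
    then show "(if b then snd else R) x = (if b' then snd else R) x" using x by (auto split: if_splits)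
  next
    fix x assume x: "x \<in> topspace (prod_topology ?I (subtopology X W))"
    show "\<exists>j. j \<in> {True, False} \<and> x \<in> (if j then {0..1} \<times> A else {0..1} \<times> \<Phi> ` D0) \<and> R x = (if j then snd else R) x"
    proof (cases "snd x \<in> A")
      case True
      then show ?thesis using x by (intro exI[of _ True]) (auto simp: R_def)
    next
      case False
      moreover have "snd x \<in> W" using x by auto
      ultimately have "snd x \<in> \<Phi> ` D0" using Wcov[of "snd x"] by simp
      then show ?thesis using x by (intro exI[of _ False]) auto
    qed
  qed auto
  show thesis
  proof (rule that[OF W AW cR])
    fix w assume w: "w \<in> W"
    show "R (0, w) = w"
    proof (cases "w \<in> A")
      case False
      then obtain u where u: "u \<in> D0" "w = \<Phi> u" using Wcov w by blast
      then show ?thesis using R\<Phi>[of u 0] by (simp add: H_def)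
    qed (simp add: R_def)
    show "R (1, w) \<in> A"
    proof (cases "w \<in> A")
      case False
      then obtain u where u: "u \<in> D0" "w = \<Phi> u" using Wcov w by blast
      have "vec_norm k (H (1, u)) = 1" using nH[of u 1] u by simp
      then have "H (1, u) \<in> ?D - ?O" using H_D0[of u 1] u unfolding D0_def open_disc_alt by auto
      then show ?thesis using R\<Phi>[of u 1] u bd by auto
    qed (simp add: R_def)
  qed (simp add: R_def)
qed

text \<open>A point of the new cell has the cell as neighbourhood. At a point of \<open>A\<close>,
  the contractible neighbourhood within \<open>A\<close> is pulled back along the end map
  \<open>r\<close> of the deformation; the pulled-back set is first deformed into \<open>A\<close>
  and then contracted there.\<close>

lemma semilocally_contractible_attach_cell:
  assumes "Hausdorff_space X" and A: "closedin X A" and X: "topspace X = A \<union> e" "A \<inter> e = {}"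
    and \<Phi>: "continuous_map (top_of_set (closed_disc k)) X \<Phi>"
    and hom: "homeomorphic_map (top_of_set (open_disc k)) (subtopology X e) \<Phi>"
    and bd: "\<Phi> ` (closed_disc k - open_disc k) \<subseteq> A"
    and slc: "semilocally_contractible (subtopology X A)"
  shows "semilocally_contractible X"
  unfolding semilocally_contractible_def
proof
  fix x assume "x \<in> topspace X"
  then consider "x \<in> e" | "x \<in> A" using X by blast
  then show "\<exists>U z. openin X U \<and> x \<in> U \<and> homotopic_with (\<lambda>_. True) (subtopology X U) X id (\<lambda>_. z)"
  proof cases
    case 1
    have "e = topspace X - A" using X by blast
    then have "openin X e" using A by auto
    then show ?thesis using 1 cell_contractible[OF hom] by blast
  next
    case 2
    obtain R W where RW: "openin X W" "A \<subseteq> W"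
      "continuous_map (prod_topology (top_of_set {0..1::real}) (subtopology X W)) X R"
      "\<And>w. w \<in> W \<Longrightarrow> R (0, w) = w" "\<And>w. w \<in> W \<Longrightarrow> R (1, w) \<in> A" "\<And>t w. w \<in> A \<Longrightarrow> R (t, w) = w"
      by (rule attach_cell_deformation[OF assms(1-7)]) (rule that)
    have AX: "A \<subseteq> topspace X" using X by blast
    have "x \<in> topspace (subtopology X A)" using 2 AX by auto
    then obtain U z where U: "openin (subtopology X A) U" "x \<in> U"
      "homotopic_with (\<lambda>_. True) (subtopology (subtopology X A) U) (subtopology X A) id (\<lambda>_. z)"
      using slc unfolding semilocally_contractible_def by blast
    have UA: "U \<subseteq> A" using U(1) openin_subset by force
    define r where "r = (\<lambda>w. R (1, w))"
    have "continuous_map (subtopology X W) X r"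
    proof -
      have "continuous_map (subtopology X W) (prod_topology (top_of_set {0..1::real}) (subtopology X W)) (\<lambda>w. (1, w))"
        by (intro continuous_map_pairedI) auto
      from continuous_map_compose[OF this RW(3)] show ?thesis unfolding r_def comp_def .
    qed
    then have r: "continuous_map (subtopology X W) (subtopology X A) r"
      by (rule continuous_map_into_subtopology) (use RW(5) in \<open>auto simp: r_def\<close>)
    define V where "V = {w \<in> topspace (subtopology X W). r w \<in> U}"
    have V: "openin (subtopology X W) V" unfolding V_def using openin_continuous_map_preimage[OF r U(1)] .
    then have VX: "openin X V" using RW(1) openin_trans_full by blast
    have VW: "V \<subseteq> W" using V openin_subset by force
    have xV: "x \<in> V" using 2 AX RW(2,6) U(2) unfolding V_def r_def by auto
    have rV: "continuous_map (subtopology X V) (subtopology (subtopology X A) U) r"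
      by (rule continuous_map_into_subtopology[OF continuous_map_from_subtopology_mono[OF r VW]]) (auto simp: V_def)
    have "homotopic_with (\<lambda>_. True) (subtopology X V) X id r"
      unfolding homotopic_with[of _ "\<lambda>_. True", simplified]
    proof (intro exI[of _ R] conjI ballI)
      have "continuous_map (subtopology X V) (subtopology X W) id"
        using VW by (intro continuous_map_into_subtopology continuous_map_id_subt) auto
      then have "continuous_map (prod_topology (top_of_set {0..1::real}) (subtopology X V))
          (prod_topology (top_of_set {0..1}) (subtopology X W)) (\<lambda>(t, w). (id t, id w))"
        unfolding continuous_map_prod_top id_def by simp
      from continuous_map_compose[OF this RW(3)]
      show "continuous_map (prod_topology (top_of_set {0..1}) (subtopology X V)) X R"
        by (simp add: comp_def case_prod_beta')
    qed (use RW VW in \<open>auto simp: r_def\<close>)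
    moreover have "homotopic_with (\<lambda>_. True) (subtopology X V) X r (\<lambda>_. z)"
    proof -
      have "homotopic_with (\<lambda>_. True) (subtopology X V) (subtopology X A) (id \<circ> r) ((\<lambda>_. z) \<circ> r)"
        by (rule homotopic_with_compose_continuous_map_right[OF U(3) rV]) auto
      then have "homotopic_with (\<lambda>_. True) (subtopology X V) X (id \<circ> (id \<circ> r)) (id \<circ> ((\<lambda>_. z) \<circ> r))"
        by (rule homotopic_with_compose_continuous_map_left) (auto intro: continuous_map_id_subt)
      then show ?thesis by (simp add: comp_def)
    qed
    ultimately have "homotopic_with (\<lambda>_. True) (subtopology X V) X id (\<lambda>_. z)"
      by (rule homotopic_with_trans)
    then show ?thesis using VX xV by (intro exI[of _ V] exI[of _ z]) simp
  qed
qed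

text \<open>Compactness comes from the finitely many closed cells; local path connectedness from the
  map of the disjoint union of the discs onto \<open>X\<close>, which is closed and therefore a
  quotient map; semilocal contractibility from attaching the cells one by one.\<close>

theorem finite_CW_complex_properties:
  assumes "finite_CW_complex X"
  shows "compact_space X" "Hausdorff_space X" "locally_path_connected_space X" "semilocally_contractible X"
proof -
  show H: "Hausdorff_space X" using assms unfolding finite_CW_complex_def by (rule conjunct1)
  obtain E and dim :: "'a set \<Rightarrow> nat" and \<Phi> where E: "finite E" "\<Union>E = topspace X" "disjoint E"
    and cells: "\<forall>e\<in>E. continuous_map (top_of_set (closed_disc (dim e))) X (\<Phi> e) \<and>
      homeomorphic_map (top_of_set (open_disc (dim e))) (subtopology X e) (\<Phi> e) \<and>
      \<Phi> e ` (closed_disc (dim e) - open_disc (dim e)) \<subseteq> \<Union>{c\<in>E. dim c < dim e}"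
    using assms[unfolded finite_CW_complex_def closed_disc_top_of_set open_disc_top_of_set, THEN conjunct2]
    by (elim exE conjE) (rule that)
  have cont: "continuous_map (top_of_set (closed_disc (dim e))) X (\<Phi> e)"
    and hom: "homeomorphic_map (top_of_set (open_disc (dim e))) (subtopology X e) (\<Phi> e)"
    and bd: "\<Phi> e ` (closed_disc (dim e) - open_disc (dim e)) \<subseteq> \<Union>{c\<in>E. dim c < dim e}" if "e \<in> E" for e
    using cells that by blast+
  have cell: "\<Phi> e ` open_disc (dim e) = e" if "e \<in> E" for e
    using homeomorphic_imp_surjective_map[OF hom[OF that]] E(2) that by auto
  have OD: "open_disc k \<subseteq> closed_disc k" for k unfolding open_disc_alt closed_disc_alt by auto
  have compD: "compact_space (top_of_set (closed_disc k))" for k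
    using compact_closed_disc by (simp add: compact_space_subtopology)
  have compC: "compactin X (\<Phi> e ` closed_disc (dim e))" if "e \<in> E" for e
    by (rule image_compactin[OF _ cont[OF that]]) (use compact_closed_disc in \<open>simp add: compactin_subtopology\<close>)
  have topX: "topspace X = (\<Union>e\<in>E. \<Phi> e ` closed_disc (dim e))"
  proof
    show "topspace X \<subseteq> (\<Union>e\<in>E. \<Phi> e ` closed_disc (dim e))"
    proof
      fix x assume "x \<in> topspace X"
      then obtain e where e: "e \<in> E" "x \<in> e" using E(2) by blast
      then have "x \<in> \<Phi> e ` open_disc (dim e)" using cell by simp
      then show "x \<in> (\<Union>e\<in>E. \<Phi> e ` closed_disc (dim e))" using e OD by blast
    qed
    show "(\<Union>e\<in>E. \<Phi> e ` closed_disc (dim e)) \<subseteq> topspace X"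
      using compactin_subset_topspace[OF compC] by (rule UN_least)
  qed
  have "compactin X (\<Union>e\<in>E. \<Phi> e ` closed_disc (dim e))"
    by (rule compactin_Union) (use E compC in auto)
  then show "compact_space X" unfolding compact_space_def topX .
  show "locally_path_connected_space X"
  proof -
    let ?S = "sum_topology (\<lambda>e. top_of_set (closed_disc (dim e))) E" and ?q = "\<lambda>(e, u). \<Phi> e u"
    have "continuous_map ?S X ?q"
      unfolding continuous_map_closedin
    proof (intro conjI allI impI)
      show "?q \<in> topspace ?S \<rightarrow> topspace X" using topX by auto
      fix C assume "closedin X C"
      then have "closedin (top_of_set (closed_disc (dim e))) {u \<in> topspace (top_of_set (closed_disc (dim e))). \<Phi> e u \<in> C}" if "e \<in> E" for e
        using cont[OF that] closedin_continuous_map_preimage by blast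
      then show "closedin ?S {x \<in> topspace ?S. ?q x \<in> C}"
        unfolding closedin_sum_topology by auto
    qed
    moreover have "closed_map ?S X ?q"
      unfolding closed_map_def
    proof (intro allI impI)
      fix C assume C: "closedin ?S C"
      have "?q ` C = (\<Union>e\<in>E. \<Phi> e ` {u. (e, u) \<in> C})"
        using C unfolding closedin_sum_topology by force
      moreover have "closedin X (\<Phi> e ` {u. (e, u) \<in> C})" if "e \<in> E" for e
        using continuous_imp_closed_map[OF cont[OF that] compD H] C that
        unfolding closed_map_def closedin_sum_topology by blast
      ultimately show "closedin X (?q ` C)" using E(1) by (auto intro!: closedin_Union)
    qed
    moreover have "?q ` topspace ?S = topspace X" unfolding topX by force
    ultimately have "quotient_map ?S X ?q" by (rule continuous_closed_imp_quotient_map)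
    moreover have "locally_path_connected_space ?S"
      unfolding locally_path_connected_space_sum_topology using locally_path_connected_closed_disc by blast
    ultimately show ?thesis using locally_path_connected_space_quotient_map_image by blast
  qed
  \<comment> \<open>The induction adds cells in order of dimension. The condition on
    \<open>S\<close> ensures that the boundary of the new cell lies in what is already there and
    that each partial union is closed.\<close>
  have "finite S \<Longrightarrow> S \<subseteq> E \<Longrightarrow> (\<forall>e\<in>S. \<forall>c\<in>E. dim c < dim e \<longrightarrow> c \<in> S) \<Longrightarrow>
    closedin X (\<Union>S) \<and> semilocally_contractible (subtopology X (\<Union>S))" for S
  proof (induction rule: finite_ranking_induct[where f = dim])
    case empty
    then show ?case by (simp add: semilocally_contractible_def)
  next
    case (insert e S)
    show ?case
    proof (cases "e \<in> S")
      \<comment> \<open>The induction rule allows the new cell to be present already.\<close>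
      case True
      then show ?thesis using insert by (simp add: insert_absorb)
    next
      case False
      have e: "e \<in> E" "S \<subseteq> E" using insert by auto
      have low: "c \<in> S" if "c \<in> E" "s \<in> insert e S" "dim c < dim s" for c s
      proof -
        have "c \<in> insert e S" using insert.prems(2)[rule_format, OF that(2,1,3)] .
        moreover have "c \<noteq> e" using that insert.hyps(2) by force
        ultimately show ?thesis by blast
      qed
      then have "\<forall>s\<in>S. \<forall>c\<in>E. dim c < dim s \<longrightarrow> c \<in> S" by (intro ballI impI) (erule low, auto)
      from insert.IH[OF e(2) this]
      have IH: "closedin X (\<Union>S)" "semilocally_contractible (subtopology X (\<Union>S))" by blast+
      have bdS: "\<Phi> e ` (closed_disc (dim e) - open_disc (dim e)) \<subseteq> \<Union>S"
      proof -
        have "\<Union>{c \<in> E. dim c < dim e} \<subseteq> \<Union>S" using low by (intro Union_mono) auto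
        then show ?thesis using bd[OF e(1)] by (rule subset_trans[rotated])
      qed
      have un: "\<Union>(insert e S) = \<Phi> e ` closed_disc (dim e) \<union> \<Union>S"
      proof -
        have "\<Phi> e ` closed_disc (dim e) = \<Phi> e ` open_disc (dim e) \<union> \<Phi> e ` (closed_disc (dim e) - open_disc (dim e))"
          using OD[of "dim e"] by (simp add: image_Un[symmetric] Un_absorb1)
        then show ?thesis using bdS cell[OF e(1)] by auto
      qed
      have cl: "closedin X (\<Union>(insert e S))"
        unfolding un using IH compactin_imp_closedin[OF H compC[OF e(1)]] by (simp add: closedin_Un)
      have disj: "\<Union>S \<inter> e = {}"
      proof -
        have "s \<inter> e = {}" if "s \<in> S" for s
          by (rule disjointD[OF E(3)]) (use that e False in auto)
        then show ?thesis by blast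
      qed
      let ?Y = "subtopology X (\<Union>(insert e S))"
      have sub: "\<Union>(insert e S) \<subseteq> topspace X" using cl closedin_subset by blast
      have "semilocally_contractible ?Y"
      proof (rule semilocally_contractible_attach_cell[where A = "\<Union>S" and e = e and k = "dim e" and \<Phi> = "\<Phi> e"])
        show "Hausdorff_space ?Y" using H by (rule Hausdorff_space_subtopology)
        show "closedin ?Y (\<Union>S)" by (rule closedin_subset_topspace[OF IH(1)]) blast
        show "topspace ?Y = \<Union>S \<union> e" using sub by auto
        show "continuous_map (top_of_set (closed_disc (dim e))) ?Y (\<Phi> e)"
          by (rule continuous_map_into_subtopology[OF cont[OF e(1)]]) (simp only: un, simp)
        have "subtopology ?Y e = subtopology X e"
          unfolding subtopology_subtopology by (rule arg_cong[of _ _ "subtopology X"]) auto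
        then show "homeomorphic_map (top_of_set (open_disc (dim e))) (subtopology ?Y e) (\<Phi> e)"
          using hom[OF e(1)] by simp
        have "subtopology ?Y (\<Union>S) = subtopology X (\<Union>S)"
          unfolding subtopology_subtopology by (rule arg_cong[of _ _ "subtopology X"]) auto
        then show "semilocally_contractible (subtopology ?Y (\<Union>S))" using IH(2) by simp
      qed (use disj bdS in auto)
      then show ?thesis using cl by blast
    qed
  qed
  from this[OF E(1)] show "semilocally_contractible X" using E(2) by simp
qed

section \<open>The universal cocycle\<close>

definition path_conj :: "'b topology \<Rightarrow> (real \<Rightarrow> 'b) \<Rightarrow> (real \<Rightarrow> 'b) \<Rightarrow> (real \<Rightarrow> 'b) \<Rightarrow> (real \<Rightarrow> 'b) set" where
  "path_conj X a p b = path_class X (path_join (path_join a p) (path_reverse b))"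

text \<open>Choose paths \<open>\<alpha> u\<close> from the base point \<open>y\<close> to all points \<open>u\<close>. For \<open>u\<close> and \<open>v\<close> close together, \<open>\<kappa> u v\<close> is the
  class of the loop that follows \<open>\<alpha> u\<close>, a short path from \<open>u\<close> to \<open>v\<close>, and the reverse of \<open>\<alpha> v\<close>.\<close>

definition universal_cocycle :: "'b topology \<Rightarrow> 'b \<Rightarrow> ('b \<Rightarrow> 'b \<Rightarrow> (real \<Rightarrow> 'b) set) \<Rightarrow> bool" where
  "universal_cocycle Y y \<kappa> \<longleftrightarrow> (\<exists>\<alpha> C. open_cover Y C \<and> (\<forall>W\<in>C. path_connectedin Y W) \<and>
     (\<forall>u\<in>topspace Y. pathin Y (\<alpha> u) \<and> \<alpha> u 0 = y \<and> \<alpha> u 1 = u) \<and> \<alpha> y = (\<lambda>_. y) \<and>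
     (\<forall>W\<in>C. \<forall>p. pathin Y p \<and> p \<in> {0..1} \<rightarrow> W \<longrightarrow> \<kappa> (p 0) (p 1) = path_conj Y (\<alpha> (p 0)) p (\<alpha> (p 1))))"

lemma path_homotopic_classI: "pathin X p \<Longrightarrow> path_class X p = path_class X q \<Longrightarrow> path_homotopic X p q"
  using path_class_eq_iff by blast

text \<open>The return along \<open>b\<close> cancels against the outward path \<open>b\<close> in
  the middle. This is the cocycle identity at the level of paths.\<close>

lemma path_conj_mult:
  assumes "pathin X a" "pathin X p" "pathin X b" "pathin X q" "pathin X d"
    and "a 1 = p 0" "p 1 = b 1" "b 1 = q 0" "q 1 = d 1"
  shows "path_class X (path_join (path_join (path_join a p) (path_reverse b)) (path_join (path_join b q) (path_reverse d)))
    = path_conj X a (path_join p q) d"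
proof -
  let ?b' = "path_reverse b" and ?d' = "path_reverse d"
  have rev: "pathin X ?b'" "pathin X ?d'" using assms pathin_reverse by blast+
  have M: "path_class X (path_join r s) = path_mult X (path_class X r) (path_class X s)"
    if "pathin X r" "pathin X s" "r 1 = s 0" for r s
    using path_mult_class[OF that] by simp
  have assoc: "path_mult X (path_mult X (path_class X r) (path_class X s)) (path_class X t) =
      path_mult X (path_class X r) (path_mult X (path_class X s) (path_class X t))"
    if "pathin X r" "pathin X s" "pathin X t" "r 1 = s 0" "s 1 = t 0" for r s t
    using path_class_assoc[OF that] that by (simp add: M pathin_join)
  have ap: "pathin X (path_join a p)" and bq: "pathin X (path_join b q)" and pq: "pathin X (path_join p q)"
    and bqd: "pathin X (path_join (path_join b q) ?d')"
    using assms rev by (auto intro!: pathin_join)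
  have "path_class X (path_join ?b' (path_join (path_join b q) ?d')) = path_class X (path_join q ?d')"
  proof -
    have "path_class X (path_join ?b' (path_join (path_join b q) ?d')) = path_class X (path_join (path_join ?b' (path_join b q)) ?d')"
      using path_class_assoc[of X ?b' "path_join b q" ?d'] rev bq assms by simp
    also have "\<dots> = path_mult X (path_class X (path_join ?b' (path_join b q))) (path_class X ?d')"
      by (rule M) (use rev bq assms in \<open>auto intro!: pathin_join\<close>)
    also have "path_class X (path_join ?b' (path_join b q)) = path_class X q"
    proof -
      have "path_class X (path_join ?b' (path_join b q)) = path_class X (path_join (path_join ?b' b) q)"
        using path_class_assoc[of X ?b' b q] rev assms by simp
      also have "\<dots> = path_mult X (path_class X (path_join ?b' b)) (path_class X q)"
        by (rule M) (use rev assms in \<open>auto intro!: pathin_join\<close>)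
      also have "path_class X (path_join ?b' b) = path_class X (\<lambda>_. b 1)" by (rule path_class_reverse_left[OF assms(3)])
      also have "path_mult X (path_class X (\<lambda>_. b 1)) (path_class X q) = path_class X (path_join (\<lambda>_. b 1) q)"
        using M[of "\<lambda>_. b 1" q] assms pathin_const[OF pathin_in_topspace[OF assms(3), of 1]] by simp
      also have "\<dots> = path_class X q" by (rule path_class_const_left) (use assms in auto)
      finally show ?thesis .
    qed
    also have "path_mult X (path_class X q) (path_class X ?d') = path_class X (path_join q ?d')"
      using M[of q ?d'] rev assms by simp
    finally show ?thesis .
  qed
  moreover have "path_class X (path_join (path_join (path_join a p) ?b') (path_join (path_join b q) ?d')) =
      path_mult X (path_class X (path_join a p)) (path_class X (path_join ?b' (path_join (path_join b q) ?d')))"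
    using path_class_assoc[of X "path_join a p" ?b' "path_join (path_join b q) ?d'"] ap rev bqd assms
    by (simp add: M pathin_join)
  moreover have "path_mult X (path_class X (path_join a p)) (path_class X (path_join q ?d')) =
      path_class X (path_join (path_join (path_join a p) q) ?d')"
    using path_class_assoc[of X "path_join a p" q ?d'] ap rev assms by (simp add: M pathin_join)
  moreover have "path_class X (path_join (path_join (path_join a p) q) ?d') = path_conj X a (path_join p q) d"
    using path_class_assoc[of X a p q] ap rev pq assms unfolding path_conj_def by (simp add: M pathin_join)
  ultimately show ?thesis by simp
qed

lemma path_conj_cong:
  assumes "pathin X a" "pathin X p" "pathin X b" "a 1 = p 0" "p 1 = b 1" "path_class X p = path_class X q"
  shows "path_conj X a p b = path_conj X a q b"
proof -
  have "path_homotopic X p q" using path_homotopic_classI assms by blast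
  then have "path_homotopic X (path_join (path_join a p) (path_reverse b)) (path_join (path_join a q) (path_reverse b))"
    using assms by (intro path_homotopic_join path_homotopic_refl pathin_reverse) auto
  then show ?thesis unfolding path_conj_def by (rule path_class_eqI)
qed

lemma small_path_connected:
  assumes "locally_path_connected_space X" "small_sets X P" "x \<in> topspace X"
  obtains U where "openin X U" "x \<in> U" "path_connectedin X U" "\<And>A. A \<subseteq> U \<Longrightarrow> P A"
proof -
  obtain W where W: "openin X W" "x \<in> W" "\<forall>A\<subseteq>W. P A" using assms(2,3) unfolding small_sets_def by blast
  have "neighbourhood_base_of (\<lambda>U. openin X U \<and> path_connectedin X U) X"
    using assms(1) locally_path_connected_space_alt by blast
  then obtain U V where UV: "openin X V" "path_connectedin X V" "x \<in> U" "U \<subseteq> V" "V \<subseteq> W"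
    using W(1,2) unfolding neighbourhood_base_of by meson
  show thesis
  proof (rule that[OF UV(1) _ UV(2)])
    show "x \<in> V" using UV(3,4) by blast
    show "P A" if "A \<subseteq> V" for A using W(3) UV(5) that by (meson subset_trans)
  qed
qed

text \<open>The contraction moves each \<open>u\<close> along a path \<open>\<eta> u\<close> to the
  point \<open>z\<close>. Applied along \<open>p\<close> it fills a square, which shows that
  \<open>p\<close> is homotopic to \<open>\<eta> (p 0)\<close> followed by the reverse of
  \<open>\<eta> (p 1)\<close>; that path depends on the ends of \<open>p\<close> only.\<close>

lemma semilocally_contractible_paths:
  assumes "semilocally_contractible X"
  shows "small_sets X (\<lambda>A. \<forall>p q. pathin X p \<and> pathin X q \<and> p \<in> {0..1} \<rightarrow> A \<and> q \<in> {0..1} \<rightarrow> A \<and> p 0 = q 0 \<and> p 1 = q 1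
    \<longrightarrow> path_class X p = path_class X q)"
  unfolding small_sets_def
proof
  fix x assume "x \<in> topspace X"
  then obtain U z where U: "openin X U" "x \<in> U" "homotopic_with (\<lambda>_. True) (subtopology X U) X id (\<lambda>_. z)"
    using assms unfolding semilocally_contractible_def by blast
  obtain h where h: "continuous_map (prod_topology (top_of_set {0..1::real}) (subtopology X U)) X h"
    "\<And>x. h (0, x) = x" "\<And>x. h (1, x) = z"
    using U(3) unfolding homotopic_with_def by auto
  define \<eta> where "\<eta> u = (\<lambda>t. h (t, u))" for u
  have \<eta>: "pathin X (\<eta> u)" if "u \<in> U" for u
  proof -
    have "continuous_map (top_of_set {0..1}) (prod_topology (top_of_set {0..1}) (subtopology X U)) (\<lambda>t::real. (t, u))"
      using that U(1) openin_subset by (intro continuous_map_pairedI) (auto simp: id_def[symmetric])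
    from continuous_map_compose[OF this h(1)] show ?thesis unfolding \<eta>_def pathin_def comp_def .
  qed
  have key: "path_class X p = path_class X (path_join (\<eta> (p 0)) (path_reverse (\<eta> (p 1))))"
    if p: "pathin X p" "p \<in> {0..1} \<rightarrow> U" for p
  proof -
    have pU: "p 0 \<in> U" "p 1 \<in> U" using p(2) by auto
    have "continuous_map (top_of_set ({0..1::real} \<times> {0..1::real})) (prod_topology (top_of_set {0..1}) (subtopology X U)) (\<lambda>(s, t). (t, p s))"
    proof -
      have "continuous_map (top_of_set {0..1}) (subtopology X U) p"
        using p continuous_map_into_subtopology unfolding pathin_def by (metis topspace_euclidean_subtopology image_subset_iff_funcset)
      then have "continuous_map (prod_topology (top_of_set {0..1::real}) (top_of_set {0..1::real})) (subtopology X U) (p \<circ> fst)"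
        using continuous_map_compose continuous_map_fst by blast
      then have "continuous_map (prod_topology (top_of_set {0..1::real}) (top_of_set {0..1::real}))
          (prod_topology (top_of_set {0..1}) (subtopology X U)) (\<lambda>w. (snd w, (p \<circ> fst) w))"
        by (intro continuous_map_pairedI continuous_map_snd)
      then show ?thesis unfolding prod_topology_subtopology_eu by (simp add: case_prod_beta' comp_def)
    qed
    from continuous_map_compose[OF this h(1)]
    have "continuous_map (top_of_set ({0..1} \<times> {0..1})) X (\<lambda>(s, t). h (t, p s))" by (simp add: comp_def case_prod_beta')
    from path_homotopic_square[OF this]
    have sq: "path_class X (path_join (\<eta> (p 0)) (\<lambda>t. z)) = path_class X (path_join p (\<eta> (p 1)))"
      using h(2,3) by (simp add: \<eta>_def)
    have e0: "pathin X (\<eta> (p 0))" "pathin X (\<eta> (p 1))" "\<eta> (p 0) 0 = p 0" "\<eta> (p 0) 1 = z" "\<eta> (p 1) 0 = p 1" "\<eta> (p 1) 1 = z"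
      using \<eta> pU h(2,3) by (auto simp: \<eta>_def)
    have M: "path_class X (path_join r s) = path_mult X (path_class X r) (path_class X s)"
      if "pathin X r" "pathin X s" "r 1 = s 0" for r s
      using path_mult_class[OF that] by simp
    let ?e = "path_reverse (\<eta> (p 1))"
    have re: "pathin X ?e" using e0 pathin_reverse by blast
    have "path_class X (path_join (\<eta> (p 0)) ?e) = path_mult X (path_class X (path_join (\<eta> (p 0)) (\<lambda>t. z))) (path_class X ?e)"
      using path_class_const_right[OF e0(1), of z] e0 re by (simp add: M)
    also have "\<dots> = path_class X (path_join (path_join p (\<eta> (p 1))) ?e)"
      unfolding sq using e0 re p by (simp add: M pathin_join)
    also have "\<dots> = path_class X (path_join p (path_join (\<eta> (p 1)) ?e))"
      by (rule path_class_assoc) (use e0 re p in auto)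
    also have "\<dots> = path_mult X (path_class X p) (path_class X (path_join (\<eta> (p 1)) ?e))"
      by (rule M) (use e0 re p in \<open>auto intro!: pathin_join\<close>)
    also have "path_class X (path_join (\<eta> (p 1)) ?e) = path_class X (\<lambda>_. p 1)"
      using path_class_reverse_right[OF e0(2)] e0 by simp
    also have "path_mult X (path_class X p) (path_class X (\<lambda>_. p 1)) = path_class X (path_join p (\<lambda>_. p 1))"
      by (rule M[symmetric]) (use p pathin_const[OF pathin_in_topspace[OF p(1), of 1]] in auto)
    also have "\<dots> = path_class X p" by (rule path_class_const_right) (use p in auto)
    finally show ?thesis by simp
  qed
  show "\<exists>U. openin X U \<and> x \<in> U \<and> (\<forall>A\<subseteq>U. \<forall>p q. pathin X p \<and> pathin X q \<and> p \<in> {0..1} \<rightarrow> A \<and> q \<in> {0..1} \<rightarrow> A \<and>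
      p 0 = q 0 \<and> p 1 = q 1 \<longrightarrow> path_class X p = path_class X q)"
  proof (intro exI[of _ U] conjI allI impI)
    fix A p q assume "A \<subseteq> U" and *: "pathin X p \<and> pathin X q \<and> p \<in> {0..1} \<rightarrow> A \<and> q \<in> {0..1} \<rightarrow> A \<and> p 0 = q 0 \<and> p 1 = q 1"
    then have "p \<in> {0..1} \<rightarrow> U" "q \<in> {0..1} \<rightarrow> U" by auto
    then show "path_class X p = path_class X q" using key[of p] key[of q] * by metis
  qed (use U in auto)
qed

text \<open>The value at \<open>u\<close> and \<open>v\<close> must not depend on which member of
  the cover contains the short path. Star refinement arranges that even two overlapping members
  together are small enough to have only one class of paths between given ends.\<close>

lemma universal_cocycle_exists:
  assumes "compact_space Y" "Hausdorff_space Y" "connected_space Y" "locally_path_connected_space Y"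
    "semilocally_contractible Y" "y \<in> topspace Y"
  obtains \<kappa> where "universal_cocycle Y y \<kappa>"
proof -
  define P where "P A \<longleftrightarrow> (\<forall>p q. pathin Y p \<and> pathin Y q \<and> p \<in> {0..1} \<rightarrow> A \<and> q \<in> {0..1} \<rightarrow> A \<and> p 0 = q 0 \<and> p 1 = q 1
    \<longrightarrow> path_class Y p = path_class Y q)" for A
  have P_mono: "P A" if "P B" "A \<subseteq> B" for A B
  proof -
    have "p \<in> {0..1} \<rightarrow> B" if "p \<in> {0..1} \<rightarrow> A" for p :: "real \<Rightarrow> 'a" using that \<open>A \<subseteq> B\<close> by auto
    then show ?thesis using \<open>P B\<close> unfolding P_def by simp
  qed
  have "small_sets Y P" using semilocally_contractible_paths[OF assms(5)] unfolding P_def .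
  then obtain B where B: "open_cover Y B" "\<And>V. V \<in> B \<Longrightarrow> V \<noteq> {} \<Longrightarrow> P (\<Union>{V'\<in>B. V' \<inter> V \<noteq> {}})"
    by (rule star_refinement[OF assms(1,2)]) (rule that)
  define C where "C = {W. openin Y W \<and> path_connectedin Y W \<and> (\<exists>V\<in>B. W \<subseteq> V)}"
  have C: "open_cover Y C"
    unfolding open_cover_def
  proof (intro conjI subset_antisym subsetI)
    fix u assume "u \<in> topspace Y"
    then obtain U where "openin Y U" "u \<in> U" "path_connectedin Y U" "\<And>A. A \<subseteq> U \<Longrightarrow> \<exists>V\<in>B. A \<subseteq> V"
      by (rule small_path_connected[OF assms(4) open_cover_imp_small_sets[OF B(1)]]) (rule that)
    then have "U \<in> C" unfolding C_def by simp
    then show "u \<in> \<Union>C" using \<open>u \<in> U\<close> by blast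
  next
    fix u assume "u \<in> \<Union>C"
    then show "u \<in> topspace Y" unfolding C_def using openin_subset by blast
  qed (auto simp: C_def)
  have PC: "P (W \<union> W')" if WW: "W \<in> C" "W' \<in> C" "u \<in> W" "u \<in> W'" for W W' u
  proof -
    obtain V V' where "V \<in> B" "W \<subseteq> V" "V' \<in> B" "W' \<subseteq> V'" using WW(1,2) unfolding C_def by blast
    then show ?thesis using WW(3,4) by (intro P_mono[OF B(2)[of V]]) blast+
  qed
  have "path_connected_space Y" using assms(3,4) path_connected_eq_connected_space by blast
  then have "\<exists>p. pathin Y p \<and> p 0 = y \<and> p 1 = u" if "u \<in> topspace Y" for u
    using assms(6) that unfolding path_connected_space_def by blast
  then obtain \<alpha>0 where \<alpha>0: "\<And>u. u \<in> topspace Y \<Longrightarrow> pathin Y (\<alpha>0 u) \<and> \<alpha>0 u 0 = y \<and> \<alpha>0 u 1 = u" by metis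
  \<comment> \<open>With a constant path at the base point, the holonomy of a loop becomes its own
    class and not a conjugate of it.\<close>
  define \<alpha> where "\<alpha> = \<alpha>0(y := (\<lambda>_. y))"
  have \<alpha>: "pathin Y (\<alpha> u) \<and> \<alpha> u 0 = y \<and> \<alpha> u 1 = u" if "u \<in> topspace Y" for u
    using \<alpha>0[OF that] pathin_const[OF assms(6)] unfolding \<alpha>_def by auto
  define G where "G u v p \<longleftrightarrow> (\<exists>W\<in>C. pathin Y p \<and> p \<in> {0..1} \<rightarrow> W \<and> p 0 = u \<and> p 1 = v)" for u v p
  define \<kappa> where "\<kappa> u v = path_conj Y (\<alpha> u) (SOME p. G u v p) (\<alpha> v)" for u v
  have key: "\<kappa> (p 0) (p 1) = path_conj Y (\<alpha> (p 0)) p (\<alpha> (p 1))" if p: "W \<in> C" "pathin Y p" "p \<in> {0..1} \<rightarrow> W" for W p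
  proof -
    define q where "q = (SOME q. G (p 0) (p 1) q)"
    have "G (p 0) (p 1) p" using p unfolding G_def by blast
    then have "G (p 0) (p 1) q" unfolding q_def by (rule someI[where P = "G (p 0) (p 1)" and x = p])
    then obtain W' where q: "W' \<in> C" "pathin Y q" "q \<in> {0..1} \<rightarrow> W'" "q 0 = p 0" "q 1 = p 1" unfolding G_def by blast
    have PW: "P (W \<union> W')" by (rule PC[of _ _ "p 0"]) (use p q in \<open>force simp: Pi_iff\<close>)+
    have "p \<in> {0..1} \<rightarrow> W \<union> W'" "q \<in> {0..1} \<rightarrow> W \<union> W'" using p(3) q(3) by auto
    then have "path_class Y q = path_class Y p"
      by (intro PW[unfolded P_def, rule_format] conjI p(2) q(2,4,5))
    moreover have "p 0 \<in> topspace Y" "p 1 \<in> topspace Y" using pathin_in_topspace[OF p(2)] by auto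
    ultimately show ?thesis unfolding \<kappa>_def q_def[symmetric] using \<alpha> q by (intro path_conj_cong) auto
  qed
  have "\<forall>W\<in>C. \<forall>p. pathin Y p \<and> p \<in> {0..1} \<rightarrow> W \<longrightarrow> \<kappa> (p 0) (p 1) = path_conj Y (\<alpha> (p 0)) p (\<alpha> (p 1))"
    by (intro ballI allI impI, elim conjE) (rule key)
  moreover have "\<forall>W\<in>C. path_connectedin Y W" "\<alpha> y = (\<lambda>_. y)" by (simp_all add: C_def \<alpha>_def)
  moreover have "\<forall>u\<in>topspace Y. pathin Y (\<alpha> u) \<and> \<alpha> u 0 = y \<and> \<alpha> u 1 = u" using \<alpha> by (intro ballI)
  ultimately have "universal_cocycle Y y \<kappa>"
    unfolding universal_cocycle_def using C by (intro exI[of _ \<alpha>] exI[of _ C] conjI)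
  then show thesis by (rule that)
qed

lemma universal_cocycle_value:
  assumes "\<forall>W\<in>C. path_connectedin Y W"
    and \<alpha>: "\<forall>u\<in>topspace Y. pathin Y (\<alpha> u) \<and> \<alpha> u 0 = y \<and> \<alpha> u 1 = u"
    and \<kappa>: "\<forall>W\<in>C. \<forall>p. pathin Y p \<and> p \<in> {0..1} \<rightarrow> W \<longrightarrow> \<kappa> (p 0) (p 1) = path_conj Y (\<alpha> (p 0)) p (\<alpha> (p 1))"
    and "W \<in> C" "u \<in> W" "v \<in> W"
  obtains p where "pathin Y p" "p \<in> {0..1} \<rightarrow> W" "p 0 = u" "p 1 = v" "\<kappa> u v = path_conj Y (\<alpha> u) p (\<alpha> v)"
    "path_join (path_join (\<alpha> u) p) (path_reverse (\<alpha> v)) \<in> loops Y y"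
proof -
  obtain p where p: "pathin Y p" "p \<in> {0..1} \<rightarrow> W" "p 0 = u" "p 1 = v"
    using assms(1,4-6) unfolding path_connectedin by meson
  have uv: "u \<in> topspace Y" "v \<in> topspace Y" using pathin_in_topspace[OF p(1), of 0] pathin_in_topspace[OF p(1), of 1] p by auto
  have "path_join (path_join (\<alpha> u) p) (path_reverse (\<alpha> v)) \<in> loops Y y"
    unfolding loops_def using \<alpha> uv p by (auto intro!: pathin_join pathin_reverse)
  then show thesis using that[OF p] \<kappa> assms(4) p by metis
qed

text \<open>Three points in one member \<open>W\<close> of the cover can be joined by paths inside
  \<open>W\<close>, and the joined path from \<open>u\<close> to \<open>w\<close> is again
  admissible for computing the value at \<open>u\<close> and \<open>w\<close>.\<close>

lemma cocycle_universal_cocycle: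
  assumes "universal_cocycle Y y \<kappa>" "y \<in> topspace Y"
  shows "cocycle Y (fundamental_group Y y) \<kappa>"
proof -
  let ?G = "fundamental_group Y y"
  obtain \<alpha> C where C: "open_cover Y C" "\<forall>W\<in>C. path_connectedin Y W"
    and \<alpha>: "\<forall>u\<in>topspace Y. pathin Y (\<alpha> u) \<and> \<alpha> u 0 = y \<and> \<alpha> u 1 = u"
    and \<kappa>: "\<forall>W\<in>C. \<forall>p. pathin Y p \<and> p \<in> {0..1} \<rightarrow> W \<longrightarrow> \<kappa> (p 0) (p 1) = path_conj Y (\<alpha> (p 0)) p (\<alpha> (p 1))"
    using assms(1) unfolding universal_cocycle_def by (elim exE conjE) (rule that)
  have "cocycle_on ?G \<kappa> A" if A: "\<exists>W\<in>C. A \<subseteq> W" for A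
    unfolding cocycle_on_def
  proof (intro ballI conjI)
    obtain W where W: "W \<in> C" "A \<subseteq> W" using A by blast
    fix u v assume uv: "u \<in> A" "v \<in> A"
    obtain p where p: "pathin Y p" "p \<in> {0..1} \<rightarrow> W" "p 0 = u" "p 1 = v" "\<kappa> u v = path_conj Y (\<alpha> u) p (\<alpha> v)"
      "path_join (path_join (\<alpha> u) p) (path_reverse (\<alpha> v)) \<in> loops Y y"
      by (rule universal_cocycle_value[OF C(2) \<alpha> \<kappa> W(1), of u v]) (use uv W in auto)
    show "\<kappa> u v \<in> carrier ?G" using p unfolding fundamental_carrier path_conj_def by blast
    fix w assume w: "w \<in> A"
    obtain q where q: "pathin Y q" "q \<in> {0..1} \<rightarrow> W" "q 0 = v" "q 1 = w" "\<kappa> v w = path_conj Y (\<alpha> v) q (\<alpha> w)"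
      "path_join (path_join (\<alpha> v) q) (path_reverse (\<alpha> w)) \<in> loops Y y"
      by (rule universal_cocycle_value[OF C(2) \<alpha> \<kappa> W(1), of v w]) (use uv w W in auto)
    have top: "u \<in> topspace Y" "v \<in> topspace Y" "w \<in> topspace Y"
      using uv w W C(1) unfolding open_cover_def by blast+
    have pq: "pathin Y (path_join p q)" "path_join p q \<in> {0..1} \<rightarrow> W"
      by (rule pathin_join[OF p(1) q(1)], simp add: p q) (use p q in \<open>auto simp: path_join_def Pi_iff\<close>)
    have "\<kappa> u v \<otimes>\<^bsub>?G\<^esub> \<kappa> v w = path_conj Y (\<alpha> u) (path_join p q) (\<alpha> w)"
      unfolding p(5) q(5) unfolding path_conj_def fundamental_mult[OF p(6) q(6)]
      unfolding path_conj_def[symmetric]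
      by (rule path_conj_mult) (use p q \<alpha> top in auto)
    also have "\<dots> = \<kappa> u w" using \<kappa> W(1) pq p q by (metis path_join_ends)
    finally show "\<kappa> u v \<otimes>\<^bsub>?G\<^esub> \<kappa> v w = \<kappa> u w" .
  qed
  then show ?thesis
    unfolding cocycle_def by (rule small_sets_mono[OF open_cover_imp_small_sets[OF C(1)]])
qed

text \<open>This justifies the word universal: the monodromy of \<open>\<kappa>\<close> is the
  identity of the fundamental group, so composing \<open>\<kappa>\<close> with a homomorphism
  realizes that homomorphism as a monodromy.\<close>

lemma holonomy_universal_cocycle:
  assumes "universal_cocycle Y y \<kappa>" "y \<in> topspace Y" "p \<in> loops Y y"
  shows "holonomy (fundamental_group Y y) \<kappa> p = path_class Y p"
proof -
  let ?G = "fundamental_group Y y" and ?I = "top_of_set {0..1::real}"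
  interpret group ?G by (rule group_fundamental_group[OF assms(2)])
  obtain \<alpha> C where C: "open_cover Y C" "\<forall>W\<in>C. path_connectedin Y W"
    and \<alpha>: "\<forall>u\<in>topspace Y. pathin Y (\<alpha> u) \<and> \<alpha> u 0 = y \<and> \<alpha> u 1 = u" and \<alpha>y: "\<alpha> y = (\<lambda>_. y)"
    and \<kappa>: "\<forall>W\<in>C. \<forall>p. pathin Y p \<and> p \<in> {0..1} \<rightarrow> W \<longrightarrow> \<kappa> (p 0) (p 1) = path_conj Y (\<alpha> (p 0)) p (\<alpha> (p 1))"
    using assms(1) unfolding universal_cocycle_def by (elim exE conjE) (rule that)
  have p: "pathin Y p" "p 0 = y" "p 1 = y" using loopsD[OF assms(3)] by auto
  have pt: "p t \<in> topspace Y" if "t \<in> {0..1}" for t using pathin_in_topspace[OF p(1) that] .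
  define \<sigma> where "\<sigma> s t = (\<lambda>r::real. p (s + (t - s) * r))" for s t
  have seg: "s + (t - s) * r \<in> {0..1}" if "s \<in> {0..1}" "t \<in> {0..1}" "r \<in> {0..1}" for s t r :: real
  proof -
    have "(1 - r) *\<^sub>R s + r *\<^sub>R t \<in> {0..1}" using that by (intro convexD_alt convex_real_interval) auto
    then show ?thesis by (simp add: algebra_simps)
  qed
  have \<sigma>: "pathin Y (\<sigma> s t)" if "s \<in> {0..1}" "t \<in> {0..1}" for s t
  proof -
    have "continuous_on {0..1} (\<lambda>r. s + (t - s) * r)" by (intro continuous_intros)
    from pathin_compose_real[OF p(1) this] show ?thesis
      unfolding \<sigma>_def comp_def using seg[OF that] by blast
  qed
  have ends: "\<sigma> s t 0 = p s" "\<sigma> s t 1 = p t" for s t unfolding \<sigma>_def by auto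
  \<comment> \<open>The trivialization follows \<open>p\<close> up to time \<open>t\<close> and
    returns along \<open>\<alpha> (p t)\<close>; the constant path in front only fits it to
    \<open>path_conj\<close>.\<close>
  define b where "b t = path_conj Y (\<lambda>_. y) (\<sigma> 0 t) (\<alpha> (p t))" for t
  have bl: "path_join (path_join (\<lambda>_. y) (\<sigma> 0 t)) (path_reverse (\<alpha> (p t))) \<in> loops Y y" if "t \<in> {0..1}" for t
    unfolding loops_def using \<alpha> pt[OF that] \<sigma>[of 0 t] that ends[of 0 t] p pathin_const[OF assms(2)]
    by (auto intro!: pathin_join pathin_reverse)
  have small: "b s \<otimes>\<^bsub>?G\<^esub> \<kappa> (p s) (p t) = b t"
    if W: "W \<in> C" and st: "s \<in> {0..1}" "t \<in> {0..1}" "\<And>r. r \<in> {0..1} \<Longrightarrow> \<sigma> s t r \<in> W" for s t W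
  proof -
    have k: "\<kappa> (p s) (p t) = path_conj Y (\<alpha> (p s)) (\<sigma> s t) (\<alpha> (p t))"
      using \<kappa> W \<sigma>[OF st(1,2)] st(3) ends[of s t] by (metis Pi_I)
    have l: "path_join (path_join (\<alpha> (p s)) (\<sigma> s t)) (path_reverse (\<alpha> (p t))) \<in> loops Y y"
      unfolding loops_def using \<alpha> pt st \<sigma>[of s t] ends[of s t] by (auto intro!: pathin_join pathin_reverse)
    have "b s \<otimes>\<^bsub>?G\<^esub> \<kappa> (p s) (p t) = path_conj Y (\<lambda>_. y) (path_join (\<sigma> 0 s) (\<sigma> s t)) (\<alpha> (p t))"
      unfolding b_def k unfolding path_conj_def fundamental_mult[OF bl[OF st(1)] l]
      unfolding path_conj_def[symmetric]
      by (rule path_conj_mult) (use \<alpha> pt st \<sigma>[of s t] \<sigma>[of 0 s] ends p pathin_const[OF assms(2)] in auto)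
    also have "\<dots> = b t" unfolding b_def
    proof (rule path_conj_cong)
      \<comment> \<open>Going from 0 to \<open>t\<close> by way of \<open>s\<close> is homotopic to
        going directly within the parameter interval, in whichever order \<open>s\<close> and
        \<open>t\<close> lie.\<close>
      have "path_homotopic Y (p \<circ> path_join (\<lambda>r. s * r) (\<lambda>r. s + (t - s) * r)) (p \<circ> (\<lambda>r. t * r))"
      proof (rule path_homotopic_convex[of "{0..1}"])
        have "pathin euclidean (path_join (\<lambda>r. s * r) (\<lambda>r. s + (t - s) * r))"
          by (rule pathin_join) (auto simp: pathin_def intro!: continuous_intros)
        then show "continuous_on {0..1} (path_join (\<lambda>r. s * r) (\<lambda>r. s + (t - s) * r))"
          unfolding pathin_def by simp
        show "path_join (\<lambda>r. s * r) (\<lambda>r. s + (t - s) * r) \<in> {0..1} \<rightarrow> {0..1}"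
        proof
          fix r :: real assume "r \<in> {0..1}"
          then show "path_join (\<lambda>r. s * r) (\<lambda>r. s + (t - s) * r) r \<in> {0..1}"
            using seg[of 0 s "2 * r"] seg[of s t "2 * r - 1"] st unfolding path_join_def by auto
        qed
        show "(\<lambda>r. t * r) \<in> {0..1} \<rightarrow> {0..1}" using seg[of 0 t] st by auto
      qed (use p in \<open>auto simp: pathin_def intro!: continuous_intros\<close>)
      moreover have "p \<circ> path_join (\<lambda>r. s * r) (\<lambda>r. s + (t - s) * r) = path_join (\<sigma> 0 s) (\<sigma> s t)"
        by (auto simp: path_join_def \<sigma>_def fun_eq_iff)
      moreover have "p \<circ> (\<lambda>r. t * r) = \<sigma> 0 t" unfolding \<sigma>_def comp_def by simp
      ultimately show "path_class Y (path_join (\<sigma> 0 s) (\<sigma> s t)) = path_class Y (\<sigma> 0 t)"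
        using path_class_eqI by metis
    qed (use \<alpha> pt st \<sigma>[of s t] \<sigma>[of 0 s] ends p pathin_const[OF assms(2)] in \<open>auto intro!: pathin_join\<close>)
    finally show ?thesis .
  qed
  have "trivialization ?I ?G (\<lambda>s t. \<kappa> (p s) (p t)) b"
    unfolding trivialization_def
  proof
    show "b \<in> topspace ?I \<rightarrow> carrier ?G" 
    proof
      fix t assume "t \<in> topspace ?I"
      then have "t \<in> {0..1}" by simp
      then show "b t \<in> carrier ?G" unfolding b_def path_conj_def fundamental_carrier using bl by blast
    qed
    show "small_sets ?I (\<lambda>A. \<forall>u\<in>A. \<forall>v\<in>A. b u \<otimes>\<^bsub>?G\<^esub> \<kappa> (p u) (p v) = b v)"
      unfolding small_sets_def
    proof
      fix t assume t: "t \<in> topspace ?I"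
      then have "p t \<in> \<Union>C" using pt[of t] C(1) unfolding open_cover_def by simp
      then obtain W where W: "W \<in> C" "p t \<in> W" by blast
      have "openin ?I {s \<in> topspace ?I. p s \<in> W}"
        using W(1) C(1) p(1) openin_continuous_map_preimage unfolding open_cover_def pathin_def by blast
      then obtain e where e: "e > 0" "ball t e \<inter> {0..1} \<subseteq> {s \<in> topspace ?I. p s \<in> W}"
        using t W(2) unfolding openin_contains_ball by (metis (no_types, lifting) mem_Collect_eq)
      \<comment> \<open>Convexity keeps the whole parameter segment between two nearby times, and so
        the corresponding piece of \<open>p\<close>, inside \<open>W\<close>.\<close>
      have cv: "convex (ball t e \<inter> {0..1})" by (intro convex_Int convex_ball convex_real_interval)
      show "\<exists>U. openin ?I U \<and> t \<in> U \<and> (\<forall>A\<subseteq>U. \<forall>u\<in>A. \<forall>v\<in>A. b u \<otimes>\<^bsub>?G\<^esub> \<kappa> (p u) (p v) = b v)"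
      proof (intro exI[of _ "ball t e \<inter> {0..1}"] conjI allI impI ballI)
        show "openin ?I (ball t e \<inter> {0..1})" by (metis inf_commute open_ball openin_open_Int)
        fix A u v assume A: "A \<subseteq> ball t e \<inter> {0..1}" "u \<in> A" "v \<in> A"
        show "b u \<otimes>\<^bsub>?G\<^esub> \<kappa> (p u) (p v) = b v"
        proof (rule small[OF W(1)])
          fix r :: real assume r: "r \<in> {0..1}"
          have "(1 - r) *\<^sub>R u + r *\<^sub>R v \<in> ball t e \<inter> {0..1}" by (rule convexD_alt[OF cv]) (use A r in auto)
          then have "u + (v - u) * r \<in> ball t e \<inter> {0..1}" by (simp add: algebra_simps)
          then show "\<sigma> u v r \<in> W" using e(2) unfolding \<sigma>_def by blast
        qed (use A in auto)
      qed (use t e in auto)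
    qed
  qed
  then have "holonomy ?G \<kappa> p = inv\<^bsub>?G\<^esub> b 0 \<otimes>\<^bsub>?G\<^esub> b 1"
    by (rule holonomy_eq[OF is_group cocycle_universal_cocycle[OF assms(1,2)] p(1)])
  moreover have "b t = path_class Y (\<sigma> 0 t)" if "t = 0 \<or> t = 1" for t
  proof -
    have t: "p t = y" "t \<in> {0..1}" using that p by auto
    have c: "pathin Y (\<lambda>_. y)" using pathin_const[OF assms(2)] .
    have rc: "path_reverse (\<lambda>_. y) = (\<lambda>_. y)" unfolding path_reverse_def by simp
    have j: "pathin Y (path_join (\<lambda>_. y) (\<sigma> 0 t))" using c \<sigma>[of 0 t] t ends[of 0 t] p by (auto intro!: pathin_join)
    have "b t = path_class Y (path_join (path_join (\<lambda>_. y) (\<sigma> 0 t)) (\<lambda>_. y))"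
      unfolding b_def path_conj_def t \<alpha>y rc ..
    also have "\<dots> = path_class Y (path_join (\<lambda>_. y) (\<sigma> 0 t))"
      by (rule path_class_const_right[OF j]) (use ends[of 0 t] t in auto)
    also have "\<dots> = path_class Y (\<sigma> 0 t)"
      by (rule path_class_const_left) (use \<sigma>[of 0 t] t ends[of 0 t] p in auto)
    finally show ?thesis .
  qed
  moreover have "\<sigma> 0 0 = (\<lambda>_. y)" "\<sigma> 0 1 = p" unfolding \<sigma>_def using p by auto
  moreover have "path_class Y p \<in> carrier ?G" unfolding fundamental_carrier using assms(3) by blast
  ultimately show ?thesis using fundamental_one[OF assms(2)] by (metis inv_one l_one)
qed

text \<open>Any cocycle is recovered from its monodromy. The coboundary is the holonomy along
  \<open>\<alpha> u\<close>: transport around the loop defining \<open>\<kappa> u v\<close> is the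
  holonomy along \<open>\<alpha> u\<close>, times \<open>c u v\<close>, times the inverse of the
  holonomy along \<open>\<alpha> v\<close>.\<close>

lemma cohomologous_universal_cocycle:
  fixes K (structure)
  assumes "universal_cocycle Y y \<kappa>" "y \<in> topspace Y" "group K" "cocycle Y K c" "locally_path_connected_space Y"
  shows "cohomologous Y K (\<lambda>u v. monodromy K c (\<kappa> u v)) c"
proof -
  interpret K: group K by fact
  obtain \<alpha> C where C: "open_cover Y C" "\<forall>W\<in>C. path_connectedin Y W"
    and \<alpha>: "\<forall>u\<in>topspace Y. pathin Y (\<alpha> u) \<and> \<alpha> u 0 = y \<and> \<alpha> u 1 = u"
    and \<kappa>: "\<forall>W\<in>C. \<forall>p. pathin Y p \<and> p \<in> {0..1} \<rightarrow> W \<longrightarrow> \<kappa> (p 0) (p 1) = path_conj Y (\<alpha> (p 0)) p (\<alpha> (p 1))"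
    using assms(1) unfolding universal_cocycle_def by (elim exE conjE) (rule that)
  have \<alpha>h: "holonomy K c (\<alpha> u) \<in> carrier K" if "u \<in> topspace Y" for u
    using holonomy_closed[OF assms(3,4)] \<alpha> that by blast
  have "cohomologous_by Y K (\<lambda>u. holonomy K c (\<alpha> u)) (\<lambda>u v. monodromy K c (\<kappa> u v)) c"
    unfolding cohomologous_by_def
  proof
    show "(\<lambda>u. holonomy K c (\<alpha> u)) \<in> topspace Y \<rightarrow> carrier K" using \<alpha>h by blast
    have sm: "small_sets Y (\<lambda>A. cocycle_on K c A \<and> (\<exists>W\<in>C. A \<subseteq> W))"
      using small_sets_conj assms(4) open_cover_imp_small_sets[OF C(1)] unfolding cocycle_def by blast
    show "small_sets Y (\<lambda>A. \<forall>u\<in>A. \<forall>v\<in>A. monodromy K c (\<kappa> u v) \<otimes> holonomy K c (\<alpha> v) = holonomy K c (\<alpha> u) \<otimes> c u v)"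
      unfolding small_sets_def
    proof
      fix x assume "x \<in> topspace Y"
      then obtain U where U: "openin Y U" "x \<in> U" "path_connectedin Y U" "\<And>A. A \<subseteq> U \<Longrightarrow> cocycle_on K c A \<and> (\<exists>W\<in>C. A \<subseteq> W)"
        by (rule small_path_connected[OF assms(5) sm]) (rule that)
      show "\<exists>U. openin Y U \<and> x \<in> U \<and> (\<forall>A\<subseteq>U. \<forall>u\<in>A. \<forall>v\<in>A.
          monodromy K c (\<kappa> u v) \<otimes> holonomy K c (\<alpha> v) = holonomy K c (\<alpha> u) \<otimes> c u v)"
      proof (intro exI[of _ U] conjI allI impI ballI)
        fix A u v assume A: "A \<subseteq> U" "u \<in> A" "v \<in> A"
        then have "u \<in> U" "v \<in> U" by auto
        then obtain p where p: "pathin Y p" "p \<in> {0..1} \<rightarrow> U" "p 0 = u" "p 1 = v"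
          using U(3) unfolding path_connectedin by meson
        obtain W where W: "W \<in> C" "U \<subseteq> W" using U(4) by blast
        have top: "u \<in> topspace Y" "v \<in> topspace Y" using A U(1) openin_subset by blast+
        have "p \<in> {0..1} \<rightarrow> W" using p(2) W(2) by auto
        then have k: "\<kappa> u v = path_conj Y (\<alpha> u) p (\<alpha> v)" using \<kappa> W(1) p by metis
        have rv: "pathin Y (path_reverse (\<alpha> v))" using \<alpha> top pathin_reverse by blast
        have ap: "pathin Y (path_join (\<alpha> u) p)" using \<alpha> top p by (auto intro!: pathin_join)
        have pall: "pathin Y (path_join (path_join (\<alpha> u) p) (path_reverse (\<alpha> v)))"
          using \<alpha> top p ap rv by (auto intro!: pathin_join)
        have "cocycle_on K c (p ` {0..1})" using U(4)[of "p ` {0..1}"] p(2) by (auto simp: Pi_iff)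
        then have hp: "holonomy K c p = c u v" using holonomy_small[OF assms(3,4) p(1)] p by simp
        have hr: "holonomy K c (path_reverse (\<alpha> v)) \<otimes> holonomy K c (\<alpha> v) = \<one>"
        proof -
          have "path_homotopic Y (path_join (path_reverse (\<alpha> v)) (\<alpha> v)) (\<lambda>_. v)"
            using path_class_reverse_left[of Y "\<alpha> v"] \<alpha> top rv by (intro path_homotopic_classI pathin_join) auto
          from holonomy_homotopic[OF assms(3,4) this] show ?thesis
            using holonomy_join[OF assms(3,4) rv, of "\<alpha> v"] \<alpha> top holonomy_const[OF assms(3,4)] by simp
        qed
        have "monodromy K c (\<kappa> u v) = holonomy K c (\<alpha> u) \<otimes> c u v \<otimes> holonomy K c (path_reverse (\<alpha> v))"
          unfolding k path_conj_def monodromy_class[OF assms(3,4) pall]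
          using holonomy_join[OF assms(3,4) ap rv] holonomy_join[OF assms(3,4), of "\<alpha> u" p] \<alpha> top p hp by simp
        moreover have "c u v \<in> carrier K" using hp holonomy_closed[OF assms(3,4) p(1)] by simp
        ultimately show "monodromy K c (\<kappa> u v) \<otimes> holonomy K c (\<alpha> v) = holonomy K c (\<alpha> u) \<otimes> c u v"
          using hr \<alpha>h top holonomy_closed[OF assms(3,4) rv] by (simp add: K.m_assoc)
      qed (use U in auto)
    qed
  qed
  then show ?thesis unfolding cohomologous_def by blast
qed

section \<open>Inverse sequences of compact Hausdorff spaces\<close>

text \<open>\<open>bond f n m\<close> is the composite of the bonding maps from level \<open>m\<close> down to level \<open>n \<le> m\<close>.\<close>

primrec bond :: "(nat \<Rightarrow> 'b \<Rightarrow> 'b) \<Rightarrow> nat \<Rightarrow> nat \<Rightarrow> 'b \<Rightarrow> 'b" where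
  "bond f n 0 = id"
| "bond f n (Suc m) = (if Suc m \<le> n then id else bond f n m \<circ> f (Suc m))"

lemma bond_refl [simp]: "bond f n n = id"
  by (cases n) auto

lemma bond_Suc_right: "n \<le> m \<Longrightarrow> bond f n (Suc m) = bond f n m \<circ> f (Suc m)"
  by simp

declare bond.simps(2) [simp del]

lemma bond_bond: "n \<le> m \<Longrightarrow> m \<le> k \<Longrightarrow> bond f n m (bond f m k z) = bond f n k z"
proof (induction k arbitrary: z)
  case (Suc k)
  show ?case
  proof (cases "m = Suc k")
    case False
    then have "m \<le> k" "n \<le> k" using Suc.prems by auto
    then show ?thesis using Suc.IH Suc.prems by (simp add: bond_Suc_right)
  qed simp
qed simp

lemma bond_Suc_left: "n < m \<Longrightarrow> bond f n m z = f (Suc n) (bond f (Suc n) m z)"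
  using bond_bond[of n "Suc n" m f z] by (simp add: bond_Suc_right)

lemma bond_in:
  assumes "\<And>n z. z \<in> A (Suc n) \<Longrightarrow> f (Suc n) z \<in> A n" "n \<le> m" "z \<in> A m"
  shows "bond f n m z \<in> A n"
  using assms(2,3)
proof (induction m arbitrary: z)
  case (Suc m)
  then show ?case using assms(1) by (cases "n = Suc m") (auto simp: bond_Suc_right)
qed simp

lemma bond_thread:
  assumes "\<And>n. f (Suc n) (z (Suc n)) = z n" "n \<le> m" shows "bond f n m (z m) = z n"
  using assms(2)
proof (induction m)
  case (Suc m)
  then show ?case using assms(1) by (cases "n = Suc m") (auto simp: bond_Suc_right)
qed simp

lemma threads_bond: "z \<in> threads A f \<Longrightarrow> n \<le> m \<Longrightarrow> bond f n m (z m) = z n"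
  unfolding threads_def by (rule bond_thread) auto

lemma continuous_map_bond:
  assumes "\<And>n. continuous_map (X (Suc n)) (X n) (f (Suc n))" "n \<le> m"
  shows "continuous_map (X m) (X n) (bond f n m)"
  using assms(2)
proof (induction m)
  case (Suc m)
  show ?case
  proof (cases "n = Suc m")
    case False
    then have n: "n \<le> m" using Suc.prems by simp
    show ?thesis unfolding bond_Suc_right[OF n] by (rule continuous_map_compose[OF assms(1) Suc.IH[OF n]])
  qed simp
qed simp

lemma topspace_invlim: "topspace (invlim_topology X f) = threads (\<lambda>n. topspace (X n)) f"
  unfolding invlim_topology_def threads_def by auto

lemma continuous_map_invlim_proj: "continuous_map (invlim_topology X f) (X n) (\<lambda>z. z n)"
  unfolding invlim_topology_def
  by (intro continuous_map_from_subtopology continuous_map_product_projection) simp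

text \<open>Sequences that satisfy the first \<open>l\<close> thread equations and the condition at
  \<open>k\<close> form nonempty closed sets in a compact product, decreasing in \<open>l\<close>.
  Their intersection consists of threads.\<close>

lemma invlim_threads_exist:
  assumes comp: "\<And>n. compact_space (X n)" and haus: "\<And>n. Hausdorff_space (X n)"
    and cont: "\<And>n. continuous_map (X (Suc n)) (X n) (f (Suc n))"
    and D: "closedin (X k) D" and ex: "\<And>l. k \<le> l \<Longrightarrow> \<exists>z\<in>topspace (X l). bond f k l z \<in> D"
  obtains u where "u \<in> threads (\<lambda>n. topspace (X n)) f" "u k \<in> D"
proof -
  let ?P = "product_topology X UNIV"
  have top: "topspace ?P = {u. \<forall>n. u n \<in> topspace (X n)}" by (auto simp: PiE_def Pi_def)
  have proj: "continuous_map ?P (X n) (\<lambda>u. u n)" for n by (rule continuous_map_product_projection) simp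
  have fin: "f (Suc n) z \<in> topspace (X n)" if "z \<in> topspace (X (Suc n))" for n z
    using cont[of n] that unfolding continuous_map_def by blast
  have bin: "bond f n m z \<in> topspace (X n)" if "n \<le> m" "z \<in> topspace (X m)" for n m z
    by (rule bond_in[where A = "\<lambda>n. topspace (X n)", OF fin that])
  define C where "C l = {u \<in> topspace ?P. (\<forall>n<l. f (Suc n) (u (Suc n)) = u n) \<and> u k \<in> D}" for l
  have "\<Inter>(range C) \<noteq> {}"
  proof (rule compact_space_imp_nest)
    show "compact_space ?P" using comp by (simp add: compact_space_product_topology)
    show "closedin ?P (C l)" for l
    proof (induction l)
      case 0
      show ?case using closedin_continuous_map_preimage[OF proj D] unfolding C_def by simp
    next
      case (Suc l)
      have "closedin ?P {u \<in> topspace ?P. (f (Suc l) \<circ> (\<lambda>u. u (Suc l))) u = u l}"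
        by (intro closedin_continuous_maps_eq[OF haus[of l]] proj continuous_map_compose[OF proj cont])
      moreover have "C (Suc l) = C l \<inter> {u \<in> topspace ?P. (f (Suc l) \<circ> (\<lambda>u. u (Suc l))) u = u l}"
        unfolding C_def by (auto simp: less_Suc_eq)
      ultimately show ?case using Suc by auto
    qed
    show "C l \<noteq> {}" for l
    proof -
      define L where "L = max l k"
      obtain z where z: "z \<in> topspace (X L)" "bond f k L z \<in> D" using ex[of L] unfolding L_def by auto
      have "\<exists>a. a \<in> topspace (X n)" for n
      proof -
        obtain y where "y \<in> topspace (X (max n k))" using ex[of "max n k"] by auto
        then have "bond f n (max n k) y \<in> topspace (X n)" by (intro bin) auto
        then show ?thesis by blast
      qed
      then obtain a where a: "\<And>n. a n \<in> topspace (X n)" by metis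
      \<comment> \<open>Above level \<open>L\<close> no equation is imposed yet, so arbitrary points
        are used there.\<close>
      define u where "u n = (if n \<le> L then bond f n L z else a n)" for n
      have "u n \<in> topspace (X n)" for n using a bin z unfolding u_def by auto
      moreover have "f (Suc n) (u (Suc n)) = u n" if "n < l" for n
        using that bond_Suc_left[of n L f z] unfolding u_def L_def by auto
      moreover have "u k \<in> D" using z unfolding u_def L_def by simp
      ultimately have "u \<in> C l" unfolding C_def top by blast
      then show ?thesis by blast
    qed
    show "antimono_on UNIV C" unfolding C_def monotone_on_def by auto
  qed
  then obtain u where u: "\<And>l. u \<in> C l" by blast
  then have "f (Suc n) (u (Suc n)) = u n" for n using u[of "Suc n"] unfolding C_def by blast
  moreover have "u n \<in> topspace (X n)" for n using u[of 0] unfolding C_def top by blast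
  moreover have "u k \<in> D" using u[of 0] unfolding C_def by blast
  ultimately show thesis using that unfolding threads_def by blast
qed

text \<open>Threads are cut out by equations between continuous maps into Hausdorff spaces, hence
  form a closed set in a compact product.\<close>

lemma compact_space_invlim:
  assumes comp: "\<And>n. compact_space (X n)" and haus: "\<And>n. Hausdorff_space (X n)"
    and cont: "\<And>n. continuous_map (X (Suc n)) (X n) (f (Suc n))"
  shows "compact_space (invlim_topology X f)"
proof -
  let ?P = "product_topology X UNIV"
  have proj: "continuous_map ?P (X n) (\<lambda>u. u n)" for n by (rule continuous_map_product_projection) simp
  have "closedin ?P {u \<in> topspace ?P. (f (Suc n) \<circ> (\<lambda>u. u (Suc n))) u = u n}" for n
    by (intro closedin_continuous_maps_eq[OF haus[of n]] proj continuous_map_compose[OF proj cont])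
  then have "closedin ?P (\<Inter>n. {u \<in> topspace ?P. (f (Suc n) \<circ> (\<lambda>u. u (Suc n))) u = u n})"
    by (intro closedin_Inter) auto
  moreover have "(\<Inter>n. {u \<in> topspace ?P. (f (Suc n) \<circ> (\<lambda>u. u (Suc n))) u = u n}) = threads (\<lambda>n. topspace (X n)) f"
    unfolding threads_def by (auto simp: PiE_def Pi_def)
  moreover have "compact_space ?P" using comp by (simp add: compact_space_product_topology)
  ultimately have "compactin ?P (threads (\<lambda>n. topspace (X n)) f)"
    using closedin_compact_space by metis
  then show ?thesis unfolding invlim_topology_def by (rule compact_space_subtopology)
qed

text \<open>A basic open set of the product restricts finitely many coordinates. A thread determines
  its earlier entries from a later one, so all restrictions can be moved to one level
  \<open>k\<close>, as late as desired.\<close>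

lemma invlim_basis:
  assumes cont: "\<And>n. continuous_map (X (Suc n)) (X n) (f (Suc n))"
    and "openin (invlim_topology X f) V" "u \<in> V"
  obtains k Q where "N \<le> k" "openin (X k) Q" "u k \<in> Q" "\<And>v. v \<in> threads (\<lambda>n. topspace (X n)) f \<Longrightarrow> v k \<in> Q \<Longrightarrow> v \<in> V"
proof -
  let ?T = "threads (\<lambda>n. topspace (X n)) f"
  obtain V' where V': "openin (product_topology X UNIV) V'" "V = V' \<inter> ?T"
    using assms(2) unfolding invlim_topology_def openin_subtopology by blast
  then obtain U where U: "finite {i. U i \<noteq> topspace (X i)}" "\<And>i. openin (X i) (U i)" "u \<in> PiE UNIV U" "PiE UNIV U \<subseteq> V'"
    using assms(3) unfolding openin_product_topology_alt by auto
  define k where "k = Max (insert N {i. U i \<noteq> topspace (X i)})"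
  have k: "N \<le> k" "\<And>i. U i \<noteq> topspace (X i) \<Longrightarrow> i \<le> k" unfolding k_def using U(1) by auto
  define Q where "Q = topspace (X k) \<inter> (\<Inter>i\<in>{..k}. {z \<in> topspace (X k). bond f i k z \<in> U i})"
  have uT: "u \<in> ?T" using assms(3) V' by blast
  show thesis
  proof (rule that[OF k(1)])
    have "openin (X k) (\<Inter>i\<in>{..k}. {z \<in> topspace (X k). bond f i k z \<in> U i})"
    proof (rule openin_Inter)
      fix S assume "S \<in> (\<lambda>i. {z \<in> topspace (X k). bond f i k z \<in> U i}) ` {..k}"
      then obtain i where i: "i \<le> k" "S = {z \<in> topspace (X k). bond f i k z \<in> U i}" by auto
      show "openin (X k) S" unfolding i(2)
        using openin_continuous_map_preimage[OF continuous_map_bond[where X = X and f = f, OF cont i(1)] U(2)] .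
    qed auto
    then show "openin (X k) Q" unfolding Q_def by blast
    show "u k \<in> Q" unfolding Q_def using threads_bond[OF uT] U(3) uT by (auto simp: threads_def PiE_def Pi_def)
    fix v assume v: "v \<in> ?T" "v k \<in> Q"
    have "v i \<in> U i" for i
    proof (cases "i \<le> k")
      case True
      then have "bond f i k (v k) \<in> U i" using v(2) unfolding Q_def by auto
      then show ?thesis using threads_bond[OF v(1) True] by simp
    next
      case False
      then have "U i = topspace (X i)" using k(2) by blast
      then show ?thesis using v(1) unfolding threads_def by blast
    qed
    then show "v \<in> V" using U(4) V' v(1) by (auto simp: PiE_def Pi_def)
  qed
qed

section \<open>Cocycles on an inverse limit\<close>

text \<open>The space \<open>X\<close> is kept apart from the set of threads so that two
  presentations can be compared through cocycles on one and the same space.\<close>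

locale compact_inverse_limit =
  fixes X :: "'x topology" and \<Gamma> :: "nat \<Rightarrow> 'b topology" and \<sigma> :: "nat \<Rightarrow> 'b \<Rightarrow> 'b" and p :: "'x \<Rightarrow> nat \<Rightarrow> 'b"
  assumes comp: "\<And>n. compact_space (\<Gamma> n)" and haus: "\<And>n. Hausdorff_space (\<Gamma> n)"
    and cont: "\<And>n. continuous_map (\<Gamma> (Suc n)) (\<Gamma> n) (\<sigma> (Suc n))"
    and homeo: "homeomorphic_map X (invlim_topology \<Gamma> \<sigma>) p"
begin

lemma continuous_map_proj: "continuous_map X (\<Gamma> n) (\<lambda>S. p S n)"
  using continuous_map_compose[OF homeomorphic_imp_continuous_map[OF homeo] continuous_map_invlim_proj]
  by (simp add: comp_def)

lemma p_threads: "S \<in> topspace X \<Longrightarrow> p S \<in> threads (\<lambda>n. topspace (\<Gamma> n)) \<sigma>"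
  using homeomorphic_imp_surjective_map[OF homeo] unfolding topspace_invlim by blast

lemma p_surj:
  assumes "u \<in> threads (\<lambda>n. topspace (\<Gamma> n)) \<sigma>" obtains S where "S \<in> topspace X" "p S = u"
proof -
  have "u \<in> p ` topspace X"
    using assms homeomorphic_imp_surjective_map[OF homeo] unfolding topspace_invlim by simp
  then show thesis using that by blast
qed

lemma bond_p: "S \<in> topspace X \<Longrightarrow> n \<le> m \<Longrightarrow> bond \<sigma> n m (p S m) = p S n"
  using threads_bond[OF p_threads] .

lemma compact_X: "compact_space X"
  using compact_space_invlim[where X = \<Gamma> and f = \<sigma>, OF comp haus cont] homeomorphic_map_imp_homeomorphic_space[OF homeo]
    homeomorphic_compact_space by blast

lemma basis:
  assumes "openin X V" "S \<in> V"
  obtains k Q where "N \<le> k" "openin (\<Gamma> k) Q" "p S k \<in> Q" "\<And>S'. S' \<in> topspace X \<Longrightarrow> p S' k \<in> Q \<Longrightarrow> S' \<in> V"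
proof -
  have V: "openin (invlim_topology \<Gamma> \<sigma>) (p ` V)"
    using homeomorphic_imp_open_map[OF homeo] assms(1) unfolding open_map_def by blast
  obtain k Q where Q: "N \<le> k" "openin (\<Gamma> k) Q" "p S k \<in> Q" "\<And>v. v \<in> threads (\<lambda>n. topspace (\<Gamma> n)) \<sigma> \<Longrightarrow> v k \<in> Q \<Longrightarrow> v \<in> p ` V"
    by (rule invlim_basis[where X = \<Gamma> and f = \<sigma>, OF cont V, of "p S" N]) (use assms(2) that in auto)
  have inj: "inj_on p (topspace X)" by (rule homeomorphic_imp_injective_map[OF homeo])
  have VX: "V \<subseteq> topspace X" using assms(1) openin_subset by blast
  show thesis
  proof (rule that[OF Q(1-3)])
    fix S' assume S': "S' \<in> topspace X" "p S' k \<in> Q"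
    then obtain S'' where "S'' \<in> V" "p S' = p S''" using Q(4)[OF p_threads[OF S'(1)]] by blast
    then show "S' \<in> V" using inj S'(1) VX by (metis inj_onD subsetD)
  qed
qed

text \<open>The projection to a late stage has an approximate section \<open>r\<close>: it need not be continuous, but at the
  scale given by \<open>P\<close> and \<open>Q\<close> it behaves like a continuous section. Points of the stage not in the image of
  the limit are moved to that image, which is harmless since late stages map close to it.\<close>

lemma approximate_section:
  assumes P: "small_sets X P" and Q: "small_sets (\<Gamma> M) Q"
  obtains l r where "N \<le> l" "M \<le> l" "\<And>z. z \<in> topspace (\<Gamma> l) \<Longrightarrow> r z \<in> topspace X"
    "small_sets (\<Gamma> l) (\<lambda>A. P (r ` A \<union> {S \<in> topspace X. p S l \<in> A}) \<and>
       Q (bond \<sigma> M l ` A \<union> (\<lambda>z. p (r z) M) ` A))"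
proof -
  \<comment> \<open>The open sets of stage \<open>k\<close> that are small in both respects: their
    trace on \<open>X\<close> for \<open>P\<close>, and their image in stage \<open>M\<close> for
    \<open>Q\<close>.\<close>
  define B where "B k = {R. openin (\<Gamma> k) R \<and> (\<forall>A\<subseteq>{S \<in> topspace X. p S k \<in> R}. P A) \<and>
      (\<forall>A\<subseteq>bond \<sigma> M k ` R. Q A)}" for k
  have B_mono: "{z \<in> topspace (\<Gamma> k'). bond \<sigma> k k' z \<in> R} \<in> B k'" if "R \<in> B k" "M \<le> k" "k \<le> k'" for R k k'
  proof -
    have "openin (\<Gamma> k') {z \<in> topspace (\<Gamma> k'). bond \<sigma> k k' z \<in> R}"
      using openin_continuous_map_preimage[OF continuous_map_bond[where X = \<Gamma>, OF cont that(3)]] that(1) unfolding B_def by blast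
    moreover have "{S \<in> topspace X. p S k' \<in> {z \<in> topspace (\<Gamma> k'). bond \<sigma> k k' z \<in> R}} \<subseteq> {S \<in> topspace X. p S k \<in> R}"
      using bond_p that(3) by auto
    moreover have "bond \<sigma> M k' ` {z \<in> topspace (\<Gamma> k'). bond \<sigma> k k' z \<in> R} \<subseteq> bond \<sigma> M k ` R"
      using bond_bond[OF that(2,3), of \<sigma>] by (auto simp: image_iff) metis
    ultimately show ?thesis using that(1) unfolding B_def by (auto dest: subset_trans)
  qed
  have Bex: "\<exists>k R. M \<le> k \<and> N \<le> k \<and> R \<in> B k \<and> p S k \<in> R" if S: "S \<in> topspace X" for S
  proof -
    obtain U where U: "openin X U" "S \<in> U" "\<forall>A\<subseteq>U. P A" using P S unfolding small_sets_def by blast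
    have "p S M \<in> topspace (\<Gamma> M)" using p_threads[OF S] unfolding threads_def by blast
    then obtain W where W: "openin (\<Gamma> M) W" "p S M \<in> W" "\<forall>A\<subseteq>W. Q A" using Q unfolding small_sets_def by blast
    obtain k R where R: "max M N \<le> k" "openin (\<Gamma> k) R" "p S k \<in> R" "\<And>S'. S' \<in> topspace X \<Longrightarrow> p S' k \<in> R \<Longrightarrow> S' \<in> U"
      by (rule basis[OF U(1,2), of "max M N"]) (rule that)
    have Mk: "M \<le> k" using R(1) by simp
    define R' where "R' = R \<inter> {z \<in> topspace (\<Gamma> k). bond \<sigma> M k z \<in> W}"
    have "openin (\<Gamma> k) R'"
      unfolding R'_def using R(2) openin_continuous_map_preimage[OF continuous_map_bond[where X = \<Gamma>, OF cont Mk] W(1)] by blast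
    moreover have "{S \<in> topspace X. p S k \<in> R'} \<subseteq> U" using R(4) unfolding R'_def by blast
    moreover have "bond \<sigma> M k ` R' \<subseteq> W" unfolding R'_def by blast
    ultimately have "R' \<in> B k" using U(3) W(3) unfolding B_def by (auto dest: subset_trans)
    moreover have "p S k \<in> R'" using R(3) W(2) bond_p[OF S Mk] p_threads[OF S] unfolding R'_def threads_def by auto
    ultimately show ?thesis using R(1) by auto
  qed
  \<comment> \<open>By compactness of \<open>X\<close> finitely many levels suffice, and
    \<open>B_mono\<close> lifts the chosen sets to the greatest of these levels.\<close>
  obtain K where K: "M \<le> K" "N \<le> K" "\<And>S. S \<in> topspace X \<Longrightarrow> \<exists>R\<in>B K. p S K \<in> R"
  proof -
    define V where "V k = {S \<in> topspace X. p S k \<in> \<Union>(B k)}" for k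
    have "\<exists>\<F>. finite \<F> \<and> \<F> \<subseteq> V ` {k. M \<le> k \<and> N \<le> k} \<and> topspace X \<subseteq> \<Union>\<F>"
    proof (rule compact_X[unfolded compact_space_def compactin_def, THEN conjunct2, rule_format], intro conjI ballI)
      fix U assume "U \<in> V ` {k. M \<le> k \<and> N \<le> k}"
      then obtain k where "U = {S \<in> topspace X. p S k \<in> \<Union>(B k)}" unfolding V_def by blast
      moreover have "openin (\<Gamma> k) (\<Union>(B k))" unfolding B_def by (rule openin_Union) blast
      ultimately show "openin X U" using openin_continuous_map_preimage[OF continuous_map_proj] by blast
    next
      show "topspace X \<subseteq> \<Union>(V ` {k. M \<le> k \<and> N \<le> k})"
      proof
        fix S assume S: "S \<in> topspace X"
        then obtain k R where "M \<le> k" "N \<le> k" "R \<in> B k" "p S k \<in> R" using Bex by blast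
        then show "S \<in> \<Union>(V ` {k. M \<le> k \<and> N \<le> k})" using S unfolding V_def by blast
      qed
    qed
    then obtain \<F> where F: "finite \<F>" "\<F> \<subseteq> V ` {k. M \<le> k \<and> N \<le> k}" "topspace X \<subseteq> \<Union>\<F>" by blast
    obtain I where I: "finite I" "I \<subseteq> {k. M \<le> k \<and> N \<le> k}" "topspace X \<subseteq> \<Union>(V ` I)"
      using finite_subset_image[OF F(1,2)] F(3) by blast
    define K where "K = Max (insert M (insert N I))"
    have fin: "finite (insert M (insert N I))" using I(1) by simp
    have KK: "M \<le> K" "N \<le> K" "\<And>i. i \<in> I \<Longrightarrow> i \<le> K" unfolding K_def by (rule Max_ge[OF fin], simp)+
    have cov: "\<exists>R\<in>B K. p S K \<in> R" if S: "S \<in> topspace X" for S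
    proof -
      obtain i where "i \<in> I" "S \<in> V i" using I(3) S by blast
      then have "p S i \<in> \<Union>(B i)" unfolding V_def by simp
      with \<open>i \<in> I\<close> obtain R where i: "i \<in> I" "R \<in> B i" "p S i \<in> R" by blast
      have iK: "M \<le> i" "i \<le> K" using I(2) i(1) KK(3) by auto
      have "p S K \<in> {z \<in> topspace (\<Gamma> K). bond \<sigma> i K z \<in> R}"
        using bond_p[OF S iK(2)] i(3) p_threads[OF S] unfolding threads_def by auto
      then show ?thesis by (rule bexI[OF _ B_mono[OF i(2) iK]])
    qed
    show thesis by (rule that[OF KK(1,2) cov])
  qed
  define Z where "Z = (\<lambda>S. p S K) ` topspace X"
  have Zc: "closedin (\<Gamma> K) Z"
    unfolding Z_def using compact_X[unfolded compact_space_def]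
    by (intro compactin_imp_closedin[OF haus] image_compactin[OF _ continuous_map_proj])
  \<comment> \<open>Away from the closed image \<open>Z\<close> of the limit nothing is demanded,
    since images of sufficiently late stages avoid that region.\<close>
  have "small_sets (\<Gamma> K) (\<lambda>A. (\<exists>R\<in>B K. A \<subseteq> R) \<or> A \<inter> Z = {})"
    unfolding small_sets_def
  proof
    fix x assume x: "x \<in> topspace (\<Gamma> K)"
    show "\<exists>U. openin (\<Gamma> K) U \<and> x \<in> U \<and> (\<forall>A\<subseteq>U. (\<exists>R\<in>B K. A \<subseteq> R) \<or> A \<inter> Z = {})"
    proof (cases "x \<in> Z")
      case True
      then obtain R where R: "R \<in> B K" "x \<in> R" using K(3) unfolding Z_def by blast
      then have "openin (\<Gamma> K) R" unfolding B_def by blast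
      then show ?thesis using R by blast
    next
      case False
      have "openin (\<Gamma> K) (topspace (\<Gamma> K) - Z)" using Zc by auto
      then show ?thesis using x False by (intro exI[of _ "topspace (\<Gamma> K) - Z"]) blast
    qed
  qed
  then obtain C where C: "open_cover (\<Gamma> K) C"
    "\<And>V. V \<in> C \<Longrightarrow> V \<noteq> {} \<Longrightarrow> (\<exists>R\<in>B K. \<Union>{V'\<in>C. V' \<inter> V \<noteq> {}} \<subseteq> R) \<or> \<Union>{V'\<in>C. V' \<inter> V \<noteq> {}} \<inter> Z = {}"
    by (rule star_refinement[OF comp haus]) (rule that)
  define CZ where "CZ = {V \<in> C. V \<inter> Z \<noteq> {}}"
  have star: "\<exists>R\<in>B K. \<Union>{V'\<in>C. V' \<inter> V \<noteq> {}} \<subseteq> R" if "V \<in> CZ" for V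
  proof -
    have V: "V \<in> C" "V \<noteq> {}" "V \<inter> Z \<noteq> {}" using that unfolding CZ_def by auto
    have "V \<subseteq> \<Union>{V'\<in>C. V' \<inter> V \<noteq> {}}" using V by blast
    then show ?thesis using C(2)[OF V(1,2)] V(3) by blast
  qed
  have CZo: "openin (\<Gamma> K) V" if "V \<in> CZ" for V using that C(1) unfolding CZ_def open_cover_def by blast
  \<comment> \<open>If every later stage had a point mapping outside the union of \<open>CZ\<close>,
    compactness would give a thread whose entry at \<open>K\<close> lies outside it; but that entry
    lies in \<open>Z\<close>, which \<open>CZ\<close> covers.\<close>
  have "\<exists>l\<ge>K. \<forall>z\<in>topspace (\<Gamma> l). bond \<sigma> K l z \<in> \<Union>CZ"
  proof (rule ccontr)
    assume *: "\<not> ?thesis"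
    have "bond \<sigma> K l z \<in> topspace (\<Gamma> K)" if "K \<le> l" "z \<in> topspace (\<Gamma> l)" for l z
      using continuous_map_bond[where X = \<Gamma>, OF cont that(1)] that(2) unfolding continuous_map_def by blast
    then have ex: "\<exists>z\<in>topspace (\<Gamma> l). bond \<sigma> K l z \<in> topspace (\<Gamma> K) - \<Union>CZ" if "K \<le> l" for l
      using * that by (meson DiffI)
    have cl: "closedin (\<Gamma> K) (topspace (\<Gamma> K) - \<Union>CZ)" using openin_Union[of CZ "\<Gamma> K"] CZo by auto
    obtain u where u: "u \<in> threads (\<lambda>n. topspace (\<Gamma> n)) \<sigma>" "u K \<in> topspace (\<Gamma> K) - \<Union>CZ"
      by (rule invlim_threads_exist[where X = \<Gamma> and f = \<sigma>, OF comp haus cont cl]) (erule ex, rule that)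
    obtain S where S: "S \<in> topspace X" "p S = u" by (rule p_surj[OF u(1)])
    then have "u K \<in> Z" unfolding Z_def by blast
    moreover have "u K \<in> topspace (\<Gamma> K)" using u(2) by blast
    moreover have "\<Union>C = topspace (\<Gamma> K)" using C(1) unfolding open_cover_def by (rule conjunct2)
    ultimately obtain V where "V \<in> C" "u K \<in> V" "u K \<in> Z" by blast
    then have "u K \<in> \<Union>CZ" unfolding CZ_def by blast
    then show False using u(2) by blast
  qed
  then obtain l where "K \<le> l \<and> (\<forall>z\<in>topspace (\<Gamma> l). bond \<sigma> K l z \<in> \<Union>CZ)" by (elim exE) (rule that)
  then have l: "K \<le> l" "\<And>z. z \<in> topspace (\<Gamma> l) \<Longrightarrow> bond \<sigma> K l z \<in> \<Union>CZ" by simp_all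
  \<comment> \<open>The section sends \<open>z\<close> to any point of \<open>X\<close> that shares
    a member of \<open>CZ\<close> with \<open>z\<close> at level \<open>K\<close>. The star property
    of \<open>C\<close> then keeps the values at nearby points within one \<open>R\<close> of
    \<open>B K\<close>.\<close>
  have "\<exists>S. S \<in> topspace X \<and> (\<exists>V\<in>CZ. bond \<sigma> K l z \<in> V \<and> p S K \<in> V)" if "z \<in> topspace (\<Gamma> l)" for z
  proof -
    obtain V where V: "V \<in> CZ" "bond \<sigma> K l z \<in> V" using l(2)[OF \<open>z \<in> topspace (\<Gamma> l)\<close>] by blast
    then have "V \<inter> Z \<noteq> {}" unfolding CZ_def by simp
    then obtain S where "S \<in> topspace X" "p S K \<in> V" unfolding Z_def by blast
    then show ?thesis using V by blast
  qed
  then obtain r where r: "\<And>z. z \<in> topspace (\<Gamma> l) \<Longrightarrow> r z \<in> topspace X"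
    "\<And>z. z \<in> topspace (\<Gamma> l) \<Longrightarrow> \<exists>V\<in>CZ. bond \<sigma> K l z \<in> V \<and> p (r z) K \<in> V"
    by metis
  have small: "small_sets (\<Gamma> l) (\<lambda>A. P (r ` A \<union> {S \<in> topspace X. p S l \<in> A}) \<and>
       Q (bond \<sigma> M l ` A \<union> (\<lambda>z. p (r z) M) ` A))"
    unfolding small_sets_def
  proof
    fix z0 assume z0: "z0 \<in> topspace (\<Gamma> l)"
    then obtain V where V: "V \<in> CZ" "bond \<sigma> K l z0 \<in> V" using l(2) by blast
    obtain R where R: "R \<in> B K" "\<Union>{V'\<in>C. V' \<inter> V \<noteq> {}} \<subseteq> R" using star[OF V(1)] by blast
    have VR: "V \<subseteq> R" using R(2) V unfolding CZ_def by blast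
    define G where "G = {z \<in> topspace (\<Gamma> l). bond \<sigma> K l z \<in> V}"
    have rR: "p (r z) K \<in> R" if z: "z \<in> G" for z
    proof -
      have "z \<in> topspace (\<Gamma> l)" "bond \<sigma> K l z \<in> V" using z unfolding G_def by auto
      then obtain V' where V': "V' \<in> CZ" "bond \<sigma> K l z \<in> V'" "p (r z) K \<in> V'" using r(2) by blast
      then have "V' \<in> {V'\<in>C. V' \<inter> V \<noteq> {}}" using \<open>bond \<sigma> K l z \<in> V\<close> unfolding CZ_def by blast
      then show ?thesis using V'(3) R(2) by blast
    qed
    show "\<exists>U. openin (\<Gamma> l) U \<and> z0 \<in> U \<and> (\<forall>A\<subseteq>U. P (r ` A \<union> {S \<in> topspace X. p S l \<in> A}) \<and>
       Q (bond \<sigma> M l ` A \<union> (\<lambda>z. p (r z) M) ` A))"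
    proof (intro exI[of _ G] conjI allI impI)
      show "openin (\<Gamma> l) G"
        unfolding G_def using openin_continuous_map_preimage[OF continuous_map_bond[where X = \<Gamma>, OF cont l(1)] CZo[OF V(1)]] .
      show "z0 \<in> G" unfolding G_def using z0 V by blast
      fix A assume A: "A \<subseteq> G"
      have "r ` A \<union> {S \<in> topspace X. p S l \<in> A} \<subseteq> {S \<in> topspace X. p S K \<in> R}"
      proof
        fix S assume "S \<in> r ` A \<union> {S \<in> topspace X. p S l \<in> A}"
        then consider z where "z \<in> A" "S = r z" | "S \<in> topspace X" "p S l \<in> A" by blast
        then show "S \<in> {S \<in> topspace X. p S K \<in> R}"
        proof cases
          case 1 then show ?thesis using rR A r(1) unfolding G_def by blast
        next
          case 2
          then have "bond \<sigma> K l (p S l) \<in> V" using A unfolding G_def by blast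
          then show ?thesis using 2 bond_p[OF 2(1) l(1)] VR by auto
        qed
      qed
      then show "P (r ` A \<union> {S \<in> topspace X. p S l \<in> A})" using R(1) unfolding B_def by blast
      have "bond \<sigma> M l ` A \<union> (\<lambda>z. p (r z) M) ` A \<subseteq> bond \<sigma> M K ` R"
      proof
        fix w assume "w \<in> bond \<sigma> M l ` A \<union> (\<lambda>z. p (r z) M) ` A"
        then consider z where "z \<in> A" "w = bond \<sigma> M l z" | z where "z \<in> A" "w = p (r z) M" by blast
        then show "w \<in> bond \<sigma> M K ` R"
        proof cases
          case 1
          then have "w = bond \<sigma> M K (bond \<sigma> K l z)" using bond_bond[OF K(1) l(1), of \<sigma> z] by simp
          moreover have "bond \<sigma> K l z \<in> R" using 1 A VR unfolding G_def by blast
          ultimately show ?thesis by blast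
        next
          case 2
          then have z: "z \<in> G" "r z \<in> topspace X" using A r(1) unfolding G_def by blast+
          then show ?thesis using 2 bond_p[OF z(2) K(1)] rR[OF z(1)] by (metis imageI)
        qed
      qed
      then show "Q (bond \<sigma> M l ` A \<union> (\<lambda>z. p (r z) M) ` A)" using R(1) unfolding B_def by blast
    qed
  qed
  show thesis by (rule that[of l r]) (use l(1) K r small in auto)
qed

text \<open>The cocycle is pulled back along the approximate section \<open>r\<close>. Since
  \<open>S\<close> and \<open>r (p S l)\<close> are close in \<open>X\<close>, the element
  \<open>c (r (p S l)) S\<close> is defined and serves as coboundary.\<close>

lemma cocycle_from_stage:
  fixes K (structure)
  assumes "group K" "cocycle X K c"
  obtains l c' where "N \<le> l" "cocycle (\<Gamma> l) K c'" "cohomologous X K (\<lambda>S S'. c' (p S l) (p S' l)) c"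
proof -
  interpret group K by fact
  obtain l r where lr: "N \<le> l" "\<And>z. z \<in> topspace (\<Gamma> l) \<Longrightarrow> r z \<in> topspace X"
    "small_sets (\<Gamma> l) (\<lambda>A. cocycle_on K c (r ` A \<union> {S \<in> topspace X. p S l \<in> A}) \<and> True)"
    by (rule approximate_section[OF assms(2)[unfolded cocycle_def], of 0 "\<lambda>_. True" N])
       (auto simp: small_sets_True intro: that)
  define c' where "c' z z' = c (r z) (r z')" for z z'
  have c': "cocycle (\<Gamma> l) K c'"
    unfolding cocycle_def by (rule small_sets_mono[OF lr(3)]) (auto simp: cocycle_on_def c'_def)
  have "cohomologous_by X K (\<lambda>S. c (r (p S l)) S) (\<lambda>S S'. c' (p S l) (p S' l)) c"
    unfolding cohomologous_by_def
  proof
    have sm: "small_sets X (\<lambda>A. cocycle_on K c (r ` (\<lambda>S. p S l) ` A \<union> {S \<in> topspace X. p S l \<in> (\<lambda>S. p S l) ` A}) \<and> True)"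
      by (rule small_sets_pullback[OF continuous_map_proj lr(3)])
    show "small_sets X (\<lambda>A. \<forall>u\<in>A. \<forall>v\<in>A. c' (p u l) (p v l) \<otimes> c (r (p v l)) v = c (r (p u l)) u \<otimes> c u v)"
    proof (rule small_sets_mono[OF sm], intro ballI)
      fix A u v
      let ?T = "r ` (\<lambda>S. p S l) ` A \<union> {S \<in> topspace X. p S l \<in> (\<lambda>S. p S l) ` A}"
      assume A: "A \<subseteq> topspace X" "cocycle_on K c ?T \<and> True" "u \<in> A" "v \<in> A"
      then have "u \<in> ?T" "v \<in> ?T" "r (p u l) \<in> ?T" "r (p v l) \<in> ?T" by blast+
      then show "c' (p u l) (p v l) \<otimes> c (r (p v l)) v = c (r (p u l)) u \<otimes> c u v"
        using A(2) unfolding cocycle_on_def c'_def by simp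
    qed
    show "(\<lambda>S. c (r (p S l)) S) \<in> topspace X \<rightarrow> carrier K"
    proof
      fix S assume S: "S \<in> topspace X"
      then obtain U where "S \<in> U" "cocycle_on K c (r ` (\<lambda>S. p S l) ` U \<union> {S \<in> topspace X. p S l \<in> (\<lambda>S. p S l) ` U}) \<and> True"
        using small_setsE[OF sm S] by blast
      then show "c (r (p S l)) S \<in> carrier K" using S unfolding cocycle_on_def by blast
    qed
  qed
  then show thesis using that[OF lr(1) c'] unfolding cohomologous_def by blast
qed

text \<open>The coboundary \<open>b\<close> on \<open>X\<close> is evaluated at \<open>r z\<close>.
  Its value belongs over the point \<open>p (r z) M\<close> instead of the image of \<open>z\<close>
  in stage \<open>M\<close>; these points are close, and the two cocycles transport the value from
  one to the other, as in the definition of \<open>d\<close>.\<close>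

lemma cohomologous_at_stage:
  fixes K (structure)
  assumes "group K" and c: "cocycle (\<Gamma> M) K c" "cocycle (\<Gamma> M) K c'"
    and coh: "cohomologous X K (\<lambda>S S'. c (p S M) (p S' M)) (\<lambda>S S'. c' (p S M) (p S' M))"
  obtains l where "N \<le> l" "M \<le> l"
    "cohomologous (\<Gamma> l) K (\<lambda>z z'. c (bond \<sigma> M l z) (bond \<sigma> M l z')) (\<lambda>z z'. c' (bond \<sigma> M l z) (bond \<sigma> M l z'))"
proof -
  interpret group K by fact
  obtain b where b: "cohomologous_by X K b (\<lambda>S S'. c (p S M) (p S' M)) (\<lambda>S S'. c' (p S M) (p S' M))"
    using coh unfolding cohomologous_def by blast
  have bc: "b S \<in> carrier K" if "S \<in> topspace X" for S using b that unfolding cohomologous_by_def by blast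
  obtain l r where lr: "N \<le> l" "M \<le> l" "\<And>z. z \<in> topspace (\<Gamma> l) \<Longrightarrow> r z \<in> topspace X"
    "small_sets (\<Gamma> l) (\<lambda>A. (\<forall>u\<in>r ` A \<union> {S \<in> topspace X. p S l \<in> A}. \<forall>v\<in>r ` A \<union> {S \<in> topspace X. p S l \<in> A}.
        c (p u M) (p v M) \<otimes> b v = b u \<otimes> c' (p u M) (p v M)) \<and>
      (cocycle_on K c (bond \<sigma> M l ` A \<union> (\<lambda>z. p (r z) M) ` A) \<and> cocycle_on K c' (bond \<sigma> M l ` A \<union> (\<lambda>z. p (r z) M) ` A)))"
    by (rule approximate_section[OF b[unfolded cohomologous_by_def, THEN conjunct2]
          small_sets_conj[OF c[unfolded cocycle_def]], of N]) (rule that)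
  let ?\<beta> = "bond \<sigma> M l"
  define d where "d z = c (?\<beta> z) (p (r z) M) \<otimes> b (r z) \<otimes> c' (p (r z) M) (?\<beta> z)" for z
  have "cohomologous_by (\<Gamma> l) K d (\<lambda>z z'. c (?\<beta> z) (?\<beta> z')) (\<lambda>z z'. c' (?\<beta> z) (?\<beta> z'))"
    unfolding cohomologous_by_def
  proof
    show "d \<in> topspace (\<Gamma> l) \<rightarrow> carrier K"
    proof
      fix z assume z: "z \<in> topspace (\<Gamma> l)"
      obtain U where U: "z \<in> U" "cocycle_on K c (?\<beta> ` U \<union> (\<lambda>z. p (r z) M) ` U)" "cocycle_on K c' (?\<beta> ` U \<union> (\<lambda>z. p (r z) M) ` U)"
        using small_setsE[OF lr(4) z] by metis
      then have "c (?\<beta> z) (p (r z) M) \<in> carrier K" "c' (p (r z) M) (?\<beta> z) \<in> carrier K"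
        unfolding cocycle_on_def by blast+
      then show "d z \<in> carrier K" unfolding d_def using bc lr(3) z by simp
    qed
    show "small_sets (\<Gamma> l) (\<lambda>A. \<forall>u\<in>A. \<forall>v\<in>A. c (?\<beta> u) (?\<beta> v) \<otimes> d v = d u \<otimes> c' (?\<beta> u) (?\<beta> v))"
    proof (rule small_sets_mono[OF lr(4)], intro ballI, elim conjE)
      fix A u v
      let ?T = "?\<beta> ` A \<union> (\<lambda>z. p (r z) M) ` A"
      assume A: "A \<subseteq> topspace (\<Gamma> l)" and uv: "u \<in> A" "v \<in> A"
        and eq: "\<forall>u\<in>r ` A \<union> {S \<in> topspace X. p S l \<in> A}. \<forall>v\<in>r ` A \<union> {S \<in> topspace X. p S l \<in> A}.
          c (p u M) (p v M) \<otimes> b v = b u \<otimes> c' (p u M) (p v M)"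
        and co: "cocycle_on K c ?T" "cocycle_on K c' ?T"
      define s t where "s = p (r u) M" and "t = p (r v) M"
      have T: "?\<beta> u \<in> ?T" "?\<beta> v \<in> ?T" "s \<in> ?T" "t \<in> ?T" using uv unfolding s_def t_def by blast+
      have C: "c w w' \<in> carrier K" "c' w w' \<in> carrier K" if "w \<in> ?T" "w' \<in> ?T" for w w'
        using co that unfolding cocycle_on_def by blast+
      have E: "c w w' \<otimes> c w' w'' = c w w''" "c' w w' \<otimes> c' w' w'' = c' w w''"
        if "w \<in> ?T" "w' \<in> ?T" "w'' \<in> ?T" for w w' w''
        using co that unfolding cocycle_on_def by blast+
      have B: "b (r u) \<in> carrier K" "b (r v) \<in> carrier K" using bc lr(3) A uv by blast+
      have eq': "c s t \<otimes> b (r v) = b (r u) \<otimes> c' s t" using eq uv unfolding s_def t_def by blast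
      have "c (?\<beta> u) (?\<beta> v) \<otimes> d v = c (?\<beta> u) (?\<beta> v) \<otimes> c (?\<beta> v) t \<otimes> b (r v) \<otimes> c' t (?\<beta> v)"
        unfolding d_def t_def[symmetric] using C T B by (simp add: m_assoc)
      also have "c (?\<beta> u) (?\<beta> v) \<otimes> c (?\<beta> v) t = c (?\<beta> u) s \<otimes> c s t" using E T by simp
      also have "c (?\<beta> u) s \<otimes> c s t \<otimes> b (r v) = c (?\<beta> u) s \<otimes> b (r u) \<otimes> c' s t"
        using C T B eq' by (simp add: m_assoc)
      also have "c (?\<beta> u) s \<otimes> b (r u) \<otimes> c' s t \<otimes> c' t (?\<beta> v) = c (?\<beta> u) s \<otimes> b (r u) \<otimes> (c' s (?\<beta> u) \<otimes> c' (?\<beta> u) (?\<beta> v))"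
        using C T B E by (simp add: m_assoc)
      also have "\<dots> = d u \<otimes> c' (?\<beta> u) (?\<beta> v)"
        unfolding d_def s_def[symmetric] using C T B by (simp add: m_assoc)
      finally show "c (?\<beta> u) (?\<beta> v) \<otimes> d v = d u \<otimes> c' (?\<beta> u) (?\<beta> v)" .
    qed
  qed
  then show thesis using that[OF lr(1,2)] unfolding cohomologous_def by blast
qed

end

section \<open>Fundamental groups of the stages\<close>

locale CW_inverse_limit = compact_inverse_limit X \<Gamma> \<sigma> p
  for X :: "'x topology" and \<Gamma> :: "nat \<Rightarrow> 'b topology" and \<sigma> p +
  fixes x :: "nat \<Rightarrow> 'b" and \<kappa> :: "nat \<Rightarrow> 'b \<Rightarrow> 'b \<Rightarrow> (real \<Rightarrow> 'b) set"
  assumes base: "\<And>n. x n \<in> topspace (\<Gamma> n)" "\<And>n. \<sigma> (Suc n) (x (Suc n)) = x n"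
    and lpc: "\<And>n. locally_path_connected_space (\<Gamma> n)"
    and univ: "\<And>n. universal_cocycle (\<Gamma> n) (x n) (\<kappa> n)"
begin

abbreviation "\<pi> n \<equiv> fundamental_group (\<Gamma> n) (x n)"

abbreviation "\<beta> n m \<equiv> induced_fundamental (\<Gamma> n) (x n) (bond \<sigma> n m)"

text \<open>The bridge between presentations: composing it with a homomorphism \<open>\<phi>\<close>
  out of \<open>\<pi> n\<close> turns \<open>\<phi>\<close> into a cocycle on \<open>X\<close>,
  where it can be compared with homomorphisms coming from another sequence.\<close>

definition stage_cocycle :: "nat \<Rightarrow> 'x \<Rightarrow> 'x \<Rightarrow> (real \<Rightarrow> 'b) set" where
  "stage_cocycle n = (\<lambda>S S'. \<kappa> n (p S n) (p S' n))"

lemma group_\<pi>: "group (\<pi> n)"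
  by (rule group_fundamental_group[OF base(1)])

lemma bond_base: "n \<le> m \<Longrightarrow> bond \<sigma> n m (x m) = x n"
  by (rule bond_thread[where z = x and f = \<sigma>, OF base(2)])

lemma continuous_bond: "n \<le> m \<Longrightarrow> continuous_map (\<Gamma> m) (\<Gamma> n) (bond \<sigma> n m)"
  by (rule continuous_map_bond[where X = \<Gamma>, OF cont])

lemma \<beta>_hom: "n \<le> m \<Longrightarrow> \<beta> n m \<in> hom (\<pi> m) (\<pi> n)"
  by (rule induced_fundamental_hom[OF continuous_bond bond_base])

lemma \<beta>_\<beta>: "n \<le> m \<Longrightarrow> m \<le> k \<Longrightarrow> A \<in> carrier (\<pi> k) \<Longrightarrow> \<beta> n m (\<beta> m k A) = \<beta> n k A"
proof -
  assume nmk: "n \<le> m" "m \<le> k" and A: "A \<in> carrier (\<pi> k)"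
  have "bond \<sigma> n m \<circ> bond \<sigma> m k = bond \<sigma> n k" using bond_bond[OF nmk, of \<sigma>] by auto
  then show "\<beta> n m (\<beta> m k A) = \<beta> n k A"
    using induced_fundamental_comp[OF continuous_bond[OF nmk(2)] continuous_bond[OF nmk(1)] bond_base[OF nmk(2)] bond_base[OF nmk(1)] A]
    by simp
qed

lemma cocycle_\<kappa>: "cocycle (\<Gamma> n) (\<pi> n) (\<kappa> n)"
  by (rule cocycle_universal_cocycle[OF univ base(1)])

lemma cocycle_stage: "cocycle X (\<pi> n) (stage_cocycle n)"
  unfolding stage_cocycle_def by (rule cocycle_pullback[OF continuous_map_proj cocycle_\<kappa>])

lemma small_\<kappa>_closed:
  "small_sets (\<Gamma> n) (\<lambda>A. \<forall>u\<in>A. \<forall>v\<in>A. \<kappa> n u v \<in> carrier (\<pi> n))"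
  using cocycle_\<kappa>[of n] unfolding cocycle_def by (rule small_sets_mono) (auto simp: cocycle_on_def)

text \<open>After descent to a stage, the cocycle is cohomologous to the universal cocycle of that
  stage composed with its own monodromy; this monodromy is \<open>\<phi>\<close>.\<close>

lemma stage_hom_exists:
  assumes "group K" "cocycle X K c"
  obtains m \<phi> where "N \<le> m" "\<phi> \<in> hom (\<pi> m) K" "cohomologous X K (\<lambda>S S'. \<phi> (stage_cocycle m S S')) c"
proof -
  obtain m c' where m: "N \<le> m" "cocycle (\<Gamma> m) K c'" "cohomologous X K (\<lambda>S S'. c' (p S m) (p S' m)) c"
    by (rule cocycle_from_stage[OF assms]) (rule that)
  let ?\<phi> = "monodromy K c'"
  have \<phi>: "?\<phi> \<in> hom (\<pi> m) K" by (rule monodromy_hom[OF assms(1) m(2)])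
  have "cohomologous (\<Gamma> m) K (\<lambda>u v. ?\<phi> (\<kappa> m u v)) c'"
    by (rule cohomologous_universal_cocycle[OF univ base(1) assms(1) m(2) lpc])
  from cohomologous_pullback[OF continuous_map_proj this]
  have "cohomologous X K (\<lambda>S S'. ?\<phi> (stage_cocycle m S S')) (\<lambda>S S'. c' (p S m) (p S' m))"
    unfolding stage_cocycle_def .
  then have "cohomologous X K (\<lambda>S S'. ?\<phi> (stage_cocycle m S S')) c"
    by (rule cohomologous_trans[OF assms(1) cocycle_hom[OF \<phi> cocycle_stage]
          cocycle_pullback[OF continuous_map_proj m(2)] assms(2) _ m(3)])
  then show thesis using that m(1) \<phi> by blast
qed

text \<open>A cohomology on \<open>X\<close> becomes one on a later stage \<open>k\<close>, where
  its coboundary conjugates holonomies along loops by its value \<open>g\<close> at the base point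
  \<open>x k\<close>. The holonomies themselves are the values of \<open>\<phi>\<close> and
  \<open>\<psi>\<close> on the image of the loop.\<close>

lemma conjugate_at_stage:
  fixes K (structure)
  assumes "group K" and \<phi>: "\<phi> \<in> hom (\<pi> m) K" and \<psi>: "\<psi> \<in> hom (\<pi> m) K"
    and coh: "cohomologous X K (\<lambda>S S'. \<phi> (stage_cocycle m S S')) (\<lambda>S S'. \<psi> (stage_cocycle m S S'))"
  obtains k g where "N \<le> k" "m \<le> k" "g \<in> carrier K"
    "\<And>A. A \<in> carrier (\<pi> k) \<Longrightarrow> \<phi> (\<beta> m k A) = g \<otimes> \<psi> (\<beta> m k A) \<otimes> inv g"
proof -
  interpret K: group K by fact
  let ?c = "\<lambda>u v. \<phi> (\<kappa> m u v)" and ?c' = "\<lambda>u v. \<psi> (\<kappa> m u v)"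
  have c: "cocycle (\<Gamma> m) K ?c" "cocycle (\<Gamma> m) K ?c'" using cocycle_hom[OF \<phi> cocycle_\<kappa>] cocycle_hom[OF \<psi> cocycle_\<kappa>] .
  obtain k where k: "N \<le> k" "m \<le> k"
    "cohomologous (\<Gamma> k) K (\<lambda>z z'. ?c (bond \<sigma> m k z) (bond \<sigma> m k z')) (\<lambda>z z'. ?c' (bond \<sigma> m k z) (bond \<sigma> m k z'))"
    by (rule cohomologous_at_stage[OF assms(1) c coh[unfolded stage_cocycle_def], of N]) (rule that)
  let ?b = "bond \<sigma> m k"
  obtain b where b: "cohomologous_by (\<Gamma> k) K b (\<lambda>z z'. ?c (?b z) (?b z')) (\<lambda>z z'. ?c' (?b z) (?b z'))"
    using k(3) unfolding cohomologous_def by blast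
  define g where "g = b (x k)"
  have g: "g \<in> carrier K" using b base(1) unfolding cohomologous_by_def g_def by blast
  have "\<phi> (\<beta> m k A) = g \<otimes> \<psi> (\<beta> m k A) \<otimes> inv g" if A: "A \<in> carrier (\<pi> k)" for A
  proof -
    obtain q where q: "q \<in> loops (\<Gamma> k) (x k)" "A = path_class (\<Gamma> k) q" using A unfolding fundamental_carrier by blast
    have bq: "?b \<circ> q \<in> loops (\<Gamma> m) (x m)" using loops_image[OF continuous_bond[OF k(2)] q(1)] bond_base[OF k(2)] by simp
    have \<beta>A: "\<beta> m k A = path_class (\<Gamma> m) (?b \<circ> q)"
      unfolding q(2) by (rule induced_fundamental_class[OF continuous_bond[OF k(2)] q(1) bond_base[OF k(2)]])
    have hol: "holonomy K (\<lambda>z z'. \<theta> (\<kappa> m (?b z) (?b z'))) q = \<theta> (\<beta> m k A)" if "\<theta> \<in> hom (\<pi> m) K" for \<theta>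
    proof -
      have "holonomy K (\<lambda>z z'. \<theta> (\<kappa> m (?b z) (?b z'))) q = holonomy K (\<lambda>u v. \<theta> (\<kappa> m u v)) (?b \<circ> q)"
        unfolding holonomy_def by simp
      also have "\<dots> = \<theta> (holonomy (\<pi> m) (\<kappa> m) (?b \<circ> q))"
        by (rule holonomy_hom[OF group_\<pi> assms(1) that cocycle_\<kappa> loopsD(1)[OF bq]])
      also have "holonomy (\<pi> m) (\<kappa> m) (?b \<circ> q) = \<beta> m k A"
        unfolding \<beta>A by (rule holonomy_universal_cocycle[OF univ base(1) bq])
      finally show ?thesis .
    qed
    have "\<psi> (\<beta> m k A) = inv g \<otimes> \<phi> (\<beta> m k A) \<otimes> g"
      using holonomy_cohomologous[OF assms(1) cocycle_pullback[OF continuous_bond[OF k(2)] c(1)]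
          cocycle_pullback[OF continuous_bond[OF k(2)] c(2)] b loopsD(1)[OF q(1)]] loopsD[OF q(1)]
      unfolding hol[OF \<phi>] hol[OF \<psi>] g_def by simp
    moreover have "\<phi> (\<beta> m k A) \<in> carrier K" using \<phi> \<beta>_hom[OF k(2)] A by (meson hom_in_carrier)
    ultimately show ?thesis using g by (simp add: K.m_assoc[symmetric]) (simp add: K.m_assoc)
  qed
  then show thesis using that[OF k(1,2) g] by blast
qed

text \<open>The universal cocycles of different stages use unrelated paths to the base points, so
  they match only up to a coboundary. The pullback of \<open>\<kappa> m\<close> to stage
  \<open>k\<close> has monodromy \<open>\<beta> m k\<close>, and universality at stage
  \<open>k\<close> applies.\<close>

lemma stage_bond:
  assumes "m \<le> k"
  shows "cohomologous X (\<pi> m) (\<lambda>S S'. \<beta> m k (stage_cocycle k S S')) (stage_cocycle m)"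
proof -
  let ?b = "bond \<sigma> m k"
  let ?c = "\<lambda>z z'. \<kappa> m (?b z) (?b z')"
  have c: "cocycle (\<Gamma> k) (\<pi> m) ?c" by (rule cocycle_pullback[OF continuous_bond[OF assms] cocycle_\<kappa>])
  have mono: "monodromy (\<pi> m) ?c A = \<beta> m k A" if A: "A \<in> carrier (\<pi> k)" for A
  proof -
    obtain q where q: "q \<in> loops (\<Gamma> k) (x k)" "A = path_class (\<Gamma> k) q" using A unfolding fundamental_carrier by blast
    have bq: "?b \<circ> q \<in> loops (\<Gamma> m) (x m)" using loops_image[OF continuous_bond[OF assms] q(1)] bond_base[OF assms] by simp
    have "monodromy (\<pi> m) ?c A = holonomy (\<pi> m) ?c q"
      unfolding q(2) by (rule monodromy_class[OF group_\<pi> c loopsD(1)[OF q(1)]])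
    also have "\<dots> = holonomy (\<pi> m) (\<kappa> m) (?b \<circ> q)" unfolding holonomy_def by simp
    also have "\<dots> = path_class (\<Gamma> m) (?b \<circ> q)" by (rule holonomy_universal_cocycle[OF univ base(1) bq])
    also have "\<dots> = \<beta> m k A"
      unfolding q(2) by (rule induced_fundamental_class[OF continuous_bond[OF assms] q(1) bond_base[OF assms], symmetric])
    finally show ?thesis .
  qed
  have "cohomologous (\<Gamma> k) (\<pi> m) (\<lambda>z z'. monodromy (\<pi> m) ?c (\<kappa> k z z')) ?c"
    by (rule cohomologous_universal_cocycle[OF univ base(1) group_\<pi> c lpc])
  moreover have "cohomologous (\<Gamma> k) (\<pi> m) (\<lambda>z z'. \<beta> m k (\<kappa> k z z')) (\<lambda>z z'. monodromy (\<pi> m) ?c (\<kappa> k z z'))"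
    by (rule cohomologous_eqI[OF group_\<pi>], rule small_sets_mono[OF small_\<kappa>_closed[of k]])
       (auto simp: mono intro: hom_in_carrier[OF \<beta>_hom[OF assms]])
  ultimately have "cohomologous (\<Gamma> k) (\<pi> m) (\<lambda>z z'. \<beta> m k (\<kappa> k z z')) ?c"
    by (intro cohomologous_trans[OF group_\<pi> cocycle_hom[OF \<beta>_hom[OF assms] cocycle_\<kappa>]
          cocycle_hom[OF monodromy_hom[OF group_\<pi> c] cocycle_\<kappa>] c])
  from cohomologous_pullback[OF continuous_map_proj this]
  have "cohomologous X (\<pi> m) (\<lambda>S S'. \<beta> m k (stage_cocycle k S S')) (\<lambda>S S'. \<kappa> m (?b (p S k)) (?b (p S' k)))"
    unfolding stage_cocycle_def .
  moreover have "cohomologous X (\<pi> m) (\<lambda>S S'. \<kappa> m (?b (p S k)) (?b (p S' k))) (stage_cocycle m)"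
  proof (rule cohomologous_eqI[OF group_\<pi>])
    show "small_sets X (\<lambda>A. \<forall>u\<in>A. \<forall>v\<in>A. \<kappa> m (?b (p u k)) (?b (p v k)) \<in> carrier (\<pi> m) \<and>
        \<kappa> m (?b (p u k)) (?b (p v k)) = stage_cocycle m u v)"
      by (rule small_sets_mono[OF cocycle_stage[of m, unfolded cocycle_def]])
         (auto simp: cocycle_on_def stage_cocycle_def bond_p[OF _ assms] subset_iff)
  qed
  ultimately show ?thesis
    by (intro cohomologous_trans[OF group_\<pi> cocycle_hom[OF \<beta>_hom[OF assms] cocycle_stage]
          cocycle_pullback[OF continuous_map_proj c] cocycle_stage])
qed

end

text \<open>Descending the stage cocycle \<open>n\<close> of the second sequence gives
  \<open>\<phi>0\<close>. Its composite with \<open>\<psi>\<close> and the bonding homomorphism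
  define cohomologous cocycles on \<open>X\<close>, hence are conjugate after restriction to a later
  stage. The resulting \<open>\<phi>\<close> satisfies what is assumed of \<open>\<psi>\<close> with
  the sequences exchanged, so the step can be repeated.\<close>

lemma zigzag_step:
  assumes L: "CW_inverse_limit X \<Gamma> \<sigma> p x \<kappa>" and L': "CW_inverse_limit X \<Gamma>' \<sigma>' p' x' \<kappa>'"
    and \<psi>: "\<psi> \<in> hom (fundamental_group (\<Gamma>' n) (x' n)) (fundamental_group (\<Gamma> j) (x j))"
    and coh: "cohomologous X (fundamental_group (\<Gamma> j) (x j))
      (\<lambda>S S'. \<psi> (CW_inverse_limit.stage_cocycle p' \<kappa>' n S S')) (CW_inverse_limit.stage_cocycle p \<kappa> j)"
  obtains k \<phi> g where "N \<le> k" "j \<le> k" "\<phi> \<in> hom (fundamental_group (\<Gamma> k) (x k)) (fundamental_group (\<Gamma>' n) (x' n))"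
    "cohomologous X (fundamental_group (\<Gamma>' n) (x' n))
      (\<lambda>S S'. \<phi> (CW_inverse_limit.stage_cocycle p \<kappa> k S S')) (CW_inverse_limit.stage_cocycle p' \<kappa>' n)"
    "g \<in> carrier (fundamental_group (\<Gamma> j) (x j))"
    "\<And>A. A \<in> carrier (fundamental_group (\<Gamma> k) (x k)) \<Longrightarrow> \<psi> (\<phi> A) =
      g \<otimes>\<^bsub>fundamental_group (\<Gamma> j) (x j)\<^esub> induced_fundamental (\<Gamma> j) (x j) (bond \<sigma> j k) A
        \<otimes>\<^bsub>fundamental_group (\<Gamma> j) (x j)\<^esub> inv\<^bsub>fundamental_group (\<Gamma> j) (x j)\<^esub> g"
proof -
  interpret L: CW_inverse_limit X \<Gamma> \<sigma> p x \<kappa> by fact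
  interpret L': CW_inverse_limit X \<Gamma>' \<sigma>' p' x' \<kappa>' by fact
  obtain m \<phi>0 where m: "max N j \<le> m" "\<phi>0 \<in> hom (L.\<pi> m) (L'.\<pi> n)"
    "cohomologous X (L'.\<pi> n) (\<lambda>S S'. \<phi>0 (L.stage_cocycle m S S')) (L'.stage_cocycle n)"
    by (rule L.stage_hom_exists[OF L'.group_\<pi> L'.cocycle_stage]) (rule that)
  have jm: "j \<le> m" using m(1) by simp
  have \<psi>\<phi>: "\<psi> \<circ> \<phi>0 \<in> hom (L.\<pi> m) (L.\<pi> j)" using hom_compose[OF m(2) \<psi>] by (simp add: compose_def)
  have 1: "cohomologous X (L.\<pi> j) (\<lambda>S S'. \<psi> (\<phi>0 (L.stage_cocycle m S S'))) (\<lambda>S S'. \<psi> (L'.stage_cocycle n S S'))"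
    by (rule cohomologous_hom[OF \<psi> cocycle_hom[OF m(2) L.cocycle_stage] L'.cocycle_stage m(3)])
  have "cohomologous X (L.\<pi> j) (\<lambda>S S'. \<psi> (\<phi>0 (L.stage_cocycle m S S'))) (L.stage_cocycle j)"
    by (rule cohomologous_trans[OF L.group_\<pi> _ _ L.cocycle_stage 1 coh])
       (use cocycle_hom[OF \<psi>\<phi> L.cocycle_stage] cocycle_hom[OF \<psi> L'.cocycle_stage] in \<open>simp_all add: comp_def\<close>)
  moreover have "cohomologous X (L.\<pi> j) (L.stage_cocycle j) (\<lambda>S S'. L.\<beta> j m (L.stage_cocycle m S S'))"
    by (rule cohomologous_sym[OF L.group_\<pi> cocycle_hom[OF L.\<beta>_hom[OF jm] L.cocycle_stage] L.cocycle_stage L.stage_bond[OF jm]])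
  ultimately have "cohomologous X (L.\<pi> j) (\<lambda>S S'. (\<psi> \<circ> \<phi>0) (L.stage_cocycle m S S')) (\<lambda>S S'. L.\<beta> j m (L.stage_cocycle m S S'))"
    unfolding comp_def
    by (rule cohomologous_trans[OF L.group_\<pi> cocycle_hom[OF \<psi>\<phi> L.cocycle_stage, unfolded comp_def] L.cocycle_stage
          cocycle_hom[OF L.\<beta>_hom[OF jm] L.cocycle_stage]])
  then obtain k g where k: "N \<le> k" "m \<le> k" "g \<in> carrier (L.\<pi> j)"
    "\<And>A. A \<in> carrier (L.\<pi> k) \<Longrightarrow> (\<psi> \<circ> \<phi>0) (L.\<beta> m k A) = g \<otimes>\<^bsub>L.\<pi> j\<^esub> L.\<beta> j m (L.\<beta> m k A) \<otimes>\<^bsub>L.\<pi> j\<^esub> inv\<^bsub>L.\<pi> j\<^esub> g"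
    by (rule L.conjugate_at_stage[OF L.group_\<pi> \<psi>\<phi> L.\<beta>_hom[OF jm], where N = N]) (rule that)
  let ?\<phi> = "\<phi>0 \<circ> L.\<beta> m k"
  have \<phi>: "?\<phi> \<in> hom (L.\<pi> k) (L'.\<pi> n)" using hom_compose[OF L.\<beta>_hom[OF k(2)] m(2)] by (simp add: compose_def)
  have "cohomologous X (L'.\<pi> n) (\<lambda>S S'. ?\<phi> (L.stage_cocycle k S S')) (\<lambda>S S'. \<phi>0 (L.stage_cocycle m S S'))"
    using cohomologous_hom[OF m(2) cocycle_hom[OF L.\<beta>_hom[OF k(2)] L.cocycle_stage] L.cocycle_stage L.stage_bond[OF k(2)]]
    by (simp add: comp_def)
  then have "cohomologous X (L'.\<pi> n) (\<lambda>S S'. ?\<phi> (L.stage_cocycle k S S')) (L'.stage_cocycle n)"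
    by (rule cohomologous_trans[OF L'.group_\<pi> cocycle_hom[OF \<phi> L.cocycle_stage]
          cocycle_hom[OF m(2) L.cocycle_stage] L'.cocycle_stage _ m(3)])
  moreover have "\<psi> (?\<phi> A) = g \<otimes>\<^bsub>L.\<pi> j\<^esub> L.\<beta> j k A \<otimes>\<^bsub>L.\<pi> j\<^esub> inv\<^bsub>L.\<pi> j\<^esub> g" if "A \<in> carrier (L.\<pi> k)" for A
    using k(4)[OF that] L.\<beta>_\<beta>[OF jm k(2) that] by simp
  ultimately show thesis using that[OF k(1) _ \<phi> _ k(3)] jm k(2) by simp
qed

section \<open>Profinite completion\<close>

context
  fixes G :: "'a monoid" (structure)
  assumes "group G"
begin

interpretation group G by fact

section \<open>Coset arithmetic and the group structure of the completion\<close>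

lemma finite_index_normalD:
  assumes "N \<in> finite_index_normal G"
  shows "N \<lhd> G" "subgroup N G" "N \<subseteq> carrier G" "finite (rcosets N)"
  using assms normal_imp_subgroup subgroup.subset unfolding finite_index_normal_def by blast+

lemma coset_eq_iff:
  assumes "subgroup N G" "g \<in> carrier G" "h \<in> carrier G"
  shows "N #> g = N #> h \<longleftrightarrow> g \<otimes> inv h \<in> N"
  using assms repr_independence repr_independenceD subgroup.rcos_module[OF assms(1) group_axioms assms(3,2)] by metis

lemma carrier_Mod: "carrier (G Mod N) = (\<lambda>g. N #> g) ` carrier G"
  unfolding FactGroup_def RCOSETS_def by auto

lemma mult_Mod:
  "N \<lhd> G \<Longrightarrow> g \<in> carrier G \<Longrightarrow> h \<in> carrier G \<Longrightarrow> (N #> g) \<otimes>\<^bsub>G Mod N\<^esub> (N #> h) = N #> (g \<otimes> h)"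
  unfolding FactGroup_def by (simp add: normal.rcos_sum)

lemma one_Mod: "\<one>\<^bsub>G Mod N\<^esub> = N"
  unfolding FactGroup_def by simp

lemma inv_Mod:
  assumes "N \<lhd> G" "g \<in> carrier G" shows "inv\<^bsub>G Mod N\<^esub> (N #> g) = N #> inv g"
proof -
  interpret Q: group "G Mod N" by (rule normal.factorgroup_is_group[OF assms(1)])
  have "(N #> inv g) \<otimes>\<^bsub>G Mod N\<^esub> (N #> g) = \<one>\<^bsub>G Mod N\<^esub>"
    using mult_Mod[OF assms(1), of "inv g" g] assms(2) coset_mult_one[OF subgroup.subset[OF normal_imp_subgroup[OF assms(1)]]]
    unfolding one_Mod by simp
  then show ?thesis using assms by (intro Q.inv_equality) (auto simp: carrier_Mod)
qed

lemma subgroup_mult_coset: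
  assumes "subgroup N G" "subgroup M G" "N \<subseteq> M" "g \<in> carrier G"
  shows "M <#> (N #> g) = M #> g"
proof
  have MG: "M \<subseteq> carrier G" "N \<subseteq> carrier G" using assms subgroup.subset by auto
  show "M <#> (N #> g) \<subseteq> M #> g"
  proof
    fix x assume "x \<in> M <#> (N #> g)"
    then obtain m n where mn: "m \<in> M" "n \<in> N" "x = m \<otimes> (n \<otimes> g)" unfolding set_mult_def r_coset_def by blast
    then have "x = (m \<otimes> n) \<otimes> g" using MG assms(4) by (simp add: m_assoc subset_iff)
    moreover have "m \<otimes> n \<in> M" using subgroup.m_closed[OF assms(2) mn(1)] mn(2) assms(3) by blast
    ultimately show "x \<in> M #> g" unfolding r_coset_def by blast
  qed
  show "M #> g \<subseteq> M <#> (N #> g)"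
  proof
    fix x assume "x \<in> M #> g"
    then obtain m where m: "m \<in> M" "x = m \<otimes> g" unfolding r_coset_def by blast
    moreover have "g \<in> N #> g" by (rule rcos_self[OF assms(4,1)])
    ultimately show "x \<in> M <#> (N #> g)" unfolding set_mult_def by blast
  qed
qed

text \<open>\<open>C\<close> will be the image of a coset under a homomorphism that need not be
  surjective; such an image is only part of a coset, and multiplication by \<open>N\<close> fills it
  up.\<close>

lemma coset_mult_coset_image:
  assumes "N \<lhd> G" "C \<subseteq> N #> g" "g \<in> C" "g \<in> carrier G"
  shows "N <#> C = N #> g"
proof
  have N: "subgroup N G" "N \<subseteq> carrier G" using assms normal_imp_subgroup subgroup.subset by blast+
  have "N <#> C \<subseteq> N <#> (N #> g)" using assms(2) unfolding set_mult_def by blast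
  also have "\<dots> = N #> g" using subgroup_mult_coset[OF N(1) N(1) _ assms(4)] by simp
  finally show "N <#> C \<subseteq> N #> g" .
  show "N #> g \<subseteq> N <#> C" using assms(3) unfolding set_mult_def r_coset_def by blast
qed

lemma profinite_carrier_value:
  assumes "u \<in> carrier (profinite_completion G)" "N \<in> finite_index_normal G"
  obtains g where "g \<in> carrier G" "u N = N #> g"
proof -
  have "u N \<in> carrier (G Mod N)" using assms unfolding profinite_completion_def by auto
  then show thesis using that unfolding carrier_Mod by blast
qed

lemma profinite_carrier_compat:
  assumes "u \<in> carrier (profinite_completion G)" "N \<in> finite_index_normal G" "M \<in> finite_index_normal G" "N \<subseteq> M"
    "g \<in> carrier G" "u N = N #> g"
  shows "u M = M #> g"
proof -
  have "M <#> u N = u M" using assms(1-4) unfolding profinite_completion_def by simp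
  then show ?thesis using subgroup_mult_coset[of N M g] finite_index_normalD assms by simp
qed

text \<open>One representative that serves \<open>N\<close> and every larger \<open>M\<close> yields
  membership in the factors and compatibility at the same time.\<close>

lemma profinite_carrierI:
  assumes "u \<in> extensional (finite_index_normal G)"
    and "\<And>N. N \<in> finite_index_normal G \<Longrightarrow> \<exists>g\<in>carrier G. u N = N #> g \<and>
      (\<forall>M\<in>finite_index_normal G. N \<subseteq> M \<longrightarrow> u M = M #> g)"
  shows "u \<in> carrier (profinite_completion G)"
proof -
  have "u N \<in> carrier (G Mod N)" if "N \<in> finite_index_normal G" for N
    using assms(2)[OF that] unfolding carrier_Mod by blast
  moreover have "M <#> u N = u M" if NM: "N \<in> finite_index_normal G" "M \<in> finite_index_normal G" "N \<subseteq> M" for N M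
  proof -
    obtain g where g: "g \<in> carrier G" "u N = N #> g" "u M = M #> g" using assms(2)[OF NM(1)] NM(2,3) by blast
    then show ?thesis using subgroup_mult_coset[of N M g] finite_index_normalD NM by simp
  qed
  ultimately show ?thesis using assms(1) unfolding profinite_completion_def by (auto simp: PiE_def)
qed

lemma profinite_eqI:
  assumes "u \<in> carrier (profinite_completion G)" "v \<in> carrier (profinite_completion G)"
    "\<And>N. N \<in> finite_index_normal G \<Longrightarrow> u N = v N"
  shows "u = v"
  using assms unfolding profinite_completion_def by (auto intro: PiE_ext)

lemma profinite_mult_value:
  assumes "N \<in> finite_index_normal G" "g \<in> carrier G" "h \<in> carrier G" "u N = N #> g" "v N = N #> h"
  shows "(u \<otimes>\<^bsub>profinite_completion G\<^esub> v) N = N #> (g \<otimes> h)"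
  using assms finite_index_normalD mult_Mod unfolding profinite_completion_def by simp

definition to_profinite :: "'a \<Rightarrow> 'a set \<Rightarrow> 'a set" where
  "to_profinite g = (\<lambda>N\<in>finite_index_normal G. N #> g)"

lemma to_profinite_closed: "g \<in> carrier G \<Longrightarrow> to_profinite g \<in> carrier (profinite_completion G)"
  by (rule profinite_carrierI) (auto simp: to_profinite_def)

lemma profinite_one: "\<one>\<^bsub>profinite_completion G\<^esub> = to_profinite \<one>"
  unfolding profinite_completion_def to_profinite_def
  by (auto simp: one_Mod restrict_def fun_eq_iff coset_mult_one finite_index_normalD)

lemma profinite_mult_closed:
  assumes u: "u \<in> carrier (profinite_completion G)" and v: "v \<in> carrier (profinite_completion G)"
  shows "u \<otimes>\<^bsub>profinite_completion G\<^esub> v \<in> carrier (profinite_completion G)"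
proof (rule profinite_carrierI)
  show "u \<otimes>\<^bsub>profinite_completion G\<^esub> v \<in> extensional (finite_index_normal G)"
    unfolding profinite_completion_def by simp
  fix N assume N: "N \<in> finite_index_normal G"
  obtain g where g: "g \<in> carrier G" "u N = N #> g" by (rule profinite_carrier_value[OF u N])
  obtain h where h: "h \<in> carrier G" "v N = N #> h" by (rule profinite_carrier_value[OF v N])
  show "\<exists>k\<in>carrier G. (u \<otimes>\<^bsub>profinite_completion G\<^esub> v) N = N #> k \<and>
      (\<forall>M\<in>finite_index_normal G. N \<subseteq> M \<longrightarrow> (u \<otimes>\<^bsub>profinite_completion G\<^esub> v) M = M #> k)"
  proof (intro bexI[of _ "g \<otimes> h"] conjI ballI impI)
    show "(u \<otimes>\<^bsub>profinite_completion G\<^esub> v) N = N #> (g \<otimes> h)" by (rule profinite_mult_value[where u = u and v = v, OF N g(1) h(1) g(2) h(2)])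
    fix M assume M: "M \<in> finite_index_normal G" "N \<subseteq> M"
    show "(u \<otimes>\<^bsub>profinite_completion G\<^esub> v) M = M #> (g \<otimes> h)"
      using profinite_carrier_compat[OF u N M g] profinite_carrier_compat[OF v N M h]
      by (intro profinite_mult_value[OF M(1) g(1) h(1)])
  qed (use g h in simp)
qed

lemma group_profinite_completion: "group (profinite_completion G)"
proof (rule groupI)
  let ?P = "profinite_completion G"
  show one: "\<one>\<^bsub>?P\<^esub> \<in> carrier ?P" unfolding profinite_one by (rule to_profinite_closed) simp
  have oneN: "\<one>\<^bsub>?P\<^esub> N = N #> \<one>" if "N \<in> finite_index_normal G" for N
    using that unfolding profinite_one to_profinite_def by simp
  fix u assume u: "u \<in> carrier ?P"
  show "\<one>\<^bsub>?P\<^esub> \<otimes>\<^bsub>?P\<^esub> u = u"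
  proof (rule profinite_eqI[OF profinite_mult_closed[OF one u] u])
    fix N assume N: "N \<in> finite_index_normal G"
    obtain g where g: "g \<in> carrier G" "u N = N #> g" by (rule profinite_carrier_value[OF u N])
    then show "(\<one>\<^bsub>?P\<^esub> \<otimes>\<^bsub>?P\<^esub> u) N = u N" using profinite_mult_value[where u = "\<one>\<^bsub>?P\<^esub>" and v = u, OF N one_closed g(1) oneN[OF N] g(2)] by simp
  qed
  define v where "v = (\<lambda>N\<in>finite_index_normal G. inv\<^bsub>G Mod N\<^esub> (u N))"
  have vN: "v N = N #> inv g" if "N \<in> finite_index_normal G" "g \<in> carrier G" "u N = N #> g" for N g
    using that finite_index_normalD inv_Mod unfolding v_def by simp
  have v: "v \<in> carrier ?P"
  proof (rule profinite_carrierI)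
    fix N assume N: "N \<in> finite_index_normal G"
    obtain g where g: "g \<in> carrier G" "u N = N #> g" by (rule profinite_carrier_value[OF u N])
    show "\<exists>k\<in>carrier G. v N = N #> k \<and> (\<forall>M\<in>finite_index_normal G. N \<subseteq> M \<longrightarrow> v M = M #> k)"
    proof (intro bexI[of _ "inv g"] conjI ballI impI)
      show "v N = N #> inv g" by (rule vN[OF N g])
      fix M assume M: "M \<in> finite_index_normal G" "N \<subseteq> M"
      show "v M = M #> inv g" by (rule vN[OF M(1) g(1) profinite_carrier_compat[OF u N M g]])
    qed (use g in simp)
  qed (simp add: v_def)
  have "v \<otimes>\<^bsub>?P\<^esub> u = \<one>\<^bsub>?P\<^esub>"
  proof (rule profinite_eqI[OF profinite_mult_closed[OF v u] one])
    fix N assume N: "N \<in> finite_index_normal G"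
    obtain g where g: "g \<in> carrier G" "u N = N #> g" by (rule profinite_carrier_value[OF u N])
    then show "(v \<otimes>\<^bsub>?P\<^esub> u) N = \<one>\<^bsub>?P\<^esub> N"
      using profinite_mult_value[where u = v and v = u, OF N inv_closed[OF g(1)] g(1) vN[OF N g] g(2)] oneN[OF N] by simp
  qed
  then show "\<exists>v\<in>carrier ?P. v \<otimes>\<^bsub>?P\<^esub> u = \<one>\<^bsub>?P\<^esub>" using v by blast
  fix v assume v: "v \<in> carrier ?P"
  show "u \<otimes>\<^bsub>?P\<^esub> v \<in> carrier ?P" by (rule profinite_mult_closed[OF u v])
  fix w assume w: "w \<in> carrier ?P"
  show "u \<otimes>\<^bsub>?P\<^esub> v \<otimes>\<^bsub>?P\<^esub> w = u \<otimes>\<^bsub>?P\<^esub> (v \<otimes>\<^bsub>?P\<^esub> w)"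
  proof (rule profinite_eqI)
    fix N assume N: "N \<in> finite_index_normal G"
    obtain g where g: "g \<in> carrier G" "u N = N #> g" by (rule profinite_carrier_value[OF u N])
    obtain h where h: "h \<in> carrier G" "v N = N #> h" by (rule profinite_carrier_value[OF v N])
    obtain k where k: "k \<in> carrier G" "w N = N #> k" by (rule profinite_carrier_value[OF w N])
    have "(u \<otimes>\<^bsub>?P\<^esub> v \<otimes>\<^bsub>?P\<^esub> w) N = N #> (g \<otimes> h \<otimes> k)"
      using profinite_mult_value[where u = u and v = v, OF N g(1) h(1) g(2) h(2)] by (intro profinite_mult_value[where v = w, OF N _ k(1) _ k(2)]) (use g h in auto)
    moreover have "(u \<otimes>\<^bsub>?P\<^esub> (v \<otimes>\<^bsub>?P\<^esub> w)) N = N #> (g \<otimes> (h \<otimes> k))"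
      using profinite_mult_value[where u = v and v = w, OF N h(1) k(1) h(2) k(2)] by (intro profinite_mult_value[where u = u, OF N g(1) _ g(2)]) (use h k in auto)
    ultimately show "(u \<otimes>\<^bsub>?P\<^esub> v \<otimes>\<^bsub>?P\<^esub> w) N = (u \<otimes>\<^bsub>?P\<^esub> (v \<otimes>\<^bsub>?P\<^esub> w)) N"
      using g h k by (simp add: m_assoc)
  qed (intro profinite_mult_closed u v w)+
qed

lemma profinite_inv_value:
  assumes u: "u \<in> carrier (profinite_completion G)" and N: "N \<in> finite_index_normal G"
    and g: "g \<in> carrier G" "u N = N #> g"
  shows "(inv\<^bsub>profinite_completion G\<^esub> u) N = N #> inv g"
proof -
  interpret P: group "profinite_completion G" by (rule group_profinite_completion)
  let ?v = "inv\<^bsub>profinite_completion G\<^esub> u"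
  obtain h where h: "h \<in> carrier G" "?v N = N #> h" by (rule profinite_carrier_value[OF P.inv_closed[OF u] N])
  have "N #> (h \<otimes> g) = (?v \<otimes>\<^bsub>profinite_completion G\<^esub> u) N"
    using profinite_mult_value[where u = ?v and v = u, OF N h(1) g(1) h(2) g(2)] by simp
  also have "\<dots> = N #> \<one>" using P.l_inv[OF u] N unfolding profinite_one to_profinite_def by simp
  finally have "h \<otimes> g \<otimes> inv \<one> \<in> N" using coset_eq_iff finite_index_normalD(2)[OF N] h g by (metis m_closed one_closed)
  then have "h \<otimes> inv (inv g) \<in> N" using h g by simp
  then have "N #> h = N #> inv g" using coset_eq_iff finite_index_normalD(2)[OF N] h g by simp
  then show ?thesis using h by simp
qed

text \<open>The completion is a closed subspace of a product of finite discrete spaces: each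
  compatibility condition equates two continuous maps into a discrete space.\<close>

lemma profinite_topology_facts:
  shows "topspace (profinite_topology G) = carrier (profinite_completion G)"
    and "compact_space (profinite_topology G)" and "Hausdorff_space (profinite_topology G)"
    and "\<And>N. N \<in> finite_index_normal G \<Longrightarrow>
      continuous_map (profinite_topology G) (discrete_topology (carrier (G Mod N))) (\<lambda>u. u N)"
proof -
  let ?X = "\<lambda>N. discrete_topology (carrier (G Mod N))" and ?F = "finite_index_normal G" and ?C = "carrier (profinite_completion G)"
  let ?P = "product_topology ?X ?F"
  have sub: "?C \<subseteq> topspace ?P" unfolding profinite_completion_def by auto
  then show "topspace (profinite_topology G) = ?C" unfolding profinite_topology_def by auto
  have haus: "Hausdorff_space ?P" by (simp add: Hausdorff_space_product_topology)
  then show "Hausdorff_space (profinite_topology G)" unfolding profinite_topology_def by (rule Hausdorff_space_subtopology)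
  have proj: "continuous_map ?P (?X N) (\<lambda>u. u N)" if "N \<in> ?F" for N by (rule continuous_map_product_projection[OF that])
  then show "continuous_map (profinite_topology G) (?X N) (\<lambda>u. u N)" if "N \<in> ?F" for N
    unfolding profinite_topology_def using that by (intro continuous_map_from_subtopology) 
  have "compact_space (?X N)" if "N \<in> ?F" for N
    using finite_index_normalD(4)[OF that] by (simp add: compact_space_discrete_topology FactGroup_def)
  then have comp: "compact_space ?P" by (simp add: compact_space_product_topology)
  define E where "E N M = {u \<in> topspace ?P. M <#> u N = u M}" for N M
  have "closedin ?P (E N M)" if NM: "N \<in> ?F" "M \<in> ?F" "N \<subseteq> M" for N M
  proof -
    have "continuous_map (?X N) (?X M) (\<lambda>C. M <#> C)"
      unfolding continuous_map_from_discrete_topology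
      using subgroup_mult_coset[OF finite_index_normalD(2)[OF NM(1)] finite_index_normalD(2)[OF NM(2)] NM(3)]
      by (auto simp: carrier_Mod)
    from continuous_map_compose[OF proj[OF NM(1)] this]
    have "continuous_map ?P (?X M) (\<lambda>u. M <#> u N)" by (simp add: comp_def)
    from closedin_continuous_maps_eq[OF _ this proj[OF NM(2)]] show ?thesis unfolding E_def by simp
  qed
  \<comment> \<open>Inserting the whole product makes the family visibly nonempty and confines the
    intersection to the product.\<close>
  then have "closedin ?P (\<Inter>(insert (topspace ?P) {E N M |N M. N \<in> ?F \<and> M \<in> ?F \<and> N \<subseteq> M}))"
    by (intro closedin_Inter) (auto simp del: topspace_product_topology)
  moreover have "?C = \<Inter>(insert (topspace ?P) {E N M |N M. N \<in> ?F \<and> M \<in> ?F \<and> N \<subseteq> M})"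
    unfolding profinite_completion_def E_def by auto
  ultimately have "closedin ?P ?C" by simp
  then have "compactin ?P ?C" using comp closedin_compact_space by blast
  then show "compact_space (profinite_topology G)" unfolding profinite_topology_def by (rule compact_space_subtopology)
qed

end

text \<open>A component that factors through a single coordinate of the source is continuous because
  the factor group at that coordinate is discrete.\<close>

lemma continuous_map_profinite:
  assumes G: "group G" and H: "group H"
    and F: "\<And>u. u \<in> carrier (profinite_completion G) \<Longrightarrow> F u \<in> carrier (profinite_completion H)"
    and comp: "\<And>N. N \<in> finite_index_normal H \<Longrightarrow> \<exists>M\<in>finite_index_normal G. \<exists>k.
      \<forall>u\<in>carrier (profinite_completion G). F u N = k (u M)"
  shows "continuous_map (profinite_topology G) (profinite_topology H) F"
proof -
  let ?C = "carrier (profinite_completion G)" and ?D = "carrier (profinite_completion H)"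
  let ?X = "\<lambda>N. discrete_topology (carrier (H Mod N))"
  have D: "?D \<subseteq> (\<Pi>\<^sub>E N\<in>finite_index_normal H. carrier (H Mod N))" unfolding profinite_completion_def by auto
  have "continuous_map (profinite_topology G) (?X N) (\<lambda>u. F u N)" if N: "N \<in> finite_index_normal H" for N
  proof -
    obtain M k where M: "M \<in> finite_index_normal G" "\<forall>u\<in>?C. F u N = k (u M)" using comp[OF N] by blast
    have FN: "F u N \<in> carrier (H Mod N)" if "u \<in> ?C" for u using D F[OF that] N by (auto simp: PiE_def Pi_def)
    show ?thesis
      unfolding continuous_map_def
    proof (intro conjI allI impI)
      show "(\<lambda>u. F u N) \<in> topspace (profinite_topology G) \<rightarrow> topspace (?X N)"
        using FN profinite_topology_facts(1)[OF G] by simp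
      fix U assume "openin (?X N) U"
      have "openin (profinite_topology G) {u \<in> topspace (profinite_topology G). u M \<in> {c \<in> carrier (G Mod M). k c \<in> U}}"
        by (rule openin_continuous_map_preimage[OF profinite_topology_facts(4)[OF G M(1)]]) auto
      moreover have "{u \<in> topspace (profinite_topology G). u M \<in> {c \<in> carrier (G Mod M). k c \<in> U}} =
          {u \<in> topspace (profinite_topology G). F u N \<in> U}"
        using M continuous_map_funspace[OF profinite_topology_facts(4)[OF G M(1)]]
        by (auto simp: profinite_topology_facts(1)[OF G])
      ultimately show "openin (profinite_topology G) {u \<in> topspace (profinite_topology G). F u N \<in> U}" by simp
    qed
  qed
  moreover have "F u \<in> extensional (finite_index_normal H)" if "u \<in> ?C" for u using D F[OF that] by (auto simp: PiE_def)
  ultimately have "continuous_map (profinite_topology G) (product_topology ?X (finite_index_normal H)) F"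
    unfolding continuous_map_componentwise using profinite_topology_facts(1)[OF G] by auto
  then show ?thesis
    unfolding profinite_topology_def[of H]
    by (rule continuous_map_into_subtopology) (use F profinite_topology_facts(1)[OF G] in auto)
qed

text \<open>Multiplication is continuous in each variable separately, which covers the maps needed
  for the correction of the zigzag: translations by fixed elements, conjugations and
  inversion.\<close>

definition compact_group :: "('g, 'm) monoid_scheme \<Rightarrow> 'g topology \<Rightarrow> bool" where
  "compact_group G X \<longleftrightarrow> group G \<and> topspace X = carrier G \<and> compact_space X \<and> Hausdorff_space X \<and>
     (\<forall>g\<in>carrier G. continuous_map X X (\<lambda>u. u \<otimes>\<^bsub>G\<^esub> g) \<and> continuous_map X X (\<lambda>u. g \<otimes>\<^bsub>G\<^esub> u)) \<and>
     continuous_map X X (m_inv G)"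

lemma compact_group_profinite:
  assumes "group G" shows "compact_group (profinite_completion G) (profinite_topology G)"
proof -
  interpret G: group G by fact
  let ?P = "profinite_completion G"
  interpret P: group ?P by (rule group_profinite_completion[OF G.group_axioms])
  have mult: "(u \<otimes>\<^bsub>?P\<^esub> v) N = u N \<otimes>\<^bsub>G Mod N\<^esub> v N" if "N \<in> finite_index_normal G" for u v N
    using that unfolding profinite_completion_def by simp
  have "continuous_map (profinite_topology G) (profinite_topology G) (\<lambda>u. u \<otimes>\<^bsub>?P\<^esub> g)" if g: "g \<in> carrier ?P" for g
  proof (rule continuous_map_profinite[OF assms assms])
    fix N assume N: "N \<in> finite_index_normal G"
    then show "\<exists>M\<in>finite_index_normal G. \<exists>k. \<forall>u\<in>carrier ?P. (u \<otimes>\<^bsub>?P\<^esub> g) N = k (u M)"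
      by (intro bexI[of _ N] exI[of _ "\<lambda>c. c \<otimes>\<^bsub>G Mod N\<^esub> g N"]) (auto simp: mult)
  qed (use g in auto)
  moreover have "continuous_map (profinite_topology G) (profinite_topology G) (\<lambda>u. g \<otimes>\<^bsub>?P\<^esub> u)" if g: "g \<in> carrier ?P" for g
  proof (rule continuous_map_profinite[OF assms assms])
    fix N assume N: "N \<in> finite_index_normal G"
    then show "\<exists>M\<in>finite_index_normal G. \<exists>k. \<forall>u\<in>carrier ?P. (g \<otimes>\<^bsub>?P\<^esub> u) N = k (u M)"
      by (intro bexI[of _ N] exI[of _ "\<lambda>c. g N \<otimes>\<^bsub>G Mod N\<^esub> c"]) (auto simp: mult)
  qed (use g in auto)
  moreover have "continuous_map (profinite_topology G) (profinite_topology G) (m_inv ?P)"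
  proof (rule continuous_map_profinite[OF assms assms])
    fix N assume N: "N \<in> finite_index_normal G"
    have "(inv\<^bsub>?P\<^esub> u) N = inv\<^bsub>G Mod N\<^esub> (u N)" if u: "u \<in> carrier ?P" for u
    proof -
      obtain g where g: "g \<in> carrier G" "u N = N #>\<^bsub>G\<^esub> g" by (rule profinite_carrier_value[OF G.group_axioms u N])
      then show ?thesis using profinite_inv_value[OF G.group_axioms u N g] inv_Mod[OF G.group_axioms finite_index_normalD(1)[OF G.group_axioms N] g(1)] by simp
    qed
    then show "\<exists>M\<in>finite_index_normal G. \<exists>k. \<forall>u\<in>carrier ?P. (inv\<^bsub>?P\<^esub> u) N = k (u M)"
      using N by (intro bexI[of _ N] exI[of _ "\<lambda>c. inv\<^bsub>G Mod N\<^esub> c"]) auto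
  qed auto
  ultimately show ?thesis unfolding compact_group_def using profinite_topology_facts[OF G.group_axioms] P.group_axioms by blast
qed

text \<open>Cosets of the preimage are preimages of cosets of \<open>N\<close>, so there are no more
  of them than cosets of \<open>N\<close>.\<close>

lemma finite_index_normal_preimage:
  assumes "group G" "group H" "\<phi> \<in> hom G H" "N \<in> finite_index_normal H"
  shows "\<phi> -` N \<inter> carrier G \<in> finite_index_normal G"
    and "\<And>g. g \<in> carrier G \<Longrightarrow> (\<phi> -` N \<inter> carrier G) #>\<^bsub>G\<^esub> g = {h \<in> carrier G. \<phi> h \<in> N #>\<^bsub>H\<^esub> \<phi> g}"
proof -
  interpret G: group G by fact
  interpret H: group H by fact
  interpret group_hom G H \<phi> by unfold_locales (rule assms(3))
  let ?M = "\<phi> -` N \<inter> carrier G"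
  have N: "N \<lhd> H" "subgroup N H" "finite (rcosets\<^bsub>H\<^esub> N)" using finite_index_normalD[OF H.group_axioms assms(4)] by auto
  have M: "subgroup ?M G"
  proof (rule G.subgroupI)
    have "\<one>\<^bsub>G\<^esub> \<in> ?M" using subgroup.one_closed[OF N(2)] by simp
    then show "?M \<noteq> {}" by blast
  qed (use N(2) in \<open>auto simp: subgroup.m_closed subgroup.m_inv_closed\<close>)
  have "?M \<lhd> G"
    unfolding G.normal_inv_iff
  proof (intro conjI ballI M)
    fix g h assume "g \<in> carrier G" "h \<in> ?M"
    then show "g \<otimes>\<^bsub>G\<^esub> h \<otimes>\<^bsub>G\<^esub> inv\<^bsub>G\<^esub> g \<in> ?M" using normal.inv_op_closed2[OF N(1)] by simp
  qed
  show coset: "?M #>\<^bsub>G\<^esub> g = {h \<in> carrier G. \<phi> h \<in> N #>\<^bsub>H\<^esub> \<phi> g}" if g: "g \<in> carrier G" for g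
  proof -
    have "h \<in> ?M #>\<^bsub>G\<^esub> g \<longleftrightarrow> \<phi> h \<in> N #>\<^bsub>H\<^esub> \<phi> g" if "h \<in> carrier G" for h
      using subgroup.rcos_module[OF M G.group_axioms g that] subgroup.rcos_module[OF N(2) H.group_axioms, of "\<phi> g" "\<phi> h"] g that
      by simp
    moreover have "?M #>\<^bsub>G\<^esub> g \<subseteq> carrier G" using g G.r_coset_subset_G[OF subgroup.subset[OF M]] by blast
    ultimately show ?thesis by blast
  qed
  have "rcosets\<^bsub>G\<^esub> ?M \<subseteq> (\<lambda>C. {h \<in> carrier G. \<phi> h \<in> C}) ` (rcosets\<^bsub>H\<^esub> N)"
  proof
    fix C assume "C \<in> rcosets\<^bsub>G\<^esub> ?M"
    then obtain g where g: "g \<in> carrier G" "C = ?M #>\<^bsub>G\<^esub> g" unfolding RCOSETS_def by blast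
    have "N #>\<^bsub>H\<^esub> \<phi> g \<in> rcosets\<^bsub>H\<^esub> N" using g H.rcosetsI[OF subgroup.subset[OF N(2)]] by simp
    then show "C \<in> (\<lambda>C. {h \<in> carrier G. \<phi> h \<in> C}) ` (rcosets\<^bsub>H\<^esub> N)" using g coset by blast
  qed
  then have "finite (rcosets\<^bsub>G\<^esub> ?M)" using N(3) finite_surj by blast
  then show "?M \<in> finite_index_normal G" using \<open>?M \<lhd> G\<close> unfolding finite_index_normal_def by blast
qed

text \<open>The image of the coset of \<open>g\<close> contains \<open>\<phi> g\<close> and stays
  within its coset modulo \<open>N\<close>. This reduces all later claims to
  representatives.\<close>

lemma induced_profinite_value:
  assumes "group G" "group H" "\<phi> \<in> hom G H" "N \<in> finite_index_normal H"
    and "g \<in> carrier G" "u (\<phi> -` N \<inter> carrier G) = (\<phi> -` N \<inter> carrier G) #>\<^bsub>G\<^esub> g"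
  shows "induced_profinite G H \<phi> u N = N #>\<^bsub>H\<^esub> \<phi> g"
proof -
  interpret H: group H by fact
  let ?M = "\<phi> -` N \<inter> carrier G"
  have M: "?M \<in> finite_index_normal G" and cos: "?M #>\<^bsub>G\<^esub> g = {h \<in> carrier G. \<phi> h \<in> N #>\<^bsub>H\<^esub> \<phi> g}"
    using finite_index_normal_preimage[OF assms(1-4)] assms(5) by blast+
  have "g \<in> ?M #>\<^bsub>G\<^esub> g" using group.rcos_self[OF assms(1,5)] finite_index_normalD(2)[OF assms(1) M] by blast
  then have "N <#>\<^bsub>H\<^esub> (\<phi> ` (?M #>\<^bsub>G\<^esub> g)) = N #>\<^bsub>H\<^esub> \<phi> g"
    using finite_index_normalD(1)[OF H.group_axioms assms(4)] hom_in_carrier[OF assms(3,5)] cos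
    by (intro coset_mult_coset_image[OF H.group_axioms]) auto
  then show ?thesis unfolding induced_profinite_def using assms(4,6) by simp
qed

lemma induced_profinite_value_exists:
  assumes "group G" "group H" "\<phi> \<in> hom G H" "N \<in> finite_index_normal H" "u \<in> carrier (profinite_completion G)"
  obtains g where "g \<in> carrier G" "u (\<phi> -` N \<inter> carrier G) = (\<phi> -` N \<inter> carrier G) #>\<^bsub>G\<^esub> g"
    "induced_profinite G H \<phi> u N = N #>\<^bsub>H\<^esub> \<phi> g"
proof -
  obtain g where g: "g \<in> carrier G" "u (\<phi> -` N \<inter> carrier G) = (\<phi> -` N \<inter> carrier G) #>\<^bsub>G\<^esub> g"
    by (rule profinite_carrier_value[OF assms(1,5) finite_index_normal_preimage(1)[OF assms(1-4)]])
  then show thesis using that induced_profinite_value[OF assms(1-4)] by blast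
qed

lemma induced_profinite_closed:
  assumes "group G" "group H" "\<phi> \<in> hom G H" "u \<in> carrier (profinite_completion G)"
  shows "induced_profinite G H \<phi> u \<in> carrier (profinite_completion H)"
proof (rule profinite_carrierI[OF assms(2)])
  fix N assume N: "N \<in> finite_index_normal H"
  obtain g where g: "g \<in> carrier G" "u (\<phi> -` N \<inter> carrier G) = (\<phi> -` N \<inter> carrier G) #>\<^bsub>G\<^esub> g"
    "induced_profinite G H \<phi> u N = N #>\<^bsub>H\<^esub> \<phi> g"
    by (rule induced_profinite_value_exists[OF assms(1-3) N assms(4)])
  show "\<exists>h\<in>carrier H. induced_profinite G H \<phi> u N = N #>\<^bsub>H\<^esub> h \<and>
    (\<forall>M\<in>finite_index_normal H. N \<subseteq> M \<longrightarrow> induced_profinite G H \<phi> u M = M #>\<^bsub>H\<^esub> h)"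
  proof (intro bexI[of _ "\<phi> g"] conjI ballI impI)
    show "induced_profinite G H \<phi> u N = N #>\<^bsub>H\<^esub> \<phi> g" by (rule g(3))
    fix M assume M: "M \<in> finite_index_normal H" "N \<subseteq> M"
    then have "\<phi> -` N \<inter> carrier G \<subseteq> \<phi> -` M \<inter> carrier G" by blast
    then have "u (\<phi> -` M \<inter> carrier G) = (\<phi> -` M \<inter> carrier G) #>\<^bsub>G\<^esub> g"
      by (rule profinite_carrier_compat[OF assms(1,4) finite_index_normal_preimage(1)[OF assms(1-3) N]
            finite_index_normal_preimage(1)[OF assms(1-3) M(1)] _ g(1,2)])
    then show "induced_profinite G H \<phi> u M = M #>\<^bsub>H\<^esub> \<phi> g"
      by (rule induced_profinite_value[OF assms(1-3) M(1) g(1)])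
  qed (rule hom_in_carrier[OF assms(3) g(1)])
qed (simp add: induced_profinite_def)

lemma induced_profinite_hom:
  assumes "group G" "group H" "\<phi> \<in> hom G H"
  shows "induced_profinite G H \<phi> \<in> hom (profinite_completion G) (profinite_completion H)"
proof (rule homI)
  interpret G: group G by fact
  interpret H: group H by fact
  fix u assume u: "u \<in> carrier (profinite_completion G)"
  then show "induced_profinite G H \<phi> u \<in> carrier (profinite_completion H)"
    by (rule induced_profinite_closed[OF assms])
  fix v assume v: "v \<in> carrier (profinite_completion G)"
  have uv: "u \<otimes>\<^bsub>profinite_completion G\<^esub> v \<in> carrier (profinite_completion G)" by (rule profinite_mult_closed[OF G.group_axioms u v])
  show "induced_profinite G H \<phi> (u \<otimes>\<^bsub>profinite_completion G\<^esub> v) =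
    induced_profinite G H \<phi> u \<otimes>\<^bsub>profinite_completion H\<^esub> induced_profinite G H \<phi> v"
  proof (rule profinite_eqI[OF H.group_axioms])
    fix N assume N: "N \<in> finite_index_normal H"
    let ?M = "\<phi> -` N \<inter> carrier G"
    obtain g where g: "g \<in> carrier G" "u ?M = ?M #>\<^bsub>G\<^esub> g" "induced_profinite G H \<phi> u N = N #>\<^bsub>H\<^esub> \<phi> g"
      by (rule induced_profinite_value_exists[OF assms N u])
    obtain h where h: "h \<in> carrier G" "v ?M = ?M #>\<^bsub>G\<^esub> h" "induced_profinite G H \<phi> v N = N #>\<^bsub>H\<^esub> \<phi> h"
      by (rule induced_profinite_value_exists[OF assms N v])
    have "(u \<otimes>\<^bsub>profinite_completion G\<^esub> v) ?M = ?M #>\<^bsub>G\<^esub> (g \<otimes>\<^bsub>G\<^esub> h)"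
      by (rule profinite_mult_value[where u = u and v = v, OF G.group_axioms finite_index_normal_preimage(1)[OF assms N] g(1) h(1) g(2) h(2)])
    then have "induced_profinite G H \<phi> (u \<otimes>\<^bsub>profinite_completion G\<^esub> v) N = N #>\<^bsub>H\<^esub> \<phi> (g \<otimes>\<^bsub>G\<^esub> h)"
      using g h by (intro induced_profinite_value[OF assms N]) auto
    also have "\<phi> (g \<otimes>\<^bsub>G\<^esub> h) = \<phi> g \<otimes>\<^bsub>H\<^esub> \<phi> h" using hom_mult[OF assms(3)] g h by blast
    also have "N #>\<^bsub>H\<^esub> (\<phi> g \<otimes>\<^bsub>H\<^esub> \<phi> h) = (induced_profinite G H \<phi> u \<otimes>\<^bsub>profinite_completion H\<^esub> induced_profinite G H \<phi> v) N"
      by (rule profinite_mult_value[where u = "induced_profinite G H \<phi> u" and v = "induced_profinite G H \<phi> v",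
          OF H.group_axioms N _ _ g(3) h(3), symmetric]) (use g h hom_in_carrier[OF assms(3)] in auto)
    finally show "induced_profinite G H \<phi> (u \<otimes>\<^bsub>profinite_completion G\<^esub> v) N =
        (induced_profinite G H \<phi> u \<otimes>\<^bsub>profinite_completion H\<^esub> induced_profinite G H \<phi> v) N" .
  qed (intro induced_profinite_closed[OF assms] profinite_mult_closed[OF H.group_axioms] uv u v)+
qed

lemma continuous_map_induced_profinite:
  assumes "group G" "group H" "\<phi> \<in> hom G H"
  shows "continuous_map (profinite_topology G) (profinite_topology H) (induced_profinite G H \<phi>)"
proof (rule continuous_map_profinite[OF assms(1,2) induced_profinite_closed[OF assms]])
  fix N assume N: "N \<in> finite_index_normal H"
  show "\<exists>M\<in>finite_index_normal G. \<exists>k. \<forall>u\<in>carrier (profinite_completion G). induced_profinite G H \<phi> u N = k (u M)"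
    by (rule bexI[OF _ finite_index_normal_preimage(1)[OF assms N]], rule exI[of _ "\<lambda>c. N <#>\<^bsub>H\<^esub> (\<phi> ` c)"])
       (simp add: induced_profinite_def N)
qed

text \<open>The composite is a separate function \<open>\<theta>\<close> because composites of
  induced homomorphisms agree with the homomorphism of the composite only on the carrier.\<close>

lemma induced_profinite_comp:
  assumes "group G" "group H" "group K" "\<phi> \<in> hom G H" "\<psi> \<in> hom H K" "u \<in> carrier (profinite_completion G)"
    and \<theta>: "\<theta> \<in> hom G K" "\<And>g. g \<in> carrier G \<Longrightarrow> \<theta> g = \<psi> (\<phi> g)"
  shows "induced_profinite H K \<psi> (induced_profinite G H \<phi> u) = induced_profinite G K \<theta> u"
proof (rule profinite_eqI[OF assms(3)])
  let ?v = "induced_profinite G H \<phi> u"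
  have v: "?v \<in> carrier (profinite_completion H)" by (rule induced_profinite_closed[OF assms(1,2,4,6)])
  then show "induced_profinite H K \<psi> ?v \<in> carrier (profinite_completion K)" by (rule induced_profinite_closed[OF assms(2,3,5)])
  show "induced_profinite G K \<theta> u \<in> carrier (profinite_completion K)"
    by (rule induced_profinite_closed[OF assms(1,3) \<theta>(1) assms(6)])
  fix N assume N: "N \<in> finite_index_normal K"
  let ?M = "\<psi> -` N \<inter> carrier H"
  have M: "?M \<in> finite_index_normal H" by (rule finite_index_normal_preimage(1)[OF assms(2,3,5) N])
  have eq: "\<phi> -` ?M \<inter> carrier G = \<theta> -` N \<inter> carrier G" using \<theta>(2) hom_in_carrier[OF assms(4)] by auto
  obtain g where g: "g \<in> carrier G" "u (\<phi> -` ?M \<inter> carrier G) = (\<phi> -` ?M \<inter> carrier G) #>\<^bsub>G\<^esub> g" "?v ?M = ?M #>\<^bsub>H\<^esub> \<phi> g"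
    by (rule induced_profinite_value_exists[OF assms(1,2,4) M assms(6)])
  have "induced_profinite H K \<psi> ?v N = N #>\<^bsub>K\<^esub> \<psi> (\<phi> g)"
    by (rule induced_profinite_value[where u = ?v, OF assms(2,3,5) N hom_in_carrier[OF assms(4) g(1)] g(3)])
  moreover have "induced_profinite G K \<theta> u N = N #>\<^bsub>K\<^esub> \<theta> g"
    by (rule induced_profinite_value[where u = u, OF assms(1,3) \<theta>(1) N g(1) g(2)[unfolded eq]])
  ultimately show "induced_profinite H K \<psi> ?v N = induced_profinite G K \<theta> u N" using \<theta>(2)[OF g(1)] by simp
qed

lemma induced_profinite_id:
  assumes "group G" "\<theta> \<in> hom G G" "\<And>g. g \<in> carrier G \<Longrightarrow> \<theta> g = g" "u \<in> carrier (profinite_completion G)"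
  shows "induced_profinite G G \<theta> u = u"
proof (rule profinite_eqI[OF assms(1) induced_profinite_closed[OF assms(1,1,2,4)] assms(4)])
  fix N assume N: "N \<in> finite_index_normal G"
  have eq: "\<theta> -` N \<inter> carrier G = N" using assms(3) finite_index_normalD(3)[OF assms(1) N] by auto
  obtain g where g: "g \<in> carrier G" "u (\<theta> -` N \<inter> carrier G) = (\<theta> -` N \<inter> carrier G) #>\<^bsub>G\<^esub> g"
    "induced_profinite G G \<theta> u N = N #>\<^bsub>G\<^esub> \<theta> g"
    by (rule induced_profinite_value_exists[OF assms(1,1,2) N assms(4)])
  then show "induced_profinite G G \<theta> u N = u N" using assms(3) eq by simp
qed

text \<open>As \<open>N\<close> is normal, conjugate homomorphisms have the same preimage of
  \<open>N\<close>. Both induced maps therefore read the same coordinate of \<open>u\<close>, and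
  their values differ by conjugation with the coset of \<open>g\<close>.\<close>

lemma induced_profinite_conj:
  assumes "group G" "group H" "\<phi> \<in> hom G H" "\<psi> \<in> hom G H" "g \<in> carrier H"
    and conj: "\<And>a. a \<in> carrier G \<Longrightarrow> \<psi> a = g \<otimes>\<^bsub>H\<^esub> \<phi> a \<otimes>\<^bsub>H\<^esub> inv\<^bsub>H\<^esub> g"
    and u: "u \<in> carrier (profinite_completion G)"
  shows "induced_profinite G H \<psi> u = to_profinite H g \<otimes>\<^bsub>profinite_completion H\<^esub> induced_profinite G H \<phi> u
    \<otimes>\<^bsub>profinite_completion H\<^esub> inv\<^bsub>profinite_completion H\<^esub> to_profinite H g"
proof -
  interpret H: group H by fact
  interpret P: group "profinite_completion H" by (rule group_profinite_completion[OF H.group_axioms])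
  let ?P = "profinite_completion H"
  have \<iota>: "to_profinite H g \<in> carrier ?P" by (rule to_profinite_closed[OF H.group_axioms assms(5)])
  have c: "induced_profinite G H \<phi> u \<in> carrier ?P" "induced_profinite G H \<psi> u \<in> carrier ?P"
    using induced_profinite_closed[OF assms(1,2) _ u] assms(3,4) by auto
  show ?thesis
  proof (rule profinite_eqI[OF H.group_axioms c(2)])
    show "to_profinite H g \<otimes>\<^bsub>?P\<^esub> induced_profinite G H \<phi> u \<otimes>\<^bsub>?P\<^esub> inv\<^bsub>?P\<^esub> to_profinite H g \<in> carrier ?P"
      using \<iota> c by simp
    fix N assume N: "N \<in> finite_index_normal H"
    have nN: "N \<lhd> H" by (rule finite_index_normalD(1)[OF H.group_axioms N])
    have eq: "\<psi> -` N \<inter> carrier G = \<phi> -` N \<inter> carrier G"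
    proof -
      have "\<psi> a \<in> N \<longleftrightarrow> \<phi> a \<in> N" if a: "a \<in> carrier G" for a
      proof
        have fa: "\<phi> a \<in> carrier H" using hom_in_carrier[OF assms(3) a] .
        show "\<phi> a \<in> N \<Longrightarrow> \<psi> a \<in> N" using conj[OF a] normal.inv_op_closed2[OF nN assms(5)] by simp
        assume "\<psi> a \<in> N"
        then have "inv\<^bsub>H\<^esub> g \<otimes>\<^bsub>H\<^esub> \<psi> a \<otimes>\<^bsub>H\<^esub> g \<in> N" using normal.inv_op_closed1[OF nN assms(5)] by simp
        moreover have "inv\<^bsub>H\<^esub> g \<otimes>\<^bsub>H\<^esub> \<psi> a \<otimes>\<^bsub>H\<^esub> g = \<phi> a"
          unfolding conj[OF a] using fa assms(5) by (simp add: H.m_assoc H.l_inv_ex) (simp add: H.m_assoc[symmetric])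
        ultimately show "\<phi> a \<in> N" by simp
      qed
      then show ?thesis by blast
    qed
    obtain a where a: "a \<in> carrier G" "u (\<phi> -` N \<inter> carrier G) = (\<phi> -` N \<inter> carrier G) #>\<^bsub>G\<^esub> a"
      "induced_profinite G H \<phi> u N = N #>\<^bsub>H\<^esub> \<phi> a"
      by (rule induced_profinite_value_exists[OF assms(1-3) N u])
    have fa: "\<phi> a \<in> carrier H" using hom_in_carrier[OF assms(3) a(1)] .
    have \<iota>N: "to_profinite H g N = N #>\<^bsub>H\<^esub> g" using N unfolding to_profinite_def[OF H.group_axioms] by simp
    have "(to_profinite H g \<otimes>\<^bsub>?P\<^esub> induced_profinite G H \<phi> u) N = N #>\<^bsub>H\<^esub> (g \<otimes>\<^bsub>H\<^esub> \<phi> a)"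
      by (rule profinite_mult_value[where u = "to_profinite H g" and v = "induced_profinite G H \<phi> u", OF H.group_axioms N assms(5) fa \<iota>N a(3)])
    then have "(to_profinite H g \<otimes>\<^bsub>?P\<^esub> induced_profinite G H \<phi> u \<otimes>\<^bsub>?P\<^esub> inv\<^bsub>?P\<^esub> to_profinite H g) N
        = N #>\<^bsub>H\<^esub> (g \<otimes>\<^bsub>H\<^esub> \<phi> a \<otimes>\<^bsub>H\<^esub> inv\<^bsub>H\<^esub> g)"
      using assms(5) fa by (intro profinite_mult_value[where v = "inv\<^bsub>?P\<^esub> to_profinite H g", OF H.group_axioms N _ _ _ profinite_inv_value[OF H.group_axioms \<iota> N assms(5) \<iota>N]]) auto
    moreover have "induced_profinite G H \<psi> u N = N #>\<^bsub>H\<^esub> \<psi> a"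
      by (rule induced_profinite_value[OF assms(1,2,4) N a(1)]) (simp add: eq a(2))
    ultimately show "induced_profinite G H \<psi> u N =
        (to_profinite H g \<otimes>\<^bsub>?P\<^esub> induced_profinite G H \<phi> u \<otimes>\<^bsub>?P\<^esub> inv\<^bsub>?P\<^esub> to_profinite H g) N"
      using conj[OF a(1)] by simp
  qed
qed

section \<open>Inverse limits of interleaved sequences of compact groups\<close>

lemma compact_groupD:
  assumes "compact_group G X"
  shows "group G" "topspace X = carrier G" "compact_space X" "Hausdorff_space X"
    "\<And>g. g \<in> carrier G \<Longrightarrow> continuous_map X X (\<lambda>u. u \<otimes>\<^bsub>G\<^esub> g)"
    "\<And>g. g \<in> carrier G \<Longrightarrow> continuous_map X X (\<lambda>u. g \<otimes>\<^bsub>G\<^esub> u)"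
    "continuous_map X X (m_inv G)"
  using assms unfolding compact_group_def by blast+

lemma bond_hom:
  assumes "\<And>n. group (A n)" "\<And>n. \<alpha> (Suc n) \<in> hom (A (Suc n)) (A n)" "n \<le> m"
  shows "bond \<alpha> n m \<in> hom (A m) (A n)"
  using assms(3)
proof (induction m)
  case (Suc m)
  show ?case
  proof (cases "n = Suc m")
    case False
    then have n: "n \<le> m" using Suc.prems by simp
    show ?thesis unfolding bond_Suc_right[OF n]
      by (rule hom_compose[OF assms(2) Suc.IH[OF n]])
  qed (simp add: hom_def)
qed (use assms in \<open>simp add: hom_def\<close>)

lemma continuous_map_conj:
  assumes "compact_group G X" "g \<in> carrier G"
  shows "continuous_map X X (\<lambda>u. g \<otimes>\<^bsub>G\<^esub> u \<otimes>\<^bsub>G\<^esub> inv\<^bsub>G\<^esub> g)"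
proof -
  interpret group G by (rule compact_groupD(1)[OF assms(1)])
  have "continuous_map X X ((\<lambda>u. u \<otimes>\<^bsub>G\<^esub> inv\<^bsub>G\<^esub> g) \<circ> (\<lambda>u. g \<otimes>\<^bsub>G\<^esub> u))"
    by (rule continuous_map_compose[OF compact_groupD(6)[OF assms] compact_groupD(5)[OF assms(1)]]) (use assms in simp)
  then show ?thesis by (simp add: comp_def)
qed

lemma conj_hom:
  assumes "group H" "h \<in> carrier H" "f \<in> hom G H"
  shows "(\<lambda>u. h \<otimes>\<^bsub>H\<^esub> f u \<otimes>\<^bsub>H\<^esub> inv\<^bsub>H\<^esub> h) \<in> hom G H"
proof -
  interpret group H by fact
  have "h \<otimes>\<^bsub>H\<^esub> (a \<otimes>\<^bsub>H\<^esub> b) \<otimes>\<^bsub>H\<^esub> inv\<^bsub>H\<^esub> h = h \<otimes>\<^bsub>H\<^esub> a \<otimes>\<^bsub>H\<^esub> inv\<^bsub>H\<^esub> h \<otimes>\<^bsub>H\<^esub> (h \<otimes>\<^bsub>H\<^esub> b \<otimes>\<^bsub>H\<^esub> inv\<^bsub>H\<^esub> h)"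
    if "a \<in> carrier H" "b \<in> carrier H" for a b
  proof -
    have "inv\<^bsub>H\<^esub> h \<otimes>\<^bsub>H\<^esub> (h \<otimes>\<^bsub>H\<^esub> c) = c" if "c \<in> carrier H" for c
      using that assms(2) by (simp add: m_assoc[symmetric])
    then show ?thesis using that assms(2) by (simp add: m_assoc)
  qed
  then show ?thesis
    using assms(2,3) hom_in_carrier[OF assms(3)] hom_mult[OF assms(3)] by (intro homI) auto
qed

text \<open>The corrections \<open>y\<close> and \<open>z\<close> must satisfy \<open>y i = F i (z i)\<close> and \<open>z i = F' i (y (i + 1))\<close> for certain continuous
  maps, so that \<open>y\<close> is a point in the limit of an inverse sequence of nonempty compact spaces.\<close>

lemma rectify_zigzag:
  fixes A :: "nat \<Rightarrow> 'g monoid" and B :: "nat \<Rightarrow> 'h monoid"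
  assumes A: "\<And>n. compact_group (A n) (TA n)" and B: "\<And>n. compact_group (B n) (TB n)"
    and \<alpha>: "\<And>n. \<alpha> n \<in> carrier (A (Suc n)) \<rightarrow> carrier (A n)" and \<beta>: "\<And>n. \<beta> n \<in> carrier (B (Suc n)) \<rightarrow> carrier (B n)"
    and a: "\<And>n. a n \<in> hom (A (Suc n)) (B n)" "\<And>n. continuous_map (TA (Suc n)) (TB n) (a n)"
    and b: "\<And>n. b n \<in> hom (B n) (A n)" "\<And>n. continuous_map (TB n) (TA n) (b n)"
    and s: "\<And>n. s n \<in> carrier (A n)" "\<And>n u. u \<in> carrier (A (Suc n)) \<Longrightarrow> b n (a n u) = s n \<otimes>\<^bsub>A n\<^esub> \<alpha> n u \<otimes>\<^bsub>A n\<^esub> inv\<^bsub>A n\<^esub> s n"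
    and t: "\<And>n. t n \<in> carrier (B n)" "\<And>n v. v \<in> carrier (B (Suc n)) \<Longrightarrow> a n (b (Suc n) v) = t n \<otimes>\<^bsub>B n\<^esub> \<beta> n v \<otimes>\<^bsub>B n\<^esub> inv\<^bsub>B n\<^esub> t n"
  obtains a' b' where
    "\<And>n. a' n \<in> hom (A (Suc n)) (B n)" "\<And>n. continuous_map (TA (Suc n)) (TB n) (a' n)"
    "\<And>n. b' n \<in> hom (B n) (A n)" "\<And>n. continuous_map (TB n) (TA n) (b' n)"
    "\<And>n u. u \<in> carrier (A (Suc n)) \<Longrightarrow> b' n (a' n u) = \<alpha> n u"
    "\<And>n v. v \<in> carrier (B (Suc n)) \<Longrightarrow> a' n (b' (Suc n) v) = \<beta> n v"
proof -
  note gA = compact_groupD(1)[OF A] and gB = compact_groupD(1)[OF B]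
  \<comment> \<open>\<open>F\<close> solves the equation \<open>yz\<close> below for
    \<open>y n\<close>, and \<open>F'\<close> solves \<open>zy\<close> for \<open>z n\<close>. These
    equations say that the total conjugating factors in the two composites are trivial.\<close>
  define F where "F n z = inv\<^bsub>A n\<^esub> (b n z \<otimes>\<^bsub>A n\<^esub> s n)" for n z
  define F' where "F' n y = inv\<^bsub>B n\<^esub> (a n y \<otimes>\<^bsub>B n\<^esub> t n)" for n y
  have cF: "continuous_map (TB n) (TA n) (F n)" for n
    using continuous_map_compose[OF continuous_map_compose[OF b(2) compact_groupD(5)[OF A s(1)]] compact_groupD(7)[OF A]]
    unfolding F_def by (simp add: comp_def)
  have cF': "continuous_map (TA (Suc n)) (TB n) (F' n)" for n
    using continuous_map_compose[OF continuous_map_compose[OF a(2) compact_groupD(5)[OF B t(1)]] compact_groupD(7)[OF B]]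
    unfolding F'_def by (simp add: comp_def)
  \<comment> \<open>The shift makes \<open>f (Suc n)\<close> lead from level \<open>Suc n\<close> to
    level \<open>n\<close>, as in any inverse sequence.\<close>
  define f where "f n = F (n - 1) \<circ> F' (n - 1)" for n
  have cf: "continuous_map (TA (Suc n)) (TA n) (f (Suc n))" for n
    unfolding f_def using continuous_map_compose[OF cF' cF] by simp
  have ex: "\<exists>z\<in>topspace (TA l). bond f 0 l z \<in> topspace (TA 0)" if "0 \<le> l" for l
  proof -
    have one: "\<one>\<^bsub>A l\<^esub> \<in> topspace (TA l)" using compact_groupD(2)[OF A] gA[of l] by (simp add: group.is_monoid)
    moreover have "bond f 0 l \<one>\<^bsub>A l\<^esub> \<in> topspace (TA 0)"
      using continuous_map_bond[where X = TA and f = f, OF cf that] one unfolding continuous_map_def by blast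
    ultimately show ?thesis by blast
  qed
  obtain y where y: "y \<in> threads (\<lambda>n. topspace (TA n)) f" "y 0 \<in> topspace (TA 0)"
    by (rule invlim_threads_exist[where X = TA and f = f, OF compact_groupD(3)[OF A] compact_groupD(4)[OF A] cf closedin_topspace])
      (erule ex, rule that)
  have yA: "y n \<in> carrier (A n)" and yf: "F n (F' n (y (Suc n))) = y n" for n
    using y(1) compact_groupD(2)[OF A] unfolding threads_def f_def by auto
  define z where "z n = F' n (y (Suc n))" for n
  have zB: "z n \<in> carrier (B n)" for n
    using cF' yA[of "Suc n"] compact_groupD(2)[OF A] compact_groupD(2)[OF B] unfolding z_def continuous_map_def by blast
  have yz: "y n \<otimes>\<^bsub>A n\<^esub> (b n (z n) \<otimes>\<^bsub>A n\<^esub> s n) = \<one>\<^bsub>A n\<^esub>" for n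
  proof -
    interpret group "A n" by (rule gA)
    have "b n (z n) \<in> carrier (A n)" using hom_in_carrier[OF b(1) zB] .
    then show ?thesis using yf[of n] s(1)[of n] unfolding z_def[symmetric] F_def by (metis l_inv m_closed)
  qed
  have zy: "z n \<otimes>\<^bsub>B n\<^esub> (a n (y (Suc n)) \<otimes>\<^bsub>B n\<^esub> t n) = \<one>\<^bsub>B n\<^esub>" for n
  proof -
    interpret group "B n" by (rule gB)
    have "a n (y (Suc n)) \<in> carrier (B n)" using hom_in_carrier[OF a(1) yA] .
    then show ?thesis using t(1)[of n] unfolding z_def F'_def by (metis l_inv m_closed)
  qed
  define a' where "a' n u = z n \<otimes>\<^bsub>B n\<^esub> a n u \<otimes>\<^bsub>B n\<^esub> inv\<^bsub>B n\<^esub> z n" for n u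
  define b' where "b' n v = y n \<otimes>\<^bsub>A n\<^esub> b n v \<otimes>\<^bsub>A n\<^esub> inv\<^bsub>A n\<^esub> y n" for n v
  \<comment> \<open>The left side is \<open>v\<close> conjugated by the product
    \<open>y0 \<otimes> (f z0 \<otimes> s0)\<close>, which the last equation makes trivial. It is
    stated for any two groups so as to serve both composites.\<close>
  have cancel: "y0 \<otimes>\<^bsub>G\<^esub> f (z0 \<otimes>\<^bsub>H\<^esub> w \<otimes>\<^bsub>H\<^esub> inv\<^bsub>H\<^esub> z0) \<otimes>\<^bsub>G\<^esub> inv\<^bsub>G\<^esub> y0 = v"
    if G: "group G" and H: "group H" and f: "f \<in> hom H G" and car: "y0 \<in> carrier G" "z0 \<in> carrier H" "w \<in> carrier H" "s0 \<in> carrier G" "v \<in> carrier G"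
      and eq: "f w = s0 \<otimes>\<^bsub>G\<^esub> v \<otimes>\<^bsub>G\<^esub> inv\<^bsub>G\<^esub> s0" "y0 \<otimes>\<^bsub>G\<^esub> (f z0 \<otimes>\<^bsub>G\<^esub> s0) = \<one>\<^bsub>G\<^esub>"
    for G :: "'c monoid" and H :: "'d monoid" and f y0 z0 w s0 v
  proof -
    interpret G: group G by fact
    interpret H: group H by fact
    interpret h: group_hom H G f by unfold_locales (rule f)
    define r where "r = y0 \<otimes>\<^bsub>G\<^esub> (f z0 \<otimes>\<^bsub>G\<^esub> s0)"
    have r: "r \<in> carrier G" "r = \<one>\<^bsub>G\<^esub>" using car eq(2) unfolding r_def by auto
    have "y0 \<otimes>\<^bsub>G\<^esub> f (z0 \<otimes>\<^bsub>H\<^esub> w \<otimes>\<^bsub>H\<^esub> inv\<^bsub>H\<^esub> z0) \<otimes>\<^bsub>G\<^esub> inv\<^bsub>G\<^esub> y0 = r \<otimes>\<^bsub>G\<^esub> v \<otimes>\<^bsub>G\<^esub> inv\<^bsub>G\<^esub> r"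
      unfolding r_def using car by (simp add: eq(1) G.m_assoc G.inv_mult_group)
    then show ?thesis using r car by simp
  qed
  show thesis
  proof (rule that[of a' b'])
    fix n
    show "a' n \<in> hom (A (Suc n)) (B n)" unfolding a'_def by (rule conj_hom[OF gB zB a(1)])
    show "b' n \<in> hom (B n) (A n)" unfolding b'_def by (rule conj_hom[OF gA yA b(1)])
    show "continuous_map (TA (Suc n)) (TB n) (a' n)"
      using continuous_map_compose[OF a(2) continuous_map_conj[OF B zB]] unfolding a'_def comp_def .
    show "continuous_map (TB n) (TA n) (b' n)"
      using continuous_map_compose[OF b(2) continuous_map_conj[OF A yA]] unfolding b'_def comp_def .
    show "b' n (a' n u) = \<alpha> n u" if u: "u \<in> carrier (A (Suc n))" for u
      unfolding a'_def b'_def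
      by (rule cancel[OF gA gB b(1) yA zB hom_in_carrier[OF a(1) u] s(1) _ s(2)[OF u] yz]) (use \<alpha> u in auto)
    show "a' n (b' (Suc n) v) = \<beta> n v" if v: "v \<in> carrier (B (Suc n))" for v
      unfolding a'_def b'_def
      by (rule cancel[OF gB gA a(1) zB yA hom_in_carrier[OF b(1) v] t(1) _ t(2)[OF v] zy]) (use \<beta> v in auto)
  qed
qed

text \<open>The entry at \<open>n\<close> is read off at level \<open>m (Suc n)\<close>, carried
  over to level \<open>k n\<close> and bonded down. The hypothesis \<open>step\<close> makes the
  entries at the levels \<open>k n\<close> coherent, and these determine the whole thread.\<close>

lemma invlim_interleaved_map:
  assumes \<beta>: "\<And>n. continuous_map (TB (Suc n)) (TB n) (\<beta> (Suc n))"
    and k: "mono k" "\<And>n. n \<le> k n"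
    and a: "\<And>n. continuous_map (TA (m (Suc n))) (TB (k n)) (a n)"
    and step: "\<And>n u. u \<in> topspace (TA (m (Suc (Suc n)))) \<Longrightarrow> bond \<beta> (k n) (k (Suc n)) (a (Suc n) u) = a n (bond \<alpha> (m (Suc n)) (m (Suc (Suc n))) u)"
    and m: "mono m"
  defines "\<theta> \<equiv> \<lambda>u n. bond \<beta> n (k n) (a n (u (m (Suc n))))"
  shows "continuous_map (invlim_topology TA \<alpha>) (invlim_topology TB \<beta>) \<theta>"
    and "\<And>u n. u \<in> threads (\<lambda>n. topspace (TA n)) \<alpha> \<Longrightarrow> \<theta> u (k n) = a n (u (m (Suc n)))"
proof -
  let ?T = "threads (\<lambda>n. topspace (TA n)) \<alpha>"
  have uT: "u j \<in> topspace (TA j)" if "u \<in> ?T" for u j using that unfolding threads_def by blast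
  have rel: "bond \<beta> (k i) (k j) (a j (u (m (Suc j)))) = a i (u (m (Suc i)))" if u: "u \<in> ?T" and ij: "i \<le> j" for u i j
    using ij
  proof (induction j)
    case (Suc j)
    show ?case
    proof (cases "i = Suc j")
      case False
      then have ij: "i \<le> j" using Suc.prems by simp
      have le: "k i \<le> k j" "k j \<le> k (Suc j)" "m (Suc j) \<le> m (Suc (Suc j))" using k(1) m ij by (auto simp: monoD)
      have "bond \<beta> (k i) (k (Suc j)) (a (Suc j) (u (m (Suc (Suc j))))) =
          bond \<beta> (k i) (k j) (bond \<beta> (k j) (k (Suc j)) (a (Suc j) (u (m (Suc (Suc j))))))"
        using bond_bond[OF le(1,2), of \<beta>] by simp
      also have "bond \<beta> (k j) (k (Suc j)) (a (Suc j) (u (m (Suc (Suc j))))) = a j (u (m (Suc j)))"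
        using step[OF uT[OF u]] threads_bond[OF u le(3)] by simp
      finally show ?thesis using Suc.IH[OF ij] by simp
    qed simp
  qed simp
  show \<theta>k: "\<theta> u (k n) = a n (u (m (Suc n)))" if u: "u \<in> ?T" for u n
    unfolding \<theta>_def by (rule rel[OF u k(2)])
  have cont: "continuous_map (invlim_topology TA \<alpha>) (TB n) (\<lambda>u. \<theta> u n)" for n
    using continuous_map_compose[OF continuous_map_compose[OF continuous_map_invlim_proj[where X = TA and f = \<alpha> and n = "m (Suc n)"] a] continuous_map_bond[where X = TB and f = \<beta>, OF \<beta> k(2)]]
    unfolding \<theta>_def by (simp add: comp_def)
  then have \<theta>top: "\<theta> u n \<in> topspace (TB n)" if "u \<in> ?T" for u n
    using that unfolding continuous_map_def topspace_invlim by blast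
  have thread: "\<theta> u \<in> threads (\<lambda>n. topspace (TB n)) \<beta>" if u: "u \<in> ?T" for u
  proof -
    have "\<beta> (Suc n) (\<theta> u (Suc n)) = \<theta> u n" for n
    proof -
      have le: "n < k (Suc n)" "k n \<le> k (Suc n)" using k(2)[of "Suc n"] k(1) by (auto simp: monoD)
      have "\<beta> (Suc n) (\<theta> u (Suc n)) = bond \<beta> n (k (Suc n)) (a (Suc n) (u (m (Suc (Suc n)))))"
        unfolding \<theta>_def using bond_Suc_left[OF le(1), of \<beta>] by simp
      also have "\<dots> = bond \<beta> n (k n) (bond \<beta> (k n) (k (Suc n)) (a (Suc n) (u (m (Suc (Suc n))))))"
        using bond_bond[OF k(2) le(2), of \<beta>] by simp
      also have "\<dots> = \<theta> u n" unfolding \<theta>_def using rel[OF u, of n "Suc n"] by simp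
      finally show ?thesis .
    qed
    then show ?thesis using \<theta>top[OF u] unfolding threads_def by blast
  qed
  have "continuous_map (invlim_topology TA \<alpha>) (product_topology TB UNIV) \<theta>"
    unfolding continuous_map_componentwise using cont by auto
  then show "continuous_map (invlim_topology TA \<alpha>) (invlim_topology TB \<beta>) \<theta>"
    unfolding invlim_topology_def[of TB]
    by (rule continuous_map_into_subtopology) (use thread in \<open>auto simp: topspace_invlim\<close>)
qed

text \<open>As \<open>n \<le> m n\<close> and \<open>n \<le> k n\<close>, threads are determined by
  their entries at these levels, where the strictly commuting zigzag shows that the two limit maps
  are mutually inverse.\<close>

lemma invlim_interleaved_iso:
  assumes A: "\<And>n. compact_group (A n) (TA n)" and B: "\<And>n. compact_group (B n) (TB n)"
    and \<alpha>: "\<And>n. \<alpha> (Suc n) \<in> hom (A (Suc n)) (A n)" "\<And>n. continuous_map (TA (Suc n)) (TA n) (\<alpha> (Suc n))"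
    and \<beta>: "\<And>n. \<beta> (Suc n) \<in> hom (B (Suc n)) (B n)" "\<And>n. continuous_map (TB (Suc n)) (TB n) (\<beta> (Suc n))"
    and mk: "mono m" "mono k" "\<And>n. n \<le> m n" "\<And>n. n \<le> k n"
    and a: "\<And>n. a n \<in> hom (A (m (Suc n))) (B (k n))" "\<And>n. continuous_map (TA (m (Suc n))) (TB (k n)) (a n)"
    and b: "\<And>n. b n \<in> hom (B (k n)) (A (m n))" "\<And>n. continuous_map (TB (k n)) (TA (m n)) (b n)"
    and ba: "\<And>n u. u \<in> carrier (A (m (Suc n))) \<Longrightarrow> b n (a n u) = bond \<alpha> (m n) (m (Suc n)) u"
    and ab: "\<And>n v. v \<in> carrier (B (k (Suc n))) \<Longrightarrow> a n (b (Suc n) v) = bond \<beta> (k n) (k (Suc n)) v"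
  shows "topological_group_isomorphic (invlim_group A \<alpha>) (invlim_topology TA \<alpha>) (invlim_group B \<beta>) (invlim_topology TB \<beta>)"
proof -
  have tA: "topspace (TA n) = carrier (A n)" and tB: "topspace (TB n) = carrier (B n)" for n
    using compact_groupD(2)[OF A] compact_groupD(2)[OF B] .
  let ?TA = "threads (\<lambda>n. topspace (TA n)) \<alpha>" and ?TB = "threads (\<lambda>n. topspace (TB n)) \<beta>"
  define \<theta> where "\<theta> = (\<lambda>u n. bond \<beta> n (k n) (a n (u (m (Suc n)))))"
  \<comment> \<open>The shift to \<open>b (Suc n)\<close> gives maps from level
    \<open>k (Suc n)\<close> to level \<open>m (Suc n)\<close>, the shape that
    \<open>invlim_interleaved_map\<close> expects with the sequences exchanged.\<close>
  define \<eta> where "\<eta> = (\<lambda>v n. bond \<alpha> n (m (Suc n)) (b (Suc n) (v (k (Suc n)))))"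
  \<comment> \<open>Both sides equal \<open>a n (b (Suc n) (a (Suc n) u))\<close>.\<close>
  have stepa: "bond \<beta> (k n) (k (Suc n)) (a (Suc n) u) = a n (bond \<alpha> (m (Suc n)) (m (Suc (Suc n))) u)"
    if "u \<in> topspace (TA (m (Suc (Suc n))))" for n u
    using that ba[of u "Suc n"] ab[of "a (Suc n) u" n] hom_in_carrier[OF a(1)] unfolding tA by metis
  have stepb: "bond \<alpha> (m (Suc n)) (m (Suc (Suc n))) (b (Suc (Suc n)) v) = b (Suc n) (bond \<beta> (k (Suc n)) (k (Suc (Suc n))) v)"
    if "v \<in> topspace (TB (k (Suc (Suc n))))" for n v
    using that ab[of v "Suc n"] ba[of "b (Suc (Suc n)) v" "Suc n"] hom_in_carrier[OF b(1)] unfolding tB by metis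
  have \<theta>: "continuous_map (invlim_topology TA \<alpha>) (invlim_topology TB \<beta>) \<theta>"
    "\<And>u n. u \<in> ?TA \<Longrightarrow> \<theta> u (k n) = a n (u (m (Suc n)))"
    using invlim_interleaved_map[where \<beta> = \<beta> and TB = TB and \<alpha> = \<alpha> and a = a, OF \<beta>(2) mk(2,4) a(2) stepa mk(1)]
    unfolding \<theta>_def by blast+
  have ms: "mono (\<lambda>n. m (Suc n))" "\<And>n. n \<le> m (Suc n)"
    using mk(1) Suc_leD[OF mk(3)] by (auto simp: mono_def)
  have \<eta>: "continuous_map (invlim_topology TB \<beta>) (invlim_topology TA \<alpha>) \<eta>"
    "\<And>v n. v \<in> ?TB \<Longrightarrow> \<eta> v (m (Suc n)) = b (Suc n) (v (k (Suc n)))"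
    using invlim_interleaved_map[where \<beta> = \<alpha> and TB = TA and TA = TB and \<alpha> = \<beta> and a = "\<lambda>n. b (Suc n)" and k = "\<lambda>n. m (Suc n)" and m = k,
        OF \<alpha>(2) ms b(2) stepb mk(2)]
    unfolding \<eta>_def by blast+
  have \<theta>T: "\<theta> u \<in> ?TB" if "u \<in> ?TA" for u
    using \<theta>(1) that unfolding continuous_map_def topspace_invlim by blast
  have \<eta>T: "\<eta> v \<in> ?TA" if "v \<in> ?TB" for v
    using \<eta>(1) that unfolding continuous_map_def topspace_invlim by blast
  have \<eta>\<theta>: "\<eta> (\<theta> u) = u" if u: "u \<in> ?TA" for u
  proof
    fix n
    have uc: "u (m (Suc (Suc n))) \<in> carrier (A (m (Suc (Suc n))))" using u unfolding threads_def tA by blast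
    have le: "m (Suc n) \<le> m (Suc (Suc n))" using mk(1) by (simp add: monoD)
    have "\<eta> (\<theta> u) n = bond \<alpha> n (m (Suc n)) (b (Suc n) (a (Suc n) (u (m (Suc (Suc n))))))"
      unfolding \<eta>_def using \<theta>(2)[OF u] by simp
    also have "\<dots> = bond \<alpha> n (m (Suc n)) (u (m (Suc n)))" using ba[OF uc] threads_bond[OF u le] by simp
    also have "\<dots> = u n" by (rule threads_bond[OF u ms(2)])
    finally show "\<eta> (\<theta> u) n = u n" .
  qed
  have \<theta>\<eta>: "\<theta> (\<eta> v) = v" if v: "v \<in> ?TB" for v
  proof
    fix n
    have vc: "v (k (Suc n)) \<in> carrier (B (k (Suc n)))" using v unfolding threads_def tB by blast
    have le: "k n \<le> k (Suc n)" using mk(2) by (simp add: monoD)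
    have "\<theta> (\<eta> v) n = bond \<beta> n (k n) (a n (b (Suc n) (v (k (Suc n)))))"
      unfolding \<theta>_def using \<eta>(2)[OF v] by simp
    also have "\<dots> = bond \<beta> n (k n) (v (k n))" using ab[OF vc] threads_bond[OF v le] by simp
    also have "\<dots> = v n" by (rule threads_bond[OF v mk(4)])
    finally show "\<theta> (\<eta> v) n = v n" .
  qed
  have maps: "homeomorphic_maps (invlim_topology TA \<alpha>) (invlim_topology TB \<beta>) \<theta> \<eta>"
    unfolding homeomorphic_maps_def topspace_invlim using \<theta>(1) \<eta>(1) \<eta>\<theta> \<theta>\<eta> by blast
  then have homeo: "homeomorphic_map (invlim_topology TA \<alpha>) (invlim_topology TB \<beta>) \<theta>"
    unfolding homeomorphic_map_maps by blast
  have carA: "carrier (invlim_group A \<alpha>) = ?TA" and carB: "carrier (invlim_group B \<beta>) = ?TB"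
    unfolding invlim_group_def tA tB by simp_all
  have "\<theta> \<in> hom (invlim_group A \<alpha>) (invlim_group B \<beta>)"
  proof (rule homI)
    fix u assume u: "u \<in> carrier (invlim_group A \<alpha>)"
    then show "\<theta> u \<in> carrier (invlim_group B \<beta>)" unfolding carA carB by (rule \<theta>T)
    fix v assume v: "v \<in> carrier (invlim_group A \<alpha>)"
    show "\<theta> (u \<otimes>\<^bsub>invlim_group A \<alpha>\<^esub> v) = \<theta> u \<otimes>\<^bsub>invlim_group B \<beta>\<^esub> \<theta> v"
    proof
      fix n
      have uv: "u (m (Suc n)) \<in> carrier (A (m (Suc n)))" "v (m (Suc n)) \<in> carrier (A (m (Suc n)))"
        using u v unfolding carA threads_def tA by blast+
      have bh: "bond \<beta> n (k n) \<in> hom (B (k n)) (B n)"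
        by (rule bond_hom[where A = B, OF compact_groupD(1)[OF B] \<beta>(1) mk(4)])
      have "\<theta> (u \<otimes>\<^bsub>invlim_group A \<alpha>\<^esub> v) n = bond \<beta> n (k n) (a n (u (m (Suc n)) \<otimes>\<^bsub>A (m (Suc n))\<^esub> v (m (Suc n))))"
        unfolding \<theta>_def invlim_group_def by simp
      also have "\<dots> = bond \<beta> n (k n) (a n (u (m (Suc n)))) \<otimes>\<^bsub>B n\<^esub> bond \<beta> n (k n) (a n (v (m (Suc n))))"
        using hom_mult[OF a(1) uv] hom_mult[OF bh] hom_in_carrier[OF a(1)] uv by simp
      also have "\<dots> = (\<theta> u \<otimes>\<^bsub>invlim_group B \<beta>\<^esub> \<theta> v) n" unfolding \<theta>_def invlim_group_def by simp
      finally show "\<theta> (u \<otimes>\<^bsub>invlim_group A \<alpha>\<^esub> v) n = (\<theta> u \<otimes>\<^bsub>invlim_group B \<beta>\<^esub> \<theta> v) n" .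
    qed
  qed
  moreover have "bij_betw \<theta> (carrier (invlim_group A \<alpha>)) (carrier (invlim_group B \<beta>))"
    unfolding carA carB by (rule bij_betw_byWitness[of _ \<eta>]) (use \<eta>\<theta> \<theta>\<eta> \<theta>T \<eta>T in auto)
  ultimately have "\<theta> \<in> iso (invlim_group A \<alpha>) (invlim_group B \<beta>)" unfolding iso_def by blast
  then show ?thesis using homeo unfolding topological_group_isomorphic_def by blast
qed

section \<open>Invariance of the profinite fundamental group\<close>

context CW_inverse_limit
begin

lemma profinite_pi1_bond_Suc:
  "profinite_pi1_bond \<Gamma> \<sigma> x (Suc n) = induced_profinite (\<pi> (Suc n)) (\<pi> n) (induced_fundamental (\<Gamma> n) (x n) (\<sigma> (Suc n)))"
  unfolding profinite_pi1_bond_def by simp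

lemma \<sigma>_hom: "induced_fundamental (\<Gamma> n) (x n) (\<sigma> (Suc n)) \<in> hom (\<pi> (Suc n)) (\<pi> n)"
  by (rule induced_fundamental_hom[OF cont base(2)])

text \<open>Functoriality of completion, iterated along the sequence. Equality of levels is a case
  of its own: there the homomorphism induced by \<open>id\<close> is the identity on the
  carrier.\<close>

lemma bond_profinite:
  assumes "n \<le> m" "u \<in> carrier (profinite_completion (\<pi> m))"
  shows "bond (profinite_pi1_bond \<Gamma> \<sigma> x) n m u = induced_profinite (\<pi> m) (\<pi> n) (\<beta> n m) u"
proof -
  have refl: "bond (profinite_pi1_bond \<Gamma> \<sigma> x) n n u = induced_profinite (\<pi> n) (\<pi> n) (\<beta> n n) u"
    if "u \<in> carrier (profinite_completion (\<pi> n))" for n u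
  proof -
    have "\<beta> n n g = g" if "g \<in> carrier (\<pi> n)" for g using induced_fundamental_id[OF that] by simp
    from induced_profinite_id[OF group_\<pi> \<beta>_hom[OF le_refl] this that] show ?thesis by simp
  qed
  show ?thesis using assms
  proof (induction m arbitrary: u)
    case 0
    then have "n = 0" by simp
    show ?case unfolding \<open>n = 0\<close> by (rule refl) (rule 0(2))
  next
    case (Suc m)
    show ?case
    proof (cases "n = Suc m")
      case True
      show ?thesis unfolding True by (rule refl) (rule Suc.prems(2))
    next
      case False
      then have n: "n \<le> m" using Suc.prems by simp
      let ?s = "induced_fundamental (\<Gamma> m) (x m) (\<sigma> (Suc m))"
      have v: "induced_profinite (\<pi> (Suc m)) (\<pi> m) ?s u \<in> carrier (profinite_completion (\<pi> m))"
        by (rule induced_profinite_closed[OF group_\<pi> group_\<pi> \<sigma>_hom Suc.prems(2)])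
      have "bond (profinite_pi1_bond \<Gamma> \<sigma> x) n (Suc m) u = induced_profinite (\<pi> m) (\<pi> n) (\<beta> n m) (induced_profinite (\<pi> (Suc m)) (\<pi> m) ?s u)"
        unfolding bond_Suc_right[OF n] profinite_pi1_bond_Suc using Suc.IH[OF n v] by simp
      also have "\<dots> = induced_profinite (\<pi> (Suc m)) (\<pi> n) (\<beta> n (Suc m)) u"
      proof (rule induced_profinite_comp[OF group_\<pi> group_\<pi> group_\<pi> \<sigma>_hom \<beta>_hom[OF n] Suc.prems(2) \<beta>_hom[OF Suc.prems(1)]])
        fix g assume "g \<in> carrier (\<pi> (Suc m))"
        from induced_fundamental_comp[OF cont continuous_bond[OF n] base(2) bond_base[OF n] this]
        show "\<beta> n (Suc m) g = \<beta> n m (?s g)" unfolding bond_Suc_right[OF n] by simp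
      qed
      finally show ?thesis .
    qed
  qed
qed

end

lemma CW_inverse_limits_isomorphic:
  assumes L: "CW_inverse_limit X \<Gamma> \<sigma> p x \<kappa>" and L': "CW_inverse_limit X \<Gamma>' \<sigma>' p' x' \<kappa>'"
  shows "topological_group_isomorphic (profinite_pi1 \<Gamma> \<sigma> x) (profinite_pi1_topology \<Gamma> \<sigma> x)
    (profinite_pi1 \<Gamma>' \<sigma>' x') (profinite_pi1_topology \<Gamma>' \<sigma>' x')"
proof -
  interpret L: CW_inverse_limit X \<Gamma> \<sigma> p x \<kappa> by fact
  interpret L': CW_inverse_limit X \<Gamma>' \<sigma>' p' x' \<kappa>' by fact
  \<comment> \<open>The state after \<open>n\<close> rounds: two levels, both at least
    \<open>n\<close>, and a homomorphism from the second sequence to the first that relates their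
    stage cocycles. The cohomology is part of the state since \<open>zigzag_step\<close> starts from
    it.\<close>
  define Good where "Good n = (\<lambda>(m, k, \<psi>). n \<le> m \<and> n \<le> k \<and> \<psi> \<in> hom (L'.\<pi> k) (L.\<pi> m) \<and>
    cohomologous X (L.\<pi> m) (\<lambda>S S'. \<psi> (L'.stage_cocycle k S S')) (L.stage_cocycle m))" for n :: nat
  \<comment> \<open>One round consists of two zigzag steps, across by \<open>\<phi>\<close> and back
    by \<open>\<psi>'\<close>; the intermediate \<open>\<phi>\<close> and the two conjugating
    elements are recovered later by choice.\<close>
  define Step where "Step = (\<lambda>(m, k, \<psi>) (m', k', \<psi>'). m \<le> m' \<and> k \<le> k' \<and>
    (\<exists>\<phi> g h. \<phi> \<in> hom (L.\<pi> m') (L'.\<pi> k) \<and> g \<in> carrier (L.\<pi> m) \<and> h \<in> carrier (L'.\<pi> k) \<and>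
      (\<forall>A\<in>carrier (L.\<pi> m'). \<psi> (\<phi> A) = g \<otimes>\<^bsub>L.\<pi> m\<^esub> L.\<beta> m m' A \<otimes>\<^bsub>L.\<pi> m\<^esub> inv\<^bsub>L.\<pi> m\<^esub> g) \<and>
      (\<forall>A\<in>carrier (L'.\<pi> k'). \<phi> (\<psi>' A) = h \<otimes>\<^bsub>L'.\<pi> k\<^esub> L'.\<beta> k k' A \<otimes>\<^bsub>L'.\<pi> k\<^esub> inv\<^bsub>L'.\<pi> k\<^esub> h)))"
  have ex0: "\<exists>q. Good 0 q"
  proof -
    obtain k \<psi> where "0 \<le> k" "\<psi> \<in> hom (L'.\<pi> k) (L.\<pi> 0)"
      "cohomologous X (L.\<pi> 0) (\<lambda>S S'. \<psi> (L'.stage_cocycle k S S')) (L.stage_cocycle 0)"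
      by (rule L'.stage_hom_exists[OF L.group_\<pi> L.cocycle_stage, of 0]) (rule that)
    then have "Good 0 (0, k, \<psi>)" unfolding Good_def by simp
    then show ?thesis by blast
  qed
  have exS: "\<exists>q'. Good (Suc n) q' \<and> Step q q'" if q: "Good n q" for n q
  proof -
    obtain m k \<psi> where mk: "q = (m, k, \<psi>)" by (cases q)
    have \<psi>: "\<psi> \<in> hom (L'.\<pi> k) (L.\<pi> m)"
      "cohomologous X (L.\<pi> m) (\<lambda>S S'. \<psi> (L'.stage_cocycle k S S')) (L.stage_cocycle m)"
      using q unfolding mk Good_def by auto
    obtain m' \<phi> g where m': "Suc n \<le> m'" "m \<le> m'" "\<phi> \<in> hom (L.\<pi> m') (L'.\<pi> k)"
      "cohomologous X (L'.\<pi> k) (\<lambda>S S'. \<phi> (L.stage_cocycle m' S S')) (L'.stage_cocycle k)"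
      "g \<in> carrier (L.\<pi> m)"
      "\<And>A. A \<in> carrier (L.\<pi> m') \<Longrightarrow> \<psi> (\<phi> A) = g \<otimes>\<^bsub>L.\<pi> m\<^esub> L.\<beta> m m' A \<otimes>\<^bsub>L.\<pi> m\<^esub> inv\<^bsub>L.\<pi> m\<^esub> g"
      by (rule zigzag_step[OF L L' \<psi>, of "Suc n"]) (rule that)
    obtain k' \<psi>' h where k': "Suc n \<le> k'" "k \<le> k'" "\<psi>' \<in> hom (L'.\<pi> k') (L.\<pi> m')"
      "cohomologous X (L.\<pi> m') (\<lambda>S S'. \<psi>' (L'.stage_cocycle k' S S')) (L.stage_cocycle m')"
      "h \<in> carrier (L'.\<pi> k)"
      "\<And>A. A \<in> carrier (L'.\<pi> k') \<Longrightarrow> \<phi> (\<psi>' A) = h \<otimes>\<^bsub>L'.\<pi> k\<^esub> L'.\<beta> k k' A \<otimes>\<^bsub>L'.\<pi> k\<^esub> inv\<^bsub>L'.\<pi> k\<^esub> h"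
      by (rule zigzag_step[OF L' L m'(3,4), of "Suc n"]) (rule that)
    have "Good (Suc n) (m', k', \<psi>')" unfolding Good_def using m'(1) k' by simp
    moreover have "Step q (m', k', \<psi>')" unfolding mk Step_def prod.case using m' k' by blast
    ultimately show ?thesis by blast
  qed
  obtain q where q: "\<And>n. Good n (q n)" "\<And>n. Step (q n) (q (Suc n))"
    using dependent_nat_choice[of Good "\<lambda>_. Step", OF ex0 exS] by blast
  define m k \<psi> where "m n = fst (q n)" and "k n = fst (snd (q n))" and "\<psi> n = snd (snd (q n))" for n
  have qe: "q n = (m n, k n, \<psi> n)" for n unfolding m_def k_def \<psi>_def by simp
  have good: "n \<le> m n" "n \<le> k n" "\<psi> n \<in> hom (L'.\<pi> (k n)) (L.\<pi> (m n))" for n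
    using q(1)[of n] unfolding qe Good_def by auto
  have le: "m n \<le> m (Suc n)" "k n \<le> k (Suc n)" for n using q(2)[of n] unfolding qe Step_def by auto
  have "\<exists>\<phi> g h. \<phi> \<in> hom (L.\<pi> (m (Suc n))) (L'.\<pi> (k n)) \<and> g \<in> carrier (L.\<pi> (m n)) \<and> h \<in> carrier (L'.\<pi> (k n)) \<and>
      (\<forall>A\<in>carrier (L.\<pi> (m (Suc n))). \<psi> n (\<phi> A) = g \<otimes>\<^bsub>L.\<pi> (m n)\<^esub> L.\<beta> (m n) (m (Suc n)) A \<otimes>\<^bsub>L.\<pi> (m n)\<^esub> inv\<^bsub>L.\<pi> (m n)\<^esub> g) \<and>
      (\<forall>A\<in>carrier (L'.\<pi> (k (Suc n))). \<phi> (\<psi> (Suc n) A) = h \<otimes>\<^bsub>L'.\<pi> (k n)\<^esub> L'.\<beta> (k n) (k (Suc n)) A \<otimes>\<^bsub>L'.\<pi> (k n)\<^esub> inv\<^bsub>L'.\<pi> (k n)\<^esub> h)" for n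
    using q(2)[of n] unfolding qe Step_def prod.case by (elim conjE)
  then obtain \<phi> g h where \<phi>: "\<And>n. \<phi> n \<in> hom (L.\<pi> (m (Suc n))) (L'.\<pi> (k n))"
    and g: "\<And>n. g n \<in> carrier (L.\<pi> (m n))" and h: "\<And>n. h n \<in> carrier (L'.\<pi> (k n))"
    and \<psi>\<phi>: "\<And>n A. A \<in> carrier (L.\<pi> (m (Suc n))) \<Longrightarrow> \<psi> n (\<phi> n A) = g n \<otimes>\<^bsub>L.\<pi> (m n)\<^esub> L.\<beta> (m n) (m (Suc n)) A \<otimes>\<^bsub>L.\<pi> (m n)\<^esub> inv\<^bsub>L.\<pi> (m n)\<^esub> g n"
    and \<phi>\<psi>: "\<And>n A. A \<in> carrier (L'.\<pi> (k (Suc n))) \<Longrightarrow> \<phi> n (\<psi> (Suc n) A) = h n \<otimes>\<^bsub>L'.\<pi> (k n)\<^esub> L'.\<beta> (k n) (k (Suc n)) A \<otimes>\<^bsub>L'.\<pi> (k n)\<^esub> inv\<^bsub>L'.\<pi> (k n)\<^esub> h n"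
    by metis
  let ?A = "\<lambda>n. profinite_completion (L.\<pi> n)" and ?B = "\<lambda>n. profinite_completion (L'.\<pi> n)"
  let ?TA = "\<lambda>n. profinite_topology (L.\<pi> n)" and ?TB = "\<lambda>n. profinite_topology (L'.\<pi> n)"
  let ?\<alpha> = "profinite_pi1_bond \<Gamma> \<sigma> x" and ?\<beta> = "profinite_pi1_bond \<Gamma>' \<sigma>' x'"
  let ?a = "\<lambda>n. induced_profinite (L.\<pi> (m (Suc n))) (L'.\<pi> (k n)) (\<phi> n)"
  let ?b = "\<lambda>n. induced_profinite (L'.\<pi> (k n)) (L.\<pi> (m n)) (\<psi> n)"
  have cA: "compact_group (?A n) (?TA n)" and cB: "compact_group (?B n) (?TB n)" for n
    by (rule compact_group_profinite[OF L.group_\<pi>], rule compact_group_profinite[OF L'.group_\<pi>])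
  have \<alpha>h: "?\<alpha> (Suc n) \<in> hom (?A (Suc n)) (?A n)" and \<beta>h: "?\<beta> (Suc n) \<in> hom (?B (Suc n)) (?B n)" for n
    unfolding L.profinite_pi1_bond_Suc L'.profinite_pi1_bond_Suc
    by (rule induced_profinite_hom[OF L.group_\<pi> L.group_\<pi> L.\<sigma>_hom], rule induced_profinite_hom[OF L'.group_\<pi> L'.group_\<pi> L'.\<sigma>_hom])
  have \<alpha>c: "continuous_map (?TA (Suc n)) (?TA n) (?\<alpha> (Suc n))" and \<beta>c: "continuous_map (?TB (Suc n)) (?TB n) (?\<beta> (Suc n))" for n
    unfolding L.profinite_pi1_bond_Suc L'.profinite_pi1_bond_Suc
    by (rule continuous_map_induced_profinite[OF L.group_\<pi> L.group_\<pi> L.\<sigma>_hom],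
        rule continuous_map_induced_profinite[OF L'.group_\<pi> L'.group_\<pi> L'.\<sigma>_hom])
  have ba: "?b n (?a n u) = to_profinite (L.\<pi> (m n)) (g n) \<otimes>\<^bsub>?A (m n)\<^esub> bond ?\<alpha> (m n) (m (Suc n)) u
      \<otimes>\<^bsub>?A (m n)\<^esub> inv\<^bsub>?A (m n)\<^esub> to_profinite (L.\<pi> (m n)) (g n)" if u: "u \<in> carrier (?A (m (Suc n)))" for n u
  proof -
    have comp: "\<psi> n \<circ> \<phi> n \<in> hom (L.\<pi> (m (Suc n))) (L.\<pi> (m n))"
      using hom_compose[OF \<phi> good(3)] by (simp add: compose_def)
    have "?b n (?a n u) = induced_profinite (L.\<pi> (m (Suc n))) (L.\<pi> (m n)) (\<psi> n \<circ> \<phi> n) u"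
      by (rule induced_profinite_comp[OF L.group_\<pi> L'.group_\<pi> L.group_\<pi> \<phi> good(3) u comp]) simp
    also have "\<dots> = to_profinite (L.\<pi> (m n)) (g n) \<otimes>\<^bsub>?A (m n)\<^esub> induced_profinite (L.\<pi> (m (Suc n))) (L.\<pi> (m n)) (L.\<beta> (m n) (m (Suc n))) u
      \<otimes>\<^bsub>?A (m n)\<^esub> inv\<^bsub>?A (m n)\<^esub> to_profinite (L.\<pi> (m n)) (g n)"
      by (rule induced_profinite_conj[OF L.group_\<pi> L.group_\<pi> L.\<beta>_hom[OF le(1)] comp g _ u]) (simp add: \<psi>\<phi>)
    finally show ?thesis unfolding L.bond_profinite[OF le(1) u] .
  qed
  have ab: "?a n (?b (Suc n) v) = to_profinite (L'.\<pi> (k n)) (h n) \<otimes>\<^bsub>?B (k n)\<^esub> bond ?\<beta> (k n) (k (Suc n)) v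
      \<otimes>\<^bsub>?B (k n)\<^esub> inv\<^bsub>?B (k n)\<^esub> to_profinite (L'.\<pi> (k n)) (h n)" if v: "v \<in> carrier (?B (k (Suc n)))" for n v
  proof -
    have comp: "\<phi> n \<circ> \<psi> (Suc n) \<in> hom (L'.\<pi> (k (Suc n))) (L'.\<pi> (k n))"
      using hom_compose[OF good(3) \<phi>] by (simp add: compose_def)
    have "?a n (?b (Suc n) v) = induced_profinite (L'.\<pi> (k (Suc n))) (L'.\<pi> (k n)) (\<phi> n \<circ> \<psi> (Suc n)) v"
      by (rule induced_profinite_comp[OF L'.group_\<pi> L.group_\<pi> L'.group_\<pi> good(3) \<phi> v comp]) simp
    also have "\<dots> = to_profinite (L'.\<pi> (k n)) (h n) \<otimes>\<^bsub>?B (k n)\<^esub> induced_profinite (L'.\<pi> (k (Suc n))) (L'.\<pi> (k n)) (L'.\<beta> (k n) (k (Suc n))) v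
      \<otimes>\<^bsub>?B (k n)\<^esub> inv\<^bsub>?B (k n)\<^esub> to_profinite (L'.\<pi> (k n)) (h n)"
      by (rule induced_profinite_conj[OF L'.group_\<pi> L'.group_\<pi> L'.\<beta>_hom[OF le(2)] comp h _ v]) (simp add: \<phi>\<psi>)
    finally show ?thesis unfolding L'.bond_profinite[OF le(2) v] .
  qed
  have bondA: "bond ?\<alpha> (m n) (m (Suc n)) \<in> carrier (?A (m (Suc n))) \<rightarrow> carrier (?A (m n))" for n
    using bond_hom[where A = ?A and \<alpha> = ?\<alpha>, OF compact_groupD(1)[OF cA] \<alpha>h le(1)] unfolding hom_def by blast
  have bondB: "bond ?\<beta> (k n) (k (Suc n)) \<in> carrier (?B (k (Suc n))) \<rightarrow> carrier (?B (k n))" for n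
    using bond_hom[where A = ?B and \<alpha> = ?\<beta>, OF compact_groupD(1)[OF cB] \<beta>h le(2)] unfolding hom_def by blast
  have ah: "?a n \<in> hom (?A (m (Suc n))) (?B (k n))" for n by (rule induced_profinite_hom[OF L.group_\<pi> L'.group_\<pi> \<phi>])
  have bh: "?b n \<in> hom (?B (k n)) (?A (m n))" for n by (rule induced_profinite_hom[OF L'.group_\<pi> L.group_\<pi> good(3)])
  have ac: "continuous_map (?TA (m (Suc n))) (?TB (k n)) (?a n)" for n by (rule continuous_map_induced_profinite[OF L.group_\<pi> L'.group_\<pi> \<phi>])
  have bc: "continuous_map (?TB (k n)) (?TA (m n)) (?b n)" for n by (rule continuous_map_induced_profinite[OF L'.group_\<pi> L.group_\<pi> good(3)])
  have sc: "to_profinite (L.\<pi> (m n)) (g n) \<in> carrier (?A (m n))" for n by (rule to_profinite_closed[OF L.group_\<pi> g])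
  have tc: "to_profinite (L'.\<pi> (k n)) (h n) \<in> carrier (?B (k n))" for n by (rule to_profinite_closed[OF L'.group_\<pi> h])
  obtain a' b' where ab': "\<And>n. a' n \<in> hom (?A (m (Suc n))) (?B (k n))" "\<And>n. continuous_map (?TA (m (Suc n))) (?TB (k n)) (a' n)"
    "\<And>n. b' n \<in> hom (?B (k n)) (?A (m n))" "\<And>n. continuous_map (?TB (k n)) (?TA (m n)) (b' n)"
    "\<And>n u. u \<in> carrier (?A (m (Suc n))) \<Longrightarrow> b' n (a' n u) = bond ?\<alpha> (m n) (m (Suc n)) u"
    "\<And>n v. v \<in> carrier (?B (k (Suc n))) \<Longrightarrow> a' n (b' (Suc n) v) = bond ?\<beta> (k n) (k (Suc n)) v"
    by (rule rectify_zigzag[where A = "\<lambda>n. ?A (m n)" and B = "\<lambda>n. ?B (k n)" and TA = "\<lambda>n. ?TA (m n)" and TB = "\<lambda>n. ?TB (k n)"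
        and \<alpha> = "\<lambda>n. bond ?\<alpha> (m n) (m (Suc n))" and \<beta> = "\<lambda>n. bond ?\<beta> (k n) (k (Suc n))" and a = ?a and b = ?b
        and s = "\<lambda>n. to_profinite (L.\<pi> (m n)) (g n)" and t = "\<lambda>n. to_profinite (L'.\<pi> (k n)) (h n)",
        OF cA cB bondA bondB ah ac bh bc sc ba tc ab], assumption, assumption) (rule that)
  have mono: "mono m" "mono k" using le by (auto simp: mono_iff_le_Suc)
  show ?thesis
    unfolding profinite_pi1_def profinite_pi1_topology_def
    by (rule invlim_interleaved_iso[where A = ?A and B = ?B and TA = ?TA and TB = ?TB and m = m and k = k and a = a' and b = b'])
       (fact cA cB \<alpha>h \<beta>h \<alpha>c \<beta>c mono good ab')+
qed

lemma CW_inverse_limit_of_presentation: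
  assumes "approximant_presentation T \<Gamma> \<sigma> x" "X homeomorphic_space hull_topology T"
  obtains p \<kappa> where "CW_inverse_limit X \<Gamma> \<sigma> p x \<kappa>"
proof -
  have CW: "\<And>n. finite_CW_complex (\<Gamma> n)" "\<And>n. connected_space (\<Gamma> n)"
    and cont: "\<And>n. continuous_map (\<Gamma> (Suc n)) (\<Gamma> n) (\<sigma> (Suc n))"
    and base: "\<And>n. x n \<in> topspace (\<Gamma> n)" "\<And>n. \<sigma> (Suc n) (x (Suc n)) = x n"
    using assms(1) unfolding approximant_presentation_def by blast+
  obtain p0 where p0: "homeomorphic_map (hull_topology T) (invlim_topology \<Gamma> \<sigma>) p0"
    using assms(1) unfolding approximant_presentation_def by blast
  obtain h where h: "homeomorphic_map X (hull_topology T) h"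
    using assms(2) unfolding homeomorphic_space by blast
  have p: "homeomorphic_map X (invlim_topology \<Gamma> \<sigma>) (p0 \<circ> h)" by (rule homeomorphic_map_compose[OF h p0])
  note facts = finite_CW_complex_properties[OF CW(1)]
  have "\<exists>\<kappa>. universal_cocycle (\<Gamma> n) (x n) \<kappa>" for n
    using universal_cocycle_exists[OF facts(1,2) CW(2) facts(3,4) base(1)] by blast
  then obtain \<kappa> where \<kappa>: "\<And>n. universal_cocycle (\<Gamma> n) (x n) (\<kappa> n)" by metis
  have "CW_inverse_limit X \<Gamma> \<sigma> (p0 \<circ> h) x \<kappa>"
    by unfold_locales (fact facts cont p base \<kappa>)+
  then show thesis by (rule that)
qed

text \<open>The homeomorphism of the hulls turns the second presentation into one of the first hull,
  so both live on the same space.\<close>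

lemma presentations_isomorphic:
  assumes "approximant_presentation T \<Gamma> \<sigma> x" "approximant_presentation T' \<Gamma>' \<sigma>' x'"
    "hull_topology T homeomorphic_space hull_topology T'"
  shows "topological_group_isomorphic (profinite_pi1 \<Gamma> \<sigma> x) (profinite_pi1_topology \<Gamma> \<sigma> x)
    (profinite_pi1 \<Gamma>' \<sigma>' x') (profinite_pi1_topology \<Gamma>' \<sigma>' x')"
proof -
  obtain p \<kappa> where L: "CW_inverse_limit (hull_topology T) \<Gamma> \<sigma> p x \<kappa>"
    by (rule CW_inverse_limit_of_presentation[OF assms(1) homeomorphic_space_refl])
  obtain p' \<kappa>' where L': "CW_inverse_limit (hull_topology T) \<Gamma>' \<sigma>' p' x' \<kappa>'"
    by (rule CW_inverse_limit_of_presentation[OF assms(2,3)])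
  show ?thesis by (rule CW_inverse_limits_isomorphic[OF L L'])
qed

text \<open>The first claim compares different hulls through a homeomorphism; for the second, the
  two presentations belong to one hull and the identity is used, while the type of points of the new
  stages remains free.\<close>

theorem corollary4p20:
  fixes T :: "('a::euclidean_space, 'l) tile set"
    and T' :: "('b::euclidean_space, 'm) tile set"
    and \<Gamma> :: "nat \<Rightarrow> 'p topology" and \<sigma> :: "nat \<Rightarrow> 'p \<Rightarrow> 'p" and x :: "nat \<Rightarrow> 'p"
    and \<Gamma>' :: "nat \<Rightarrow> 'q topology" and \<sigma>' :: "nat \<Rightarrow> 'q \<Rightarrow> 'q" and x' :: "nat \<Rightarrow> 'q"
  assumes "tiling T" "finite_local_complexity T" "repetitive T"
    and "tiling T'" "finite_local_complexity T'" "repetitive T'"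
    and "approximant_presentation T \<Gamma> \<sigma> x"
    and "approximant_presentation T' \<Gamma>' \<sigma>' x'"
  shows "(hull_topology T homeomorphic_space hull_topology T' \<longrightarrow>
            topological_group_isomorphic
              (profinite_pi1 \<Gamma> \<sigma> x) (profinite_pi1_topology \<Gamma> \<sigma> x)
              (profinite_pi1 \<Gamma>' \<sigma>' x') (profinite_pi1_topology \<Gamma>' \<sigma>' x')) \<and>
         (\<forall>(\<Gamma>'' :: nat \<Rightarrow> 'r topology) \<sigma>'' x''. approximant_presentation T \<Gamma>'' \<sigma>'' x'' \<longrightarrow>
            topological_group_isomorphic
              (profinite_pi1 \<Gamma> \<sigma> x) (profinite_pi1_topology \<Gamma> \<sigma> x)
              (profinite_pi1 \<Gamma>'' \<sigma>'' x'') (profinite_pi1_topology \<Gamma>'' \<sigma>'' x''))"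
  using presentations_isomorphic[OF assms(7,8)] presentations_isomorphic[OF assms(7) _ homeomorphic_space_refl]
  by blast

end
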